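(* Let $(A,\mathfrak n,k)$ be a Noetherian local ring of prime characteristic $p>0$ and of dimension $t$, and let $\mathfrak q$ be an ideal of $A$ generated by a system of parameters of $A$. Let $\eta\colon A\to Q$ and $\theta\colon Q\to B$ be local ring homomorphisms of Noetherian local rings of characteristic $p$ such that $Q$ is a regular local ring of dimension $t$, $\theta$ is surjective, and $\eta$ induces an isomorphism between the residue fields of $A$ and $Q$. Set $\delta=\theta\eta\colon A\to B$ and $d=\ell(B/\mathfrak q^*B)$ (assumed finite), where $\mathfrak q^*B$ denotes the ideal of $B$ generated by $\delta(\mathfrak q^* )$. Assume that for some integer $q=p^e$ with $q>d^t t^{t-1}$ we have $\ell(B/\mathfrak q^{[q]}B)\geq \ell(A/\mathfrak q^{[q]})$, and that the ideal $\mathfrak q^{[q]}$ of $A$ is tightly closed, i.e. $(\mathfrak q^{[q]})^*=\mathfrak q^{[q]}$. Then the canonical homomorphism $\pi\colon Q/\mathfrak q^*Q\to B/\mathfrak q^*B$ induced by $\theta$ is an isomorphism (here $\mathfrak q^*Q$ is the ideal of $Q$ generated by $\eta(\mathfrak q^* )$). Moreover, if in addition $A$ is equidimensional and a homomorphic image of a Cohen–Macaulay ring, then $\mathfrak q^*=\mathfrak q$ and $\pi\colon Q/\mathfrak qQ\to B/\mathfrak qB$ is an isomorphism between complete intersection rings.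
   Context: All rings are commutative and Noetherian of characteristic $p>0$; $\ell(\cdot)$ denotes length. For a ring $R$, $R^0$ is the complement of the union of the minimal primes of $R$. For an ideal $J$ and $q=p^e$, $J^{[q]}$ is the ideal generated by the $q$-th powers of elements of $J$ (equivalently of a generating set of $J$). The tight closure $J^*$ of $J$ is the set of $x\in R$ such that there is $c\in R^0$ with $cx^{q}\in J^{[q]}$ for all sufficiently large $q=p^e$; $J$ is tightly closed if $J^*=J$. *)

theory Defs
  imports "HOL-Algebra.Algebra" "HOL-Library.Extended_Nat"
begin

definition ring_char :: "('a, 'm) ring_scheme \<Rightarrow> nat" where
  "ring_char R = (if \<exists>n::nat. n > 0 \<and> [n] \<cdot>\<^bsub>R\<^esub> \<one>\<^bsub>R\<^esub> = \<zero>\<^bsub>R\<^esub>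
                  then (LEAST n::nat. n > 0 \<and> [n] \<cdot>\<^bsub>R\<^esub> \<one>\<^bsub>R\<^esub> = \<zero>\<^bsub>R\<^esub>) else 0)"

definition local_ring :: "('a, 'm) ring_scheme \<Rightarrow> bool" where
  "local_ring R \<longleftrightarrow> cring R \<and> (\<exists>!m. maximalideal m R)"

definition max_ideal :: "('a, 'm) ring_scheme \<Rightarrow> 'a set" where
  "max_ideal R = (THE m. maximalideal m R)"

definition noetherian_local_ring :: "('a, 'm) ring_scheme \<Rightarrow> bool" where
  "noetherian_local_ring R \<longleftrightarrow> noetherian_ring R \<and> local_ring R"

definition local_hom :: "('a, 'm) ring_scheme \<Rightarrow> ('b, 'n) ring_scheme \<Rightarrow> ('a \<Rightarrow> 'b) \<Rightarrow> bool" where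
  "local_hom R S f \<longleftrightarrow> f \<in> ring_hom R S \<and> f ` max_ideal R \<subseteq> max_ideal S"

definition prime_chain :: "('a, 'm) ring_scheme \<Rightarrow> (nat \<Rightarrow> 'a set) \<Rightarrow> nat \<Rightarrow> bool" where
  "prime_chain R c n \<longleftrightarrow> (\<forall>i\<le>n. primeideal (c i) R) \<and> (\<forall>i<n. c i \<subset> c (Suc i))"

definition krull_dim :: "('a, 'm) ring_scheme \<Rightarrow> nat \<Rightarrow> bool" where
  "krull_dim R n \<longleftrightarrow> (\<exists>c. prime_chain R c n) \<and> (\<forall>c m. prime_chain R c m \<longrightarrow> m \<le> n)"

definition ideal_height :: "('a, 'm) ring_scheme \<Rightarrow> 'a set \<Rightarrow> nat \<Rightarrow> bool" where
  "ideal_height R P h \<longleftrightarrow> (\<exists>c. prime_chain R c h \<and> c h = P)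
      \<and> (\<forall>c m. prime_chain R c m \<and> c m = P \<longrightarrow> m \<le> h)"

(* length of the R-module R/I: supremum of lengths of chains of submodules of R/I,
   i.e. of strictly increasing chains of ideals of R containing I *)
definition ideal_chain :: "('a, 'm) ring_scheme \<Rightarrow> 'a set \<Rightarrow> (nat \<Rightarrow> 'a set) \<Rightarrow> nat \<Rightarrow> bool" where
  "ideal_chain R I c n \<longleftrightarrow> (\<forall>i\<le>n. ideal (c i) R \<and> I \<subseteq> c i) \<and> (\<forall>i<n. c i \<subset> c (Suc i))"

definition quot_length :: "('a, 'm) ring_scheme \<Rightarrow> 'a set \<Rightarrow> enat" where
  "quot_length R I = Sup {enat n | n. \<exists>c. ideal_chain R I c n}"

definition frob_power :: "('a, 'm) ring_scheme \<Rightarrow> 'a set \<Rightarrow> nat \<Rightarrow> 'a set" where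
  "frob_power R J q = Idl\<^bsub>R\<^esub> ((\<lambda>x. x [^]\<^bsub>R\<^esub> q) ` J)"

definition ext_ideal :: "('b, 'n) ring_scheme \<Rightarrow> ('a \<Rightarrow> 'b) \<Rightarrow> 'a set \<Rightarrow> 'b set" where
  "ext_ideal S f J = Idl\<^bsub>S\<^esub> (f ` J)"

definition minimal_prime :: "('a, 'm) ring_scheme \<Rightarrow> 'a set \<Rightarrow> bool" where
  "minimal_prime R P \<longleftrightarrow> primeideal P R \<and> (\<forall>P'. primeideal P' R \<and> P' \<subseteq> P \<longrightarrow> P' = P)"

definition ring_zero_compl :: "('a, 'm) ring_scheme \<Rightarrow> 'a set" where
  "ring_zero_compl R = carrier R - \<Union>{P. minimal_prime R P}"

definition tight_closure :: "('a, 'm) ring_scheme \<Rightarrow> nat \<Rightarrow> 'a set \<Rightarrow> 'a set" where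
  "tight_closure R p J = {x \<in> carrier R. \<exists>c \<in> ring_zero_compl R. \<exists>N. \<forall>e\<ge>N.
       c \<otimes>\<^bsub>R\<^esub> (x [^]\<^bsub>R\<^esub> (p ^ e)) \<in> frob_power R J (p ^ e)}"

definition ideal_radical :: "('a, 'm) ring_scheme \<Rightarrow> 'a set \<Rightarrow> 'a set" where
  "ideal_radical R I = {x \<in> carrier R. \<exists>n::nat. x [^]\<^bsub>R\<^esub> n \<in> I}"

definition system_of_parameters :: "('a, 'm) ring_scheme \<Rightarrow> 'a list \<Rightarrow> bool" where
  "system_of_parameters R xs \<longleftrightarrow> krull_dim R (length xs) \<and> set xs \<subseteq> max_ideal R
      \<and> ideal_radical R (Idl\<^bsub>R\<^esub> (set xs)) = max_ideal R"

definition regular_local_ring :: "('a, 'm) ring_scheme \<Rightarrow> bool" where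
  "regular_local_ring R \<longleftrightarrow> noetherian_local_ring R \<and>
     (\<exists>xs. krull_dim R (length xs) \<and> set xs \<subseteq> carrier R \<and> max_ideal R = Idl\<^bsub>R\<^esub> (set xs))"

definition regular_sequence :: "('a, 'm) ring_scheme \<Rightarrow> 'a list \<Rightarrow> bool" where
  "regular_sequence R xs \<longleftrightarrow> set xs \<subseteq> carrier R \<and> Idl\<^bsub>R\<^esub> (set xs) \<noteq> carrier R \<and>
     (\<forall>i < length xs. \<forall>y \<in> carrier R.
        xs ! i \<otimes>\<^bsub>R\<^esub> y \<in> Idl\<^bsub>R\<^esub> (set (take i xs)) \<longrightarrow> y \<in> Idl\<^bsub>R\<^esub> (set (take i xs)))"

definition ideal_grade :: "('a, 'm) ring_scheme \<Rightarrow> 'a set \<Rightarrow> nat \<Rightarrow> bool" where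
  "ideal_grade R I g \<longleftrightarrow> (\<exists>xs. length xs = g \<and> set xs \<subseteq> I \<and> regular_sequence R xs)
      \<and> (\<forall>xs. set xs \<subseteq> I \<and> regular_sequence R xs \<longrightarrow> length xs \<le> g)"

(* Cohen-Macaulay Noetherian ring: for every maximal ideal m, grade m = height m
   (equivalently depth R_m = dim R_m) *)
definition cohen_macaulay :: "('a, 'm) ring_scheme \<Rightarrow> bool" where
  "cohen_macaulay R \<longleftrightarrow> cring R \<and> noetherian_ring R \<and>
     (\<forall>m. maximalideal m R \<longrightarrow> (\<exists>h. ideal_height R m h \<and> ideal_grade R m h))"

definition equidimensional :: "('a, 'm) ring_scheme \<Rightarrow> bool" where
  "equidimensional R \<longleftrightarrow> (\<exists>t. krull_dim R t \<and> (\<forall>P. minimal_prime R P \<longrightarrow> krull_dim (R Quot P) t))"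

definition complete_intersection :: "'s itself \<Rightarrow> ('a, 'm) ring_scheme \<Rightarrow> bool" where
  "complete_intersection (_::'s itself) R \<longleftrightarrow> local_ring R \<and>
     (\<exists>(S::'s ring) xs. regular_local_ring S \<and> regular_sequence S xs
        \<and> is_ring_iso (S Quot (Idl\<^bsub>S\<^esub> (set xs))) R)"

(* the homomorphism R/I \<rightarrow> S/J induced by f (when f(I) \<subseteq> J) *)
definition induced_hom :: "('b, 'n) ring_scheme \<Rightarrow> 'b set \<Rightarrow> ('a \<Rightarrow> 'b) \<Rightarrow> 'a set \<Rightarrow> 'b set" where
  "induced_hom R I g Y = a_r_coset R I (g (SOME x. x \<in> Y))"

end

theory Submission
  imports Defs
begin

text \<open>Write \<open>\<aa>\<close> for the tight closure of the parameter ideal \<open>\<qq>\<close>, and filter \<open>Q\<close> by the powers of its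
  maximal ideal \<open>\<nn>\<close>. Since \<open>B/\<aa>B\<close> has length \<open>d\<close>, the preimage of \<open>\<aa>B\<close> contains \<open>\<nn> ^ d\<close>. As \<open>\<qq>[q]\<close> is
  tightly closed, it contains the \<open>q\<close>-th powers of \<open>\<aa>\<close>, so \<open>\<qq>[q]B\<close> contains the images of the
  \<open>dq\<close>-th powers of the regular parameters. If the kernel of \<open>\<theta>\<close> contained an element of order
  at most \<open>d\<close>, the length of \<open>B/\<qq>[q]B\<close> would grow only like \<open>q ^ (t - 1)\<close>, whereas that of
  \<open>A/\<qq>[q]\<close> is at least \<open>q ^ t\<close>. So the kernel lies in \<open>\<nn> ^ (d + 1)\<close>, and Nakayama's lemma gives
  \<open>\<nn> ^ d \<subseteq> \<aa>Q\<close>, hence the kernel is contained in \<open>\<aa>Q\<close>.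

  For the second part, colon capturing yields an element outside the minimal primes that
  multiplies all colons of powers of the parameters into the expected ideals, and this allows
  tight closedness to descend from \<open>\<qq>[q]\<close> to \<open>\<qq>\<close>. The images of the parameters are then a system of
  parameters, hence a regular sequence, in \<open>Q\<close>.\<close>

section \<open>Ideals saturated at a prime\<close>

text \<open>The constant d ^ t * t ^ (t - 1) comes from two estimates. The dq-th powers of t
  generators force degree N = tdq into the ideal by the pigeonhole principle, and a hypersurface of
  order s <= d has length at most s * N ^ (t - 1) in degrees below N. The lower bound q ^ t must
  hold although the parameters of A need not form a regular sequence: it is obtained at a prime P
  with dim A/P = t, by moving P upward past one parameter at a time, each of which multiplies the
  length by q. In the second part the difficulty is uniformity. One multiplier must serve all
  Frobenius powers of the parameters, and its image in A must avoid every minimal prime. It is built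
  in the Cohen-Macaulay ring, modulo a maximal regular sequence inside the kernel K of the map to A:
  the minimal primes of K are then minimal over that sequence, and the parameters lift to elements
  that are regular modulo it. As this ring need not be local, everything is phrased with ideals
  saturated at one prime.\<close>

locale noetherian_cring = cring R + noetherian_ring R for R (structure)

context cring
begin

lemma ideal_add: "ideal J R \<Longrightarrow> a \<in> J \<Longrightarrow> b \<in> J \<Longrightarrow> a \<oplus> b \<in> J"
  by (rule additive_subgroup.a_closed[OF ideal.axioms(1)])

lemma ideal_zero: "ideal J R \<Longrightarrow> \<zero> \<in> J"
  by (rule additive_subgroup.zero_closed[OF ideal.axioms(1)])

lemma ideal_mult: "ideal J R \<Longrightarrow> a \<in> J \<Longrightarrow> r \<in> carrier R \<Longrightarrow> r \<otimes> a \<in> J"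
  by (rule ideal.I_l_closed)

lemma ideal_mult_right: "ideal J R \<Longrightarrow> a \<in> J \<Longrightarrow> r \<in> carrier R \<Longrightarrow> a \<otimes> r \<in> J"
  by (rule ideal.I_r_closed)

lemma ideal_carr: "ideal J R \<Longrightarrow> a \<in> J \<Longrightarrow> a \<in> carrier R"
  by (rule ideal.Icarr)

lemma ideal_sub: "ideal J R \<Longrightarrow> J \<subseteq> carrier R"
  by (auto intro: ideal_carr)

lemma ideal_neg: "ideal J R \<Longrightarrow> a \<in> J \<Longrightarrow> \<ominus> a \<in> J"
  by (rule additive_subgroup.a_inv_closed[OF ideal.axioms(1)])

lemma ideal_minus: "ideal J R \<Longrightarrow> a \<in> J \<Longrightarrow> b \<in> J \<Longrightarrow> a \<ominus> b \<in> J"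
  by (simp add: a_minus_def ideal_add ideal_neg)

text \<open>The equation is a separate premise, so that a membership proof splits into an identity
  for \<open>algebra\<close> and two known members.\<close>

lemma ideal_comb:
  assumes "ideal J R" "a \<in> J" "b \<in> J" "p \<in> carrier R" "q \<in> carrier R" "z = p \<otimes> a \<oplus> q \<otimes> b"
  shows "z \<in> J"
  using assms by (simp add: ideal_add ideal_mult)

lemma ideal_minus_cancel:
  assumes "ideal J R" "a \<ominus> b \<in> J" "b \<in> J" "a \<in> carrier R"
  shows "a \<in> J"
proof -
  have b: "b \<in> carrier R" using assms ideal_carr by blast
  have "a = \<one> \<otimes> (a \<ominus> b) \<oplus> \<one> \<otimes> b"
    using assms(4) b by algebra
  thus ?thesis using assms ideal_comb[OF assms(1-3), of \<one> \<one>] by simp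
qed

lemma ideal_minus_cancel':
  assumes "ideal J R" "a \<ominus> b \<in> J" "a \<in> J" "b \<in> carrier R"
  shows "b \<in> J"
proof -
  have a: "a \<in> carrier R" using assms ideal_carr by blast
  have "b = \<one> \<otimes> a \<oplus> (\<ominus> \<one>) \<otimes> (a \<ominus> b)"
    using assms(4) a by algebra
  thus ?thesis using assms ideal_comb[OF assms(1) assms(3,2), of \<one> "\<ominus> \<one>"] by simp
qed

lemma cring_idealI:
  assumes "I \<subseteq> carrier R" "\<zero> \<in> I" "\<And>a b. a \<in> I \<Longrightarrow> b \<in> I \<Longrightarrow> a \<oplus> b \<in> I"
    "\<And>a r. a \<in> I \<Longrightarrow> r \<in> carrier R \<Longrightarrow> r \<otimes> a \<in> I"
  shows "ideal I R"
proof (rule idealI)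
  show "ring R" by (rule ring_axioms)
  have neg: "\<ominus> a \<in> I" if "a \<in> I" for a
  proof -
    have "a \<in> carrier R" using that assms(1) by auto
    then have "\<ominus> a = (\<ominus> \<one>) \<otimes> a" by algebra
    then show ?thesis using assms(4)[OF that, of "\<ominus> \<one>"] by simp
  qed
  show "subgroup I (add_monoid R)"
    by (rule subgroup.intro) (use assms neg in \<open>auto simp: a_inv_def\<close>)
  show "\<And>a x. a \<in> I \<Longrightarrow> x \<in> carrier R \<Longrightarrow> x \<otimes> a \<in> I" by (rule assms(4))
  show "\<And>a x. a \<in> I \<Longrightarrow> x \<in> carrier R \<Longrightarrow> a \<otimes> x \<in> I"
    using assms(1,4) m_comm by (metis subsetD)
qed

lemma prime_ideal: "primeideal P R \<Longrightarrow> ideal P R"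
  by (rule primeideal.axioms(1))

lemma prime_one: "primeideal P R \<Longrightarrow> \<one> \<notin> P"
  using primeideal.I_notcarr ideal.one_imp_carrier prime_ideal by metis

lemma primeD: "primeideal P R \<Longrightarrow> a \<otimes> b \<in> P \<Longrightarrow> a \<in> carrier R \<Longrightarrow> b \<in> carrier R \<Longrightarrow> a \<in> P \<or> b \<in> P"
  by (rule primeideal.I_prime)

lemma primeI:
  assumes "ideal P R" "\<one> \<notin> P"
    "\<And>a b. a \<in> carrier R \<Longrightarrow> b \<in> carrier R \<Longrightarrow> a \<otimes> b \<in> P \<Longrightarrow> a \<in> P \<or> b \<in> P"
  shows "primeideal P R"
  by (rule primeidealI[OF assms(1) cring_axioms]) (use assms in auto)

lemma prime_compl_mult:
  "primeideal P R \<Longrightarrow> s \<in> carrier R - P \<Longrightarrow> s' \<in> carrier R - P \<Longrightarrow> s \<otimes> s' \<in> carrier R - P"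
  using primeD by auto

lemma prime_compl_one: "primeideal P R \<Longrightarrow> \<one> \<in> carrier R - P"
  using prime_one by auto

lemma prime_compl_pow: "primeideal P R \<Longrightarrow> s \<in> carrier R - P \<Longrightarrow> s [^] (n::nat) \<in> carrier R - P"
  by (induction n) (use prime_compl_one prime_compl_mult in \<open>simp_all only: nat_pow_0 nat_pow_Suc\<close>)

lemma prime_pow: "primeideal P R \<Longrightarrow> s \<in> carrier R \<Longrightarrow> s [^] (n::nat) \<in> P \<Longrightarrow> s \<in> P"
  using prime_compl_pow by blast

text \<open>Ideals of the localisation at a prime \<open>M\<close> are encoded by the ideals of \<open>R\<close> that are
  saturated with respect to the complement of \<open>M\<close>; so no localisation has to be formed.\<close>

definition saturated :: "'a set \<Rightarrow> 'a set \<Rightarrow> bool" where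
  "saturated M J \<longleftrightarrow> ideal J R \<and> (\<forall>s \<in> carrier R - M. \<forall>u \<in> carrier R. s \<otimes> u \<in> J \<longrightarrow> u \<in> J)"

text \<open>For \<open>M\<close> prime this is the contraction to \<open>R\<close> of the ideal that
  \<open>T\<close> generates in the localisation. Fractions enter only through
  \<open>mem_sat_ideal\<close>.\<close>

definition sat :: "'a set \<Rightarrow> 'a set \<Rightarrow> 'a set" where
  "sat M T = {x \<in> carrier R. \<forall>J. saturated M J \<and> T \<subseteq> J \<longrightarrow> x \<in> J}"

lemma saturatedI:
  "ideal J R \<Longrightarrow> (\<And>s u. s \<in> carrier R - M \<Longrightarrow> u \<in> carrier R \<Longrightarrow> s \<otimes> u \<in> J \<Longrightarrow> u \<in> J) \<Longrightarrow> saturated M J"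
  unfolding saturated_def by blast

lemma saturated_ideal: "saturated M J \<Longrightarrow> ideal J R"
  by (simp add: saturated_def)

lemma saturatedD: "saturated M J \<Longrightarrow> s \<otimes> u \<in> J \<Longrightarrow> s \<in> carrier R - M \<Longrightarrow> u \<in> carrier R \<Longrightarrow> u \<in> J"
  by (auto simp: saturated_def)

lemma saturated_carrier: "saturated M (carrier R)"
  by (simp add: saturated_def oneideal)

lemma saturated_mono: "saturated M' J \<Longrightarrow> M' \<subseteq> M \<Longrightarrow> saturated M J"
  by (auto simp: saturated_def)

lemma saturated_prime: "primeideal P R \<Longrightarrow> P \<subseteq> M \<Longrightarrow> saturated M P"
  using primeD prime_ideal by (auto simp: saturated_def)

lemma saturated_sat: "saturated M (sat M T)"
proof -
  have "ideal (sat M T) R"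
  proof (rule cring_idealI)
    show "\<zero> \<in> sat M T" using ideal_zero saturated_ideal unfolding sat_def by blast
    show "a \<oplus> b \<in> sat M T" if "a \<in> sat M T" "b \<in> sat M T" for a b
      using that ideal_add[OF saturated_ideal] unfolding sat_def by blast
    show "r \<otimes> a \<in> sat M T" if "a \<in> sat M T" "r \<in> carrier R" for a r
      using that ideal_mult[OF saturated_ideal] unfolding sat_def by blast
  qed (auto simp: sat_def)
  moreover have "u \<in> sat M T" if "s \<in> carrier R - M" "u \<in> carrier R" "s \<otimes> u \<in> sat M T" for s u
    using that saturatedD unfolding sat_def by blast
  ultimately show ?thesis unfolding saturated_def by blast
qed

lemma sat_ideal: "ideal (sat M T) R"
  by (rule saturated_ideal[OF saturated_sat])

lemma sat_carr: "x \<in> sat M T \<Longrightarrow> x \<in> carrier R"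
  by (simp add: sat_def)

lemma sat_sub_carrier: "sat M T \<subseteq> carrier R"
  by (auto simp: sat_def)

lemma sat_upper: "T \<subseteq> carrier R \<Longrightarrow> T \<subseteq> sat M T"
  by (auto simp: sat_def)

lemma sat_upper': "x \<in> T \<Longrightarrow> x \<in> carrier R \<Longrightarrow> x \<in> sat M T"
  by (auto simp: sat_def)

lemma sat_least: "saturated M J \<Longrightarrow> T \<subseteq> J \<Longrightarrow> sat M T \<subseteq> J"
  by (auto simp: sat_def)

lemma sat_mono: "S \<subseteq> T \<Longrightarrow> sat M S \<subseteq> sat M T"
  by (auto simp: sat_def)

lemma sat_saturated: "saturated M J \<Longrightarrow> sat M J = J"
  using sat_least[of M J J] sat_upper[of J M] saturated_ideal ideal_sub by blast

lemma sat_sat_Un: assumes "S \<subseteq> carrier R" "T \<subseteq> carrier R" shows "sat M (sat M S \<union> T) = sat M (S \<union> T)"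
proof
  show "sat M (sat M S \<union> T) \<subseteq> sat M (S \<union> T)"
    using sat_mono[of S "S \<union> T" M] sat_upper[of "S \<union> T" M] assms by (intro sat_least[OF saturated_sat]) auto
  show "sat M (S \<union> T) \<subseteq> sat M (sat M S \<union> T)"
    using sat_upper[OF assms(1), of M] by (intro sat_mono) auto
qed

lemma sat_sat_insert: "S \<subseteq> carrier R \<Longrightarrow> x \<in> carrier R \<Longrightarrow> sat M (insert x (sat M S)) = sat M (insert x S)"
  using sat_sat_Un[of S "{x}"] by simp

text \<open>Clearing denominators: the elements that some \<open>s\<close> outside \<open>M\<close>
  carries into \<open>K\<close> form a saturated ideal because the complement of the prime
  \<open>M\<close> is closed under products.\<close>

lemma mem_sat_ideal:
  assumes M: "primeideal M R" and K: "ideal K R"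
  shows "u \<in> sat M K \<longleftrightarrow> u \<in> carrier R \<and> (\<exists>s \<in> carrier R - M. s \<otimes> u \<in> K)"
proof -
  let ?S = "{u \<in> carrier R. \<exists>s \<in> carrier R - M. s \<otimes> u \<in> K}"
  have "ideal ?S R"
  proof (rule cring_idealI)
    show "?S \<subseteq> carrier R" by auto
    show "\<zero> \<in> ?S" using prime_compl_one[OF M] ideal_zero[OF K] by force
  next
    fix a b assume a: "a \<in> ?S" and b: "b \<in> ?S"
    then obtain s s' where s: "s \<in> carrier R - M" "s \<otimes> a \<in> K" and s': "s' \<in> carrier R - M" "s' \<otimes> b \<in> K" by auto
    have c: "a \<in> carrier R" "b \<in> carrier R" "s \<in> carrier R" "s' \<in> carrier R" using a b s s' by auto
    have "(s \<otimes> s') \<otimes> (a \<oplus> b) = s' \<otimes> (s \<otimes> a) \<oplus> s \<otimes> (s' \<otimes> b)" using c by algebra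
    hence "(s \<otimes> s') \<otimes> (a \<oplus> b) \<in> K" using ideal_comb[OF K s(2) s'(2) c(4,3)] by simp
    thus "a \<oplus> b \<in> ?S" using prime_compl_mult[OF M s(1) s'(1)] c by blast
  next
    fix a r assume a: "a \<in> ?S" and r: "r \<in> carrier R"
    then obtain s where s: "s \<in> carrier R - M" "s \<otimes> a \<in> K" by auto
    have "s \<otimes> (r \<otimes> a) = r \<otimes> (s \<otimes> a)" using a r s m_lcomm by auto
    hence "s \<otimes> (r \<otimes> a) \<in> K" using ideal_mult[OF K s(2) r] by simp
    thus "r \<otimes> a \<in> ?S" using a r s by auto
  qed
  moreover have "u \<in> ?S" if h: "s \<in> carrier R - M" "u \<in> carrier R" "s \<otimes> u \<in> ?S" for s u
  proof -
    obtain s' where s': "s' \<in> carrier R - M" "s' \<otimes> (s \<otimes> u) \<in> K" using h(3) by blast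
    hence "(s' \<otimes> s) \<otimes> u \<in> K" using h by (simp add: m_assoc)
    thus ?thesis using prime_compl_mult[OF M s'(1) h(1)] h by blast
  qed
  ultimately have S: "saturated M ?S" by (auto simp: saturated_def)
  have "K \<subseteq> ?S" using prime_compl_one[OF M] ideal_carr[OF K] by force
  hence "sat M K \<subseteq> ?S" by (rule sat_least[OF S])
  moreover have "?S \<subseteq> sat M K"
    using saturatedD[OF saturated_sat[of M K]] sat_upper[OF ideal_sub[OF K], of M] by blast
  ultimately show ?thesis by blast
qed

text \<open>The set is \<open>J + Lx\<close>. Writing it as a congruence of \<open>k\<close> with
  \<open>rx\<close> modulo \<open>J\<close> avoids a sum of ideals and yields the coefficient
  \<open>r\<close> by unfolding.\<close>

lemma ideal_plus_multiples:
  assumes K: "ideal J R" and L: "ideal L R" and x: "x \<in> carrier R"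
  shows "ideal {k \<in> carrier R. \<exists>r \<in> L. k \<ominus> r \<otimes> x \<in> J} R" (is "ideal ?K R")
proof (rule cring_idealI)
  show "?K \<subseteq> carrier R" by auto
  have "\<zero> \<ominus> \<zero> \<otimes> x = \<zero>" using x by algebra
  thus "\<zero> \<in> ?K" using ideal_zero[OF K] ideal_zero[OF L] by force
next
  fix a b assume a: "a \<in> ?K" and b: "b \<in> ?K"
  then obtain r s where r: "r \<in> L" "a \<ominus> r \<otimes> x \<in> J" and s: "s \<in> L" "b \<ominus> s \<otimes> x \<in> J" by auto
  have rc: "r \<in> carrier R" "s \<in> carrier R" using r s ideal_carr[OF L] by auto
  have "(a \<oplus> b) \<ominus> (r \<oplus> s) \<otimes> x = (a \<ominus> r \<otimes> x) \<oplus> (b \<ominus> s \<otimes> x)" using a b rc x by (simp, algebra)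
  hence "(a \<oplus> b) \<ominus> (r \<oplus> s) \<otimes> x \<in> J" using ideal_add[OF K r(2) s(2)] by simp
  thus "a \<oplus> b \<in> ?K" using a b ideal_add[OF L r(1) s(1)] by auto
next
  fix a c assume a: "a \<in> ?K" and c: "c \<in> carrier R"
  then obtain r where r: "r \<in> L" "a \<ominus> r \<otimes> x \<in> J" by auto
  have rc: "r \<in> carrier R" using r ideal_carr[OF L] by auto
  have "c \<otimes> a \<ominus> (c \<otimes> r) \<otimes> x = c \<otimes> (a \<ominus> r \<otimes> x)" using a c rc x by (simp, algebra)
  hence "c \<otimes> a \<ominus> (c \<otimes> r) \<otimes> x \<in> J" using ideal_mult[OF K r(2) c] by simp
  thus "c \<otimes> a \<in> ?K" using a c ideal_mult[OF L r(1) c] by auto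
qed

lemmas ideal_insert = ideal_plus_multiples[OF _ oneideal]

lemma sat_insert_eq:
  assumes J: "ideal J R" and x: "x \<in> carrier R"
  shows "sat M {k \<in> carrier R. \<exists>r \<in> carrier R. k \<ominus> r \<otimes> x \<in> J} = sat M (insert x J)"
proof -
  define K where "K = {k \<in> carrier R. \<exists>r \<in> carrier R. k \<ominus> r \<otimes> x \<in> J}"
  have KI: "k \<in> K" if "k \<in> carrier R" "r \<in> carrier R" "k \<ominus> r \<otimes> x \<in> J" for k r
    using that unfolding K_def by blast
  have "x \<ominus> \<one> \<otimes> x = \<zero>" using x by algebra
  hence xK: "x \<in> K" using KI[OF x one_closed] ideal_zero[OF J] by simp
  have JK: "j \<in> K" if "j \<in> J" for j
  proof -
    have j: "j \<in> carrier R" using ideal_carr[OF J that] .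
    have "j \<ominus> \<zero> \<otimes> x = j" using x j by algebra
    thus ?thesis using KI[OF j zero_closed] that by simp
  qed
  have "k \<in> sat M (insert x J)" if k: "k \<in> K" for k
  proof -
    obtain r where r: "r \<in> carrier R" "k \<ominus> r \<otimes> x \<in> J" and kc: "k \<in> carrier R"
      using k unfolding K_def by blast
    have up: "insert x J \<subseteq> sat M (insert x J)" using x ideal_sub[OF J] by (intro sat_upper) simp
    have "k \<ominus> r \<otimes> x \<in> sat M (insert x J)" using r(2) up by blast
    moreover have "r \<otimes> x \<in> sat M (insert x J)" using r(1) up ideal_mult[OF sat_ideal, of x M "insert x J" r] by blast
    ultimately show ?thesis using ideal_minus_cancel[OF sat_ideal] kc by blast
  qed
  hence "K \<subseteq> sat M (insert x J)" by (rule subsetI)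
  hence "sat M K \<subseteq> sat M (insert x J)" by (rule sat_least[OF saturated_sat])
  moreover have "insert x J \<subseteq> K" using xK JK by blast
  ultimately show ?thesis unfolding K_def[symmetric] using sat_mono by blast
qed

text \<open>A congruence of \<open>su\<close> with \<open>rx\<close> modulo \<open>J\<close>, for
  \<open>s\<close> outside \<open>M\<close>, puts \<open>u\<close> into \<open>J + Rx\<close> after
  localisation. Most arguments below manipulate such congruences and carry the denominators
  along.\<close>

lemma mem_sat_insert:
  assumes M: "primeideal M R" and J: "ideal J R" and x: "x \<in> carrier R"
  shows "u \<in> sat M (insert x J) \<longleftrightarrow>
    u \<in> carrier R \<and> (\<exists>s \<in> carrier R - M. \<exists>r \<in> carrier R. s \<otimes> u \<ominus> r \<otimes> x \<in> J)"
  unfolding sat_insert_eq[OF J x, symmetric] mem_sat_ideal[OF M ideal_insert[OF J x]]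
  using x by fastforce

lemma colon_ideal:
  assumes J: "ideal J R" and g: "g \<in> carrier R"
  shows "ideal {r \<in> carrier R. r \<otimes> g \<in> J} R"
proof (rule cring_idealI)
  fix a b assume "a \<in> {r \<in> carrier R. r \<otimes> g \<in> J}" "b \<in> {r \<in> carrier R. r \<otimes> g \<in> J}"
  thus "a \<oplus> b \<in> {r \<in> carrier R. r \<otimes> g \<in> J}" using g J by (simp add: l_distr ideal_add)
qed (use g J in \<open>auto simp: ideal_zero m_assoc ideal_mult\<close>)

lemma colon_saturated:
  assumes J: "saturated M J" and g: "g \<in> carrier R"
  shows "saturated M {r \<in> carrier R. r \<otimes> g \<in> J}"
  using colon_ideal[OF saturated_ideal[OF J] g] J g by (auto simp: saturated_def m_assoc)

lemma colon_carr_subset: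
  assumes J: "ideal J R" and g: "g \<in> carrier R" shows "J \<subseteq> {r \<in> carrier R. r \<otimes> g \<in> J}"
  using ideal_carr[OF J] ideal_mult_right[OF J _ g] by auto

end

section \<open>Maximal ideals in families, Nakayama's lemma and associated primes\<close>

context noetherian_cring
begin

text \<open>A chain of ideals in a Noetherian ring contains its union, so Zorn's lemma applies to
  every nonempty family of ideals.\<close>

lemma ideal_maximal_exists:
  assumes "F \<noteq> {}" "\<And>J. J \<in> F \<Longrightarrow> ideal J R"
  shows "\<exists>J \<in> F. \<forall>K \<in> F. J \<subseteq> K \<longrightarrow> K = J"
proof (rule subset_Zorn_nonempty[OF assms(1)])
  fix \<C> assume "\<C> \<noteq> {}" "subset.chain F \<C>"
  moreover then have "subset.chain {I. ideal I R} \<C>"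
    using assms(2) by (auto simp: subset.chain_def)
  ultimately show "\<Union>\<C> \<in> F"
    using ideal_chain_is_trivial[of \<C>] by (auto simp: subset.chain_def)
qed

lemma noetherian_induct [consumes 1, case_names step]:
  assumes "ideal J R"
    and "\<And>J. ideal J R \<Longrightarrow> (\<And>K. ideal K R \<Longrightarrow> J \<subset> K \<Longrightarrow> Q K) \<Longrightarrow> Q J"
  shows "Q J"
proof (rule ccontr)
  assume "\<not> Q J"
  then obtain I where "ideal I R" "\<not> Q I" "\<And>K. ideal K R \<Longrightarrow> \<not> Q K \<Longrightarrow> I \<subseteq> K \<Longrightarrow> K = I"
    using ideal_maximal_exists[of "{I. ideal I R \<and> \<not> Q I}"] assms(1) by blast
  thus False using assms(2)[of I] by blast
qed

lemma saturated_maximal_exists: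
  assumes D: "saturated M D" and Q: "Q D"
  shows "\<exists>E. saturated M E \<and> Q E \<and> (\<forall>K. saturated M K \<and> Q K \<and> E \<subseteq> K \<longrightarrow> K = E)"
proof -
  have "Collect (\<lambda>E. saturated M E \<and> Q E) \<noteq> {}" using assms by auto
  moreover have "ideal J R" if "J \<in> Collect (\<lambda>E. saturated M E \<and> Q E)" for J
    using that saturated_ideal[of M J] by simp
  ultimately show ?thesis using ideal_maximal_exists[of "Collect (\<lambda>E. saturated M E \<and> Q E)"] by (simp add: imp_conjL)
qed

text \<open>Nakayama's lemma, with \<open>E\<close> ranging over the ideals containing \<open>D + MC\<close>.\<close>

lemma nakayama:
  assumes M: "primeideal M R" and D: "saturated M D" and C: "C \<subseteq> carrier R"
    and step: "\<And>E. saturated M E \<Longrightarrow> D \<subseteq> E \<Longrightarrow> (\<And>p u. p \<in> M \<Longrightarrow> u \<in> C \<Longrightarrow> p \<otimes> u \<in> E) \<Longrightarrow> C \<subseteq> E"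
  shows "C \<subseteq> D"
proof (rule ccontr)
  assume "\<not> C \<subseteq> D"
  \<comment> \<open>An \<open>E\<close> maximal among the counterexamples takes the place of finite
    generation of \<open>C\<close> in the usual proof.\<close>
  then obtain E where E: "saturated M E" "D \<subseteq> E" "\<not> C \<subseteq> E"
    and max: "\<And>K. saturated M K \<Longrightarrow> D \<subseteq> K \<Longrightarrow> \<not> C \<subseteq> K \<Longrightarrow> E \<subseteq> K \<Longrightarrow> K = E"
    using saturated_maximal_exists[OF D, of "\<lambda>E. D \<subseteq> E \<and> \<not> C \<subseteq> E"] by (metis order.refl)
  have "p \<otimes> v \<in> E" if p: "p \<in> M" and v: "v \<in> C" for p v
  proof (rule ccontr)
    assume n: "p \<otimes> v \<notin> E"
    have pc: "p \<in> carrier R" and vc: "v \<in> carrier R"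
      using p v C ideal_carr[OF prime_ideal[OF M]] by auto
    have vE: "v \<notin> E" using n ideal_mult[OF saturated_ideal[OF E(1)] _ pc] by blast
    let ?K = "sat M (insert (p \<otimes> v) E)"
    have up: "insert (p \<otimes> v) E \<subseteq> ?K"
      using pc vc ideal_sub[OF saturated_ideal[OF E(1)]] by (intro sat_upper) auto
    hence "?K \<noteq> E" using n by auto
    hence "C \<subseteq> ?K" using max[OF saturated_sat, of "insert (p \<otimes> v) E"] up E(2) by blast
    hence "v \<in> ?K" using v by auto
    then obtain s r where s: "s \<in> carrier R - M" "r \<in> carrier R" "s \<otimes> v \<ominus> r \<otimes> (p \<otimes> v) \<in> E"
      using mem_sat_insert[OF M saturated_ideal[OF E(1)]] pc vc by auto
    \<comment> \<open>The coefficient \<open>s - rp\<close> stays outside \<open>M\<close>, the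
      analogue of the unit \<open>1 - rp\<close>; cancelling it puts \<open>v\<close> into
      \<open>E\<close>.\<close>
    have "s \<otimes> v \<ominus> r \<otimes> (p \<otimes> v) = (s \<ominus> r \<otimes> p) \<otimes> v" using s pc vc by (simp, algebra)
    moreover have "s \<ominus> r \<otimes> p \<notin> M"
      using ideal_minus_cancel[OF prime_ideal[OF M], of s "r \<otimes> p"] s ideal_mult[OF prime_ideal[OF M] p s(2)] by blast
    ultimately show False using saturatedD[OF E(1), of "s \<ominus> r \<otimes> p" v] s pc vc vE by auto
  qed
  thus False using step[OF E(1,2)] E(3) by blast
qed

text \<open>Among the annihilators of the multiples \<open>ru\<close> outside \<open>J\<close>, a
  maximal one is prime. It lies in \<open>M\<close> because elements outside \<open>M\<close> cancel
  modulo a saturated ideal.\<close>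

lemma associated_prime_exists:
  assumes M: "primeideal M R" and J: "saturated M J" and u: "u \<in> carrier R" "u \<notin> J"
  shows "\<exists>r \<in> carrier R. r \<otimes> u \<notin> J \<and> primeideal {c \<in> carrier R. c \<otimes> (r \<otimes> u) \<in> J} R
    \<and> {c \<in> carrier R. c \<otimes> (r \<otimes> u) \<in> J} \<subseteq> M"
proof -
  define A where "A r = {c \<in> carrier R. c \<otimes> (r \<otimes> u) \<in> J}" for r
  have Ji: "ideal J R" by (rule saturated_ideal[OF J])
  have "\<exists>K \<in> A ` {r \<in> carrier R. r \<otimes> u \<notin> J}. \<forall>L \<in> A ` {r \<in> carrier R. r \<otimes> u \<notin> J}. K \<subseteq> L \<longrightarrow> L = K"
  proof (rule ideal_maximal_exists)
    have "\<one> \<in> {r \<in> carrier R. r \<otimes> u \<notin> J}" using u by simp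
    thus "A ` {r \<in> carrier R. r \<otimes> u \<notin> J} \<noteq> {}" by blast
  qed (use colon_ideal[OF Ji] u in \<open>auto simp: A_def\<close>)
  then obtain r where r: "r \<in> carrier R" "r \<otimes> u \<notin> J"
    and max: "\<And>r'. r' \<in> carrier R \<Longrightarrow> r' \<otimes> u \<notin> J \<Longrightarrow> A r \<subseteq> A r' \<Longrightarrow> A r' = A r" by blast
  have ru: "r \<otimes> u \<in> carrier R" using r u by simp
  have "primeideal (A r) R"
  proof (rule primeI)
    show "ideal (A r) R" using colon_ideal[OF Ji ru] by (simp add: A_def)
    show "\<one> \<notin> A r" using r u by (simp add: A_def)
  next
    fix a b assume ab: "a \<in> carrier R" "b \<in> carrier R" "a \<otimes> b \<in> A r"
    show "a \<in> A r \<or> b \<in> A r"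
    proof (cases "b \<in> A r")
      case False
      hence "(b \<otimes> r) \<otimes> u \<notin> J" using ab r u by (simp add: A_def m_assoc)
      moreover have "A r \<subseteq> A (b \<otimes> r)"
      proof
        fix c assume "c \<in> A r"
        hence c: "c \<in> carrier R" "c \<otimes> (r \<otimes> u) \<in> J" by (auto simp: A_def)
        have "c \<otimes> (b \<otimes> r \<otimes> u) = b \<otimes> (c \<otimes> (r \<otimes> u))" using c(1) ab(1,2) r(1) u(1) by algebra
        thus "c \<in> A (b \<otimes> r)" using c ideal_mult[OF Ji c(2) ab(2)] by (simp add: A_def)
      qed
      ultimately have "A (b \<otimes> r) = A r" using max ab r by simp
      moreover have "a \<in> A (b \<otimes> r)" using ab r u by (simp add: A_def m_assoc)
      ultimately show ?thesis by simp
    qed auto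
  qed
  moreover have "A r \<subseteq> M" using saturatedD[OF J] r ru by (auto simp: A_def)
  ultimately show ?thesis using r by (auto simp: A_def)
qed

end

section \<open>Length, measured by chains of saturated ideals\<close>

context cring
begin

text \<open>Both ends are arguments, so that chains can be concatenated and transported. Saturation
  of the lower end \<open>I\<close> accompanies a chain as a separate premise.\<close>

inductive saturated_chain :: "'a set \<Rightarrow> 'a set \<Rightarrow> nat \<Rightarrow> 'a set \<Rightarrow> bool" for P I where
  saturated_chain_0: "saturated_chain P I 0 I"
| saturated_chain_Suc: "saturated_chain P I n J \<Longrightarrow> J \<subset> K \<Longrightarrow> saturated P K \<Longrightarrow> saturated_chain P I (Suc n) K"

lemma saturated_chain_trans: "saturated_chain P J m K \<Longrightarrow> saturated_chain P I n J \<Longrightarrow> saturated_chain P I (n + m) K"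
  by (induction rule: saturated_chain.induct) (auto intro: saturated_chain.intros)

lemma saturated_chain_saturated: "saturated_chain P I n K \<Longrightarrow> saturated P I \<Longrightarrow> saturated P K"
  by (cases rule: saturated_chain.cases) auto

lemma saturated_chain_sub: "saturated_chain P I n K \<Longrightarrow> I \<subseteq> K"
  by (induction rule: saturated_chain.induct) auto

text \<open>This expresses that \<open>R/J\<close>, localised at \<open>P\<close>, has length at most \<open>k\<close>.\<close>

definition colength_le :: "'a set \<Rightarrow> 'a set \<Rightarrow> nat \<Rightarrow> bool" where
  "colength_le P J k \<longleftrightarrow> (\<forall>I n K. saturated P I \<and> J \<subseteq> I \<and> saturated_chain P I n K \<longrightarrow> n \<le> k)"

text \<open>Modulo \<open>J\<close> the element \<open>g\<close> spans a module killed by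
  \<open>M\<close>, so of length at most one locally. Dividing by \<open>g\<close> therefore
  collapses at most the one step of the chain at which \<open>g\<close> enters.\<close>

lemma saturated_chain_insert:
  assumes M: "primeideal M R" and g: "g \<in> carrier R" and gJ: "\<And>p. p \<in> M \<Longrightarrow> p \<otimes> g \<in> J"
  shows "saturated_chain M I n K \<Longrightarrow> saturated M I \<Longrightarrow> J \<subseteq> I \<Longrightarrow>
    \<exists>n'. saturated_chain M (sat M (insert g I)) n' (sat M (insert g K)) \<and> n \<le> n' + (if g \<in> K \<and> g \<notin> I then 1 else 0)"
proof (induction rule: saturated_chain.induct)
  case saturated_chain_0
  show ?case using saturated_chain.saturated_chain_0[of M] by auto
next
  case (saturated_chain_Suc n K K')
  then obtain n' where n': "saturated_chain M (sat M (insert g I)) n' (sat M (insert g K))"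
    "n \<le> n' + (if g \<in> K \<and> g \<notin> I then 1 else 0)" by blast
  have K: "saturated M K" using saturated_chain_saturated saturated_chain_Suc by blast
  have JK: "J \<subseteq> K" using saturated_chain_sub saturated_chain_Suc by blast
  have sub: "sat M (insert g K) \<subseteq> sat M (insert g K')" using saturated_chain_Suc(2) by (intro sat_mono) auto
  show ?case
  proof (cases "g \<in> K \<or> g \<notin> K'")
    case True
    have "sat M (insert g K) \<noteq> sat M (insert g K')"
    proof (cases "g \<in> K")
      case True
      thus ?thesis using saturated_chain_Suc(2,3) K sat_saturated by (metis insert_absorb psubset_eq psubsetD)
    next
      case False
      hence gK': "g \<notin> K'" using True by simp
      obtain u where u: "u \<in> K'" "u \<notin> K" using saturated_chain_Suc(2) by auto
      have uc: "u \<in> carrier R" using u ideal_carr[OF saturated_ideal[OF saturated_chain_Suc(3)]] by auto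
      have "u \<notin> sat M (insert g K)"
      proof
        assume "u \<in> sat M (insert g K)"
        then obtain s r where s: "s \<in> carrier R - M" "r \<in> carrier R" "s \<otimes> u \<ominus> r \<otimes> g \<in> K"
          using mem_sat_insert[OF M saturated_ideal[OF K] g] by auto
        \<comment> \<open>For \<open>r\<close> in \<open>M\<close> the multiple \<open>rg\<close> is
          already in \<open>J\<close>, which gives \<open>u\<close> in \<open>K\<close>; for
          \<open>r\<close> outside \<open>M\<close> the element \<open>g\<close> itself would lie in
          \<open>K'\<close>.\<close>
        show False
        proof (cases "r \<in> M")
          case True
          hence "r \<otimes> g \<in> K" using gJ JK by auto
          hence "s \<otimes> u \<in> K" using ideal_minus_cancel[OF saturated_ideal[OF K] s(3)] s uc by auto
          thus False using saturatedD[OF K] s uc u by auto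
        next
          case False
          have "s \<otimes> u \<in> K'" using ideal_mult[OF saturated_ideal[OF saturated_chain_Suc(3)] u(1)] s by auto
          moreover have "s \<otimes> u \<ominus> r \<otimes> g \<in> K'" using s saturated_chain_Suc(2) by auto
          ultimately have "r \<otimes> g \<in> K'"
            using ideal_minus_cancel'[OF saturated_ideal[OF saturated_chain_Suc(3)]] s g by auto
          thus False using saturatedD[OF saturated_chain_Suc(3)] False s g gK' by auto
        qed
      qed
      moreover have "u \<in> sat M (insert g K')" using u uc by (intro sat_upper') auto
      ultimately show ?thesis by auto
    qed
    hence "saturated_chain M (sat M (insert g I)) (Suc n') (sat M (insert g K'))"
      using saturated_chain.saturated_chain_Suc[OF n'(1) _ saturated_sat] sub by blast
    thus ?thesis using n'(2) True saturated_chain_Suc(2) by (auto split: if_splits)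
  next
    case False
    hence g': "g \<notin> K" "g \<in> K'" "g \<notin> I" using saturated_chain_sub[OF saturated_chain_Suc(1)] by auto
    have nn: "n \<le> n'" using n'(2) g' by auto
    have "\<exists>n''\<ge>n'. saturated_chain M (sat M (insert g I)) n'' (sat M (insert g K'))"
    proof (cases "sat M (insert g K) = sat M (insert g K')")
      case True thus ?thesis using n' by auto
    next
      case False
      hence "saturated_chain M (sat M (insert g I)) (Suc n') (sat M (insert g K'))"
        using saturated_chain.saturated_chain_Suc[OF n'(1) _ saturated_sat] sub by blast
      thus ?thesis by (intro exI[of _ "Suc n'"]) auto
    qed
    thus ?thesis using nn g' by (auto intro: exI)
  qed
qed

lemma colength_le_insert:
  assumes "primeideal M R" "g \<in> carrier R" "J \<subseteq> carrier R" "\<And>p. p \<in> M \<Longrightarrow> p \<otimes> g \<in> J" "colength_le M (sat M (insert g J)) k"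
  shows "colength_le M J (Suc k)"
  unfolding colength_le_def
proof (intro allI impI)
  fix I n K assume A: "saturated M I \<and> J \<subseteq> I \<and> saturated_chain M I n K"
  then obtain n' where n': "saturated_chain M (sat M (insert g I)) n' (sat M (insert g K))"
    "n \<le> n' + (if g \<in> K \<and> g \<notin> I then 1 else 0)"
    using saturated_chain_insert[OF assms(1,2), of J I n K] assms(4) by blast
  have "sat M (insert g J) \<subseteq> sat M (insert g I)" using A by (intro sat_mono) auto
  hence "n' \<le> k" using assms(5) n'(1) saturated_sat unfolding colength_le_def by blast
  thus "n \<le> Suc k" using n'(2) by (auto split: if_splits)
qed

lemma colength_le_carrier: "carrier R \<subseteq> J \<Longrightarrow> colength_le M J 0"
  unfolding colength_le_def
proof (intro allI impI)
  fix I n K assume "carrier R \<subseteq> J" and A: "saturated M I \<and> J \<subseteq> I \<and> saturated_chain M I n K"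
  hence c: "carrier R \<subseteq> I" by auto
  from A have "saturated_chain M I n K" by simp
  thus "n \<le> 0" using c A
  proof (cases rule: saturated_chain.cases)
    case (saturated_chain_Suc m L)
    thus ?thesis using c saturated_chain_sub[OF saturated_chain_Suc(2)] ideal_sub[OF saturated_ideal[OF saturated_chain_Suc(4)]] by auto
  qed auto
qed

lemma colength_le_mono: "colength_le M J k \<Longrightarrow> J \<subseteq> J' \<Longrightarrow> k \<le> k' \<Longrightarrow> colength_le M J' k'"
  unfolding colength_le_def by (meson order.trans)

end

section \<open>The principal ideal theorem and chains of primes\<close>

context noetherian_cring
begin

text \<open>Unless \<open>J\<close> is the whole ring, the only available associated prime of
  \<open>J\<close> is \<open>M\<close>. So some \<open>g\<close> outside \<open>J\<close> is killed
  by \<open>M\<close> modulo \<open>J\<close>, and adjoining it costs one unit of length; Noetherian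
  induction ends the process.\<close>

lemma finite_length_of_unique_prime:
  assumes M: "primeideal M R" and J: "saturated M J"
    and uniq: "\<And>P. primeideal P R \<Longrightarrow> J \<subseteq> P \<Longrightarrow> P \<subseteq> M \<Longrightarrow> P = M"
  shows "\<exists>k. colength_le M J k"
proof -
  have "saturated M J \<longrightarrow> (\<forall>P. primeideal P R \<longrightarrow> J \<subseteq> P \<longrightarrow> P \<subseteq> M \<longrightarrow> P = M) \<longrightarrow> (\<exists>k. colength_le M J k)"
    using saturated_ideal[OF J]
  proof (induction rule: noetherian_induct)
    case (step J)
    show ?case
    proof (intro impI)
      assume J: "saturated M J" and uniq: "\<forall>P. primeideal P R \<longrightarrow> J \<subseteq> P \<longrightarrow> P \<subseteq> M \<longrightarrow> P = M"
      show "\<exists>k. colength_le M J k"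
      proof (cases "\<one> \<in> J")
        case True
        hence "carrier R \<subseteq> J" using ideal.one_imp_carrier[OF step(1)] by simp
        thus ?thesis using colength_le_carrier by blast
      next
        case False
        then obtain g where g: "g \<in> carrier R" "g \<notin> J"
          "primeideal {c \<in> carrier R. c \<otimes> g \<in> J} R" "{c \<in> carrier R. c \<otimes> g \<in> J} \<subseteq> M"
          using associated_prime_exists[OF M J one_closed] by auto
        have eq: "{c \<in> carrier R. c \<otimes> g \<in> J} = M"
          using uniq g colon_carr_subset[OF step(1) g(1)] by blast
        let ?K = "sat M (insert g J)"
        have up: "insert g J \<subseteq> ?K" using g ideal_sub[OF step(1)] by (intro sat_upper) auto
        hence "J \<subset> ?K" using g by auto
        then obtain k where "colength_le M ?K k"
          using step(2)[OF sat_ideal] saturated_sat uniq by blast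
        hence "colength_le M J (Suc k)"
          using colength_le_insert[OF M g(1) ideal_sub[OF step(1)]] eq by blast
        thus ?thesis by blast
      qed
    qed
  qed
  thus ?thesis using J uniq by blast
qed

text \<open>A member \<open>c\<close> of the chain is sent to \<open>I + (c + Rx)y\<close>, which is
  \<open>K c\<close> in the proof. If two consecutive images agreed, then cancelling
  \<open>y\<close> and afterwards \<open>x\<close>, both outside \<open>P'\<close>, would put
  \<open>c'\<close> into \<open>c + xc'\<close> locally at \<open>P\<close>, and Nakayama's lemma
  would collapse the step. Thus length at the smaller prime bounds length at the larger one from
  below.\<close>

lemma saturated_chain_multiply:
  assumes P: "primeideal P R" and P': "primeideal P' R" and sub: "P' \<subseteq> P"
    and x: "x \<in> P" "x \<notin> P'" and y: "y \<in> carrier R" "y \<notin> P'" and I: "saturated P' I"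
    and ch: "saturated_chain P' I n (carrier R)"
  shows "saturated_chain P (sat P (insert (x \<otimes> y) I)) n (sat P (insert y I))"
proof -
  define L where "L c = {w \<in> carrier R. \<exists>r \<in> carrier R. w \<ominus> r \<otimes> x \<in> c}" for c
  define K where "K c = {z \<in> carrier R. \<exists>w \<in> L c. z \<ominus> w \<otimes> y \<in> I}" for c
  have xc: "x \<in> carrier R" using x ideal_carr[OF prime_ideal[OF P]] by auto
  have Ii: "ideal I R" using I saturated_ideal by auto
  have Li: "ideal (L c) R" if "ideal c R" for c using ideal_insert[OF that xc] by (simp add: L_def)
  have Ki: "ideal (K c) R" if "ideal c R" for c
    using ideal_plus_multiples[OF Ii Li[OF that] y(1)] by (simp add: K_def)
  have cL: "u \<in> L c" if "ideal c R" "u \<in> c" for c u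
  proof -
    have uc: "u \<in> carrier R" using that ideal_carr by blast
    have "u \<ominus> \<zero> \<otimes> x = u" using uc xc by algebra
    hence "u \<ominus> \<zero> \<otimes> x \<in> c" using that by (simp only:)
    thus ?thesis using uc unfolding L_def by blast
  qed
  have "saturated_chain P (sat P (K I)) n (sat P (K c))" if "saturated_chain P' I n c" for n c
    using that
  proof (induction rule: saturated_chain.induct[consumes 1, case_names 0 Suc])
    case 0 show ?case by (rule saturated_chain.saturated_chain_0)
  next
    case (Suc n c c')
    note I = Suc(1)
    have c: "saturated P' c" "saturated P' c'" using saturated_chain_saturated[OF Suc(1) \<open>saturated P' I\<close>] Suc by auto
    have ci: "ideal c R" "ideal c' R" using c saturated_ideal by auto
    have Ic: "I \<subseteq> c" using saturated_chain_sub[OF Suc(1)] by simp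
    have "K c \<subseteq> K c'" using Suc(2) by (fastforce simp: K_def L_def)
    hence sub1: "sat P (K c) \<subseteq> sat P (K c')" by (rule sat_mono)
    have "sat P (K c) \<noteq> sat P (K c')"
    proof
      assume eq: "sat P (K c) = sat P (K c')"
      have key: "\<exists>s \<in> carrier R - P. \<exists>r \<in> c'. s \<otimes> u \<ominus> r \<otimes> x \<in> c" if u: "u \<in> c'" for u
      proof -
        have uc: "u \<in> carrier R" using u ideal_carr[OF ci(2)] by auto
        have "u \<otimes> y \<ominus> u \<otimes> y = \<zero>" using uc y by algebra
        hence "u \<otimes> y \<ominus> u \<otimes> y \<in> I" using ideal_zero[OF Ii] by (simp only:)
        hence "u \<otimes> y \<in> K c'" using cL[OF ci(2) u] m_closed[OF uc y(1)] unfolding K_def by blast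
        hence "u \<otimes> y \<in> sat P (K c)" using eq sat_upper[OF ideal_sub[OF Ki[OF ci(2)]], of P] by auto
        then obtain s where s: "s \<in> carrier R - P" "s \<otimes> (u \<otimes> y) \<in> K c"
          using mem_sat_ideal[OF P Ki[OF ci(1)]] by auto
        then obtain w where w: "w \<in> L c" "s \<otimes> (u \<otimes> y) \<ominus> w \<otimes> y \<in> I" by (auto simp: K_def)
        then obtain r where r: "r \<in> carrier R" "w \<ominus> r \<otimes> x \<in> c" by (auto simp: L_def)
        have wc: "w \<in> carrier R" using w by (auto simp: L_def)
        have "s \<otimes> (u \<otimes> y) \<ominus> w \<otimes> y = y \<otimes> (s \<otimes> u \<ominus> w)" using s(1) uc y wc by (simp, algebra)
        hence "y \<otimes> (s \<otimes> u \<ominus> w) \<in> c" using w Ic by auto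
        hence 1: "s \<otimes> u \<ominus> w \<in> c" using saturatedD[OF c(1)] y s(1) uc wc by auto
        have "s \<otimes> u \<ominus> r \<otimes> x = (s \<otimes> u \<ominus> w) \<oplus> (w \<ominus> r \<otimes> x)" using s(1) uc wc r xc by (simp, algebra)
        hence 2: "s \<otimes> u \<ominus> r \<otimes> x \<in> c" using ideal_add[OF ci(1) 1 r(2)] by simp
        have "s \<otimes> u \<in> c'" using ideal_mult[OF ci(2) u] s by auto
        hence "r \<otimes> x \<in> c'" using ideal_minus_cancel'[OF ci(2), of "s \<otimes> u"] 2 Suc(2) r xc by auto
        hence "x \<otimes> r \<in> c'" using r xc m_comm by simp
        hence "r \<in> c'" using saturatedD[OF c(2)] x xc r by auto
        thus ?thesis using s(1) 2 by auto
      qed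
      have "c' \<subseteq> c"
      proof (rule nakayama[OF P saturated_mono[OF c(1) sub] ideal_sub[OF ci(2)]])
        fix E assume E: "saturated P E" "c \<subseteq> E" "\<And>p u. p \<in> P \<Longrightarrow> u \<in> c' \<Longrightarrow> p \<otimes> u \<in> E"
        show "c' \<subseteq> E"
        proof
          fix u assume u: "u \<in> c'"
          then obtain s r where s: "s \<in> carrier R - P" "r \<in> c'" "s \<otimes> u \<ominus> r \<otimes> x \<in> c" using key by blast
          have uc: "u \<in> carrier R" and rc: "r \<in> carrier R" using u s ideal_carr[OF ci(2)] by auto
          have "r \<otimes> x \<in> E" using E(3)[OF x(1) s(2)] m_comm rc xc by simp
          hence "s \<otimes> u \<in> E" using ideal_minus_cancel[OF saturated_ideal[OF E(1)], of "s \<otimes> u" "r \<otimes> x"] E(2) s uc by auto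
          thus "u \<in> E" using saturatedD[OF E(1)] s uc by auto
        qed
      qed
      thus False using Suc(2) by auto
    qed
    thus ?case using saturated_chain.saturated_chain_Suc[OF Suc.IH _ saturated_sat] sub1 by blast
  qed
  hence main: "saturated_chain P (sat P (K I)) n (sat P (K (carrier R)))" using ch by blast
  have "L (carrier R) = carrier R" using xc by (auto simp: L_def intro!: bexI[of _ \<zero>])
  hence "sat P (K (carrier R)) = sat P (insert y I)"
    using sat_insert_eq[OF Ii y(1), of P] by (simp add: K_def)
  moreover have "sat P (K I) = sat P (insert (x \<otimes> y) I)"
  proof
    have "u \<in> sat P (insert (x \<otimes> y) I)" if u: "u \<in> K I" for u
    proof -
      obtain w r where w: "w \<in> carrier R" "u \<ominus> w \<otimes> y \<in> I" "r \<in> carrier R" "w \<ominus> r \<otimes> x \<in> I" "u \<in> carrier R"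
        using u by (auto simp: K_def L_def)
      have "u \<ominus> r \<otimes> (x \<otimes> y) = (u \<ominus> w \<otimes> y) \<oplus> y \<otimes> (w \<ominus> r \<otimes> x)" using w(1,3,5) xc y(1) by algebra
      hence "u \<ominus> r \<otimes> (x \<otimes> y) \<in> I" using ideal_add[OF Ii w(2) ideal_mult[OF Ii w(4) y(1)]] by simp
      hence "\<one> \<otimes> u \<ominus> r \<otimes> (x \<otimes> y) \<in> I" using w by simp
      thus ?thesis using mem_sat_insert[OF P Ii, of "x \<otimes> y" u] xc y w prime_compl_one[OF P] by blast
    qed
    thus "sat P (K I) \<subseteq> sat P (insert (x \<otimes> y) I)" by (intro sat_least[OF saturated_sat]) auto
    have "x \<otimes> y \<ominus> x \<otimes> y = \<zero>" "x \<ominus> \<one> \<otimes> x = \<zero>" using xc y by algebra+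
    hence z: "x \<otimes> y \<ominus> x \<otimes> y \<in> I" "x \<ominus> \<one> \<otimes> x \<in> I" using ideal_zero[OF Ii] by (simp_all only:)
    have "x \<in> L I" using z(2) xc one_closed unfolding L_def by blast
    hence "x \<otimes> y \<in> K I" using z(1) m_closed[OF xc y(1)] unfolding K_def by blast
    moreover have "u \<in> K I" if u: "u \<in> I" for u
    proof -
      have uc: "u \<in> carrier R" using u ideal_carr[OF Ii] by auto
      have "u \<ominus> \<zero> \<otimes> y = u" using uc y by algebra
      hence "u \<ominus> \<zero> \<otimes> y \<in> I" using u by (simp only:)
      thus ?thesis using uc ideal_zero[OF Li[OF Ii]] unfolding K_def by blast
    qed
    ultimately show "sat P (insert (x \<otimes> y) I) \<subseteq> sat P (K I)" by (intro sat_mono) auto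
  qed
  ultimately show ?thesis using main by simp
qed

text \<open>The choices \<open>y = 1, x, x ^ 2, ...\<close> in
  \<open>saturated_chain_multiply\<close> give adjacent chains of length \<open>n\<close> each, and
  these telescope.\<close>

lemma saturated_chain_power:
  assumes P: "primeideal P R" and P': "primeideal P' R" and sub: "P' \<subseteq> P"
    and x: "x \<in> P" "x \<notin> P'" and I: "saturated P' I" and ch: "saturated_chain P' I n (carrier R)"
  shows "saturated_chain P (sat P (insert (x [^] (k::nat)) I)) (k * n) (carrier R)"
proof (induction k)
  case 0
  have "\<one> \<in> sat P (insert \<one> I)" by (rule sat_upper') auto
  hence "sat P (insert \<one> I) = carrier R" using ideal.one_imp_carrier[OF sat_ideal] by blast
  thus ?case using saturated_chain.saturated_chain_0[of P "carrier R"] by simp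
next
  case (Suc k)
  have xc: "x \<in> carrier R" using x ideal_carr[OF prime_ideal[OF P]] by auto
  have "x [^] k \<notin> P'" using prime_pow[OF P' xc] x by auto
  hence "saturated_chain P (sat P (insert (x \<otimes> x [^] k) I)) n (sat P (insert (x [^] k) I))"
    using saturated_chain_multiply[OF P P' sub x _ _ I ch, of "x [^] k"] xc by simp
  thus ?case using saturated_chain_trans[OF Suc] xc by (simp add: m_comm add.commute)
qed

text \<open>Krull's principal ideal theorem. If no prime lay strictly between, then modulo the smallest
  prime the largest one would be minimal over the given element, so the corresponding localised
  quotient would have finite length; but it inherits the infinite chain of symbolic powers of the
  middle prime.\<close>

lemma principal_ideal_theorem:
  assumes P: "primeideal P R" and P1: "primeideal P1 R" and P2: "primeideal P2 R"
    and sub: "P \<subset> P1" "P1 \<subset> P2" and x: "x \<in> P2"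
  shows "\<exists>P'. primeideal P' R \<and> P \<subset> P' \<and> P' \<subset> P2 \<and> x \<in> P'"
proof (rule ccontr)
  assume no: "\<not> ?thesis"
  hence x1: "x \<notin> P1" using P1 sub by blast
  have xc: "x \<in> carrier R" using x ideal_carr[OF prime_ideal[OF P2]] by auto
  let ?J = "sat P2 (insert x P)"
  have Pc: "insert x P \<subseteq> carrier R" using xc ideal_sub[OF prime_ideal[OF P]] by auto
  have "Q = P2" if Q: "primeideal Q R" "?J \<subseteq> Q" "Q \<subseteq> P2" for Q
  proof -
    have "x \<in> Q" "P \<subseteq> Q" using sat_upper[OF Pc, of P2] Q by auto
    moreover have "x \<notin> P" using x1 sub by auto
    ultimately have "P \<subset> Q" by auto
    thus ?thesis using no Q \<open>x \<in> Q\<close> by blast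
  qed
  then obtain k where k: "colength_le P2 ?J k" using finite_length_of_unique_prime[OF P2 saturated_sat] by blast
  \<comment> \<open>\<open>T n\<close> is the n-th symbolic power of \<open>P1\<close> modulo
    \<open>P\<close>: each round multiplies by \<open>P1\<close> and saturates at
    \<open>P1\<close>.\<close>
  define T where "T = rec_nat (carrier R) (\<lambda>_ t. sat P1 (P \<union> {p \<otimes> v | p v. p \<in> P1 \<and> v \<in> t}))"
  have T: "T 0 = carrier R" "T (Suc n) = sat P1 (P \<union> {p \<otimes> v | p v. p \<in> P1 \<and> v \<in> T n})" for n
    by (simp_all add: T_def)
  have Ts: "saturated P1 (T n)" for n by (cases n) (simp_all add: T saturated_carrier saturated_sat)
  have Tc: "T n \<subseteq> carrier R" for n using Ts saturated_ideal ideal_sub by blast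
  have P1c: "P1 \<subseteq> carrier R" using P1 prime_ideal ideal_sub by blast
  have gen: "P \<union> {p \<otimes> v | p v. p \<in> P1 \<and> v \<in> T n} \<subseteq> carrier R" for n
    using Pc P1c Tc[of n] by (auto intro!: m_closed)
  have PT: "P \<subseteq> T n" for n using Pc sat_upper[OF gen, where M=P1] by (cases n) (auto simp: T)
  have dec: "T (Suc n) \<subseteq> T n" for n
  proof (induction n)
    case (Suc n) thus ?case unfolding T(2)[of "Suc n"] T(2)[of n] by (intro sat_mono) auto
  next
    case 0 show ?case using Tc T(1) by metis
  qed
  obtain w where w: "w \<in> P1" "w \<notin> P" using sub by auto
  have wT: "w [^] n \<in> T n" for n
  proof (induction n)
    case (Suc n)
    have "w [^] Suc n = w \<otimes> w [^] n" using w P1c by (simp add: m_comm subset_iff)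
    moreover have "w \<otimes> w [^] n \<in> T (Suc n)"
      unfolding T(2) by (rule subsetD[OF sat_upper[OF gen]]) (use Suc w in blast)
    ultimately show ?case by simp
  qed (simp add: T)
  \<comment> \<open>If the powers became stationary, Nakayama's lemma at \<open>P1\<close> would put
    \<open>T n\<close> inside \<open>P\<close>, although it contains \<open>w ^ n\<close> with
    \<open>w\<close> outside the prime \<open>P\<close>.\<close>
  have strict: "T (Suc n) \<noteq> T n" for n
  proof
    assume eq: "T (Suc n) = T n"
    have "T n \<subseteq> P"
    proof (rule nakayama[OF P1 saturated_prime[OF P] Tc])
      show "P \<subseteq> P1" using sub by auto
      fix E assume "saturated P1 E" "P \<subseteq> E" "\<And>p u. p \<in> P1 \<Longrightarrow> u \<in> T n \<Longrightarrow> p \<otimes> u \<in> E"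
      hence "T (Suc n) \<subseteq> E" unfolding T(2) by (intro sat_least) auto
      thus "T n \<subseteq> E" using eq by simp
    qed
    thus False using wT prime_pow[OF P] w P1c by blast
  qed
  have "saturated_chain P1 (T n) n (carrier R)" for n
  proof (induction n)
    case 0 show ?case using saturated_chain.saturated_chain_0 T by metis
  next
    case (Suc n)
    have "saturated_chain P1 (T (Suc n)) (Suc 0) (T n)"
      using saturated_chain.saturated_chain_Suc[OF saturated_chain.saturated_chain_0[of P1 "T (Suc n)"] _ Ts] dec strict by blast
    from saturated_chain_trans[OF Suc this] show ?case by simp
  qed
  \<comment> \<open>With exponent 1 the power lemma carries the \<open>k + 1\<close> steps at
    \<open>P1\<close> to a chain at \<open>P2\<close> above \<open>P\<close> and \<open>x\<close>,
    one step longer than \<open>k\<close> allows.\<close>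
  hence "saturated_chain P2 (sat P2 (insert (x [^] (1::nat)) (T (Suc k)))) (1 * Suc k) (carrier R)"
    using saturated_chain_power[OF P2 P1 _ x x1 Ts] sub by blast
  moreover have "?J \<subseteq> sat P2 (insert (x [^] (1::nat)) (T (Suc k)))" using PT xc by (intro sat_mono) auto
  ultimately have "1 * Suc k \<le> k" using k saturated_sat unfolding colength_le_def by blast
  thus False by simp
qed

end

section \<open>Chains of primes and Krull's height theorem\<close>

context cring
begin

inductive prime_path :: "'a set \<Rightarrow> nat \<Rightarrow> 'a set \<Rightarrow> bool" where
  prime_path_0: "primeideal P R \<Longrightarrow> prime_path P 0 P"
| prime_path_Suc: "primeideal P R \<Longrightarrow> P \<subset> P' \<Longrightarrow> prime_path P' n Q \<Longrightarrow> prime_path P (Suc n) Q"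

lemma prime_path_prime: "prime_path P n Q \<Longrightarrow> primeideal P R \<and> primeideal Q R"
  by (induction rule: prime_path.induct) auto

lemma prime_path_sub: "prime_path P n Q \<Longrightarrow> P \<subseteq> Q"
  by (induction rule: prime_path.induct) auto

lemma prime_path_strict: "prime_path P n Q \<Longrightarrow> 0 < n \<Longrightarrow> P \<subset> Q"
  by (induction rule: prime_path.induct) (auto dest: prime_path_sub)

lemma prime_path_trans: "prime_path P m P' \<Longrightarrow> prime_path P' n Q \<Longrightarrow> prime_path P (m + n) Q"
  by (induction rule: prime_path.induct) (auto intro: prime_path.intros)

lemma prime_path_step: "primeideal P R \<Longrightarrow> primeideal Q R \<Longrightarrow> P \<subset> Q \<Longrightarrow> prime_path P (Suc 0) Q"
  by (auto intro: prime_path.intros)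

end

context noetherian_cring
begin

text \<open>Once the part above \<open>P'\<close> has been moved to a prime \<open>P1\<close>
  containing \<open>x\<close>, the principal ideal theorem for \<open>P\<close>, \<open>P'\<close>
  and \<open>P1\<close> supplies a new lower end between \<open>P\<close> and \<open>P1\<close> that
  contains \<open>x\<close>. Only one step is lost.\<close>

lemma prime_path_move:
  assumes "prime_path P n Q" "x \<in> Q" "0 < n"
  shows "\<exists>P1. prime_path P1 (n - 1) Q \<and> P \<subset> P1 \<and> x \<in> P1"
  using assms
proof (induction rule: prime_path.induct)
  case (prime_path_Suc P P' n Q)
  show ?case
  proof (cases n)
    case 0
    hence "P' = Q" using prime_path_Suc(3) by (auto elim: prime_path.cases)
    thus ?thesis using prime_path_Suc 0 by auto
  next
    case (Suc m)
    then obtain P1 where P1: "prime_path P1 m Q" "P' \<subset> P1" "x \<in> P1" using prime_path_Suc by auto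
    then obtain P2 where P2: "primeideal P2 R" "P \<subset> P2" "P2 \<subset> P1" "x \<in> P2"
      using principal_ideal_theorem[of P P' P1 x] prime_path_Suc(1,2) prime_path_prime[OF prime_path_Suc(3)] prime_path_prime[OF P1(1)] by blast
    have "prime_path P2 (Suc m) Q" using prime_path.prime_path_Suc[OF P2(1,3) P1(1)] .
    thus ?thesis using P2 Suc by auto
  qed
qed auto

lemma prime_path_move_list:
  "prime_path P n Q \<Longrightarrow> set ys \<subseteq> Q \<Longrightarrow> length ys \<le> n \<Longrightarrow>
    \<exists>P1. prime_path P1 (n - length ys) Q \<and> P \<subseteq> P1 \<and> set ys \<subseteq> P1"
proof (induction ys arbitrary: P n)
  case (Cons y ys)
  then obtain P1 where P1: "prime_path P1 (n - 1) Q" "P \<subset> P1" "y \<in> P1" using prime_path_move[of P n Q y] by auto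
  have "length ys \<le> n - 1" using Cons.prems(3) by simp
  then obtain P2 where "prime_path P2 (n - 1 - length ys) Q" "P1 \<subseteq> P2" "set ys \<subseteq> P2"
    using Cons.IH[OF P1(1)] Cons.prems(2) by auto
  thus ?case using P1 by (intro exI[of _ P2]) auto
qed auto

text \<open>Krull's height theorem relative to \<open>P\<close>: every element is absorbed into the
  lower end for one step, and if steps remained, that end would be a prime below \<open>M\<close>
  containing all of them.\<close>

lemma prime_path_length_le:
  assumes "prime_path P n M" "set ys \<subseteq> M"
    and "\<And>P'. primeideal P' R \<Longrightarrow> P \<subseteq> P' \<Longrightarrow> set ys \<subseteq> P' \<Longrightarrow> P' \<subseteq> M \<Longrightarrow> P' = M"
  shows "n \<le> length ys"
proof (rule ccontr)
  assume "\<not> n \<le> length ys"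
  then obtain P1 where P1: "prime_path P1 (n - length ys) M" "P \<subseteq> P1" "set ys \<subseteq> P1"
    using prime_path_move_list[OF assms(1,2)] by auto
  hence "P1 \<subset> M" using prime_path_strict[OF P1(1)] \<open>\<not> n \<le> length ys\<close> by auto
  thus False using assms(3) P1 prime_path_prime[OF P1(1)] by blast
qed

text \<open>Each parameter moves the lower end of the chain of primes up by one step and multiplies
  the length by \<open>q\<close>, through \<open>saturated_chain_power\<close>. No regularity of the
  parameters enters, only the chain of primes.\<close>

lemma saturated_chain_parameter_powers:
  assumes "prime_path P (length ys) M" "set ys \<subseteq> M"
    and "\<And>P'. primeideal P' R \<Longrightarrow> P \<subseteq> P' \<Longrightarrow> set ys \<subseteq> P' \<Longrightarrow> P' \<subseteq> M \<Longrightarrow> P' = M"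
    and "saturated P J" "saturated_chain P J k (carrier R)"
  shows "\<exists>I. saturated M I \<and> J \<subseteq> I \<and> (\<lambda>y. y [^] q) ` set ys \<subseteq> I \<and> saturated_chain M I (q ^ length ys * k) (carrier R)"
  using assms
proof (induction ys arbitrary: P J k)
  case Nil
  hence "P = M" by (auto elim: prime_path.cases)
  thus ?case using Nil by auto
next
  case (Cons y ys)
  \<comment> \<open>Otherwise \<open>ys\<close> alone would cut out \<open>M\<close> over
    \<open>P\<close>, and a chain of \<open>length ys + 1\<close> steps would contradict the height
    theorem.\<close>
  have "y \<notin> P"
  proof
    assume "y \<in> P"
    hence "length (y # ys) \<le> length ys"
      using prime_path_length_le[OF Cons.prems(1), of ys] Cons.prems(2,3) by auto
    thus False by simp
  qed
  obtain P1 where P1: "prime_path P1 (length ys) M" "P \<subset> P1" "y \<in> P1"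
    using prime_path_move[OF Cons.prems(1), of y] Cons.prems(2) by auto
  have yc: "y \<in> carrier R" using P1 prime_path_prime[OF P1(1)] ideal_carr[OF prime_ideal] by blast
  have P: "primeideal P R" using prime_path_prime[OF Cons.prems(1)] by auto
  let ?J = "sat P1 (insert (y [^] q) J)"
  have "saturated_chain P1 ?J (q * k) (carrier R)"
    using saturated_chain_power[of P1 P y J k q] prime_path_prime[OF P1(1)] P P1 \<open>y \<notin> P\<close> Cons.prems by blast
  moreover have "P' = M" if "primeideal P' R" "P1 \<subseteq> P'" "set ys \<subseteq> P'" "P' \<subseteq> M" for P'
    using Cons.prems(3)[OF that(1) _ _ that(4)] that P1(2,3) by auto
  moreover have "set ys \<subseteq> M" using Cons.prems(2) by simp
  ultimately obtain I where I: "saturated M I" "?J \<subseteq> I" "(\<lambda>y. y [^] q) ` set ys \<subseteq> I"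
    "saturated_chain M I (q ^ length ys * (q * k)) (carrier R)"
    using Cons.IH[OF P1(1) _ _ saturated_sat, of "insert (y [^] q) J" "q * k"] by blast
  have "insert (y [^] q) J \<subseteq> ?J" using yc ideal_sub[OF saturated_ideal[OF Cons.prems(4)]] by (intro sat_upper) auto
  thus ?case using I by (intro exI[of _ I]) (auto simp: ac_simps)
qed

lemma parameter_powers_chain:
  assumes "prime_path P (length ys) M" "set ys \<subseteq> M"
    and "\<And>P'. primeideal P' R \<Longrightarrow> P \<subseteq> P' \<Longrightarrow> set ys \<subseteq> P' \<Longrightarrow> P' \<subseteq> M \<Longrightarrow> P' = M"
  shows "\<exists>I. saturated M I \<and> P \<subseteq> I \<and> (\<lambda>y. y [^] q) ` set ys \<subseteq> I \<and> saturated_chain M I (q ^ length ys) (carrier R)"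
proof -
  have P: "primeideal P R" using prime_path_prime[OF assms(1)] by auto
  have "P \<subset> carrier R" using ideal_sub[OF prime_ideal[OF P]] prime_one[OF P] by auto
  hence "saturated_chain P P (Suc 0) (carrier R)" using saturated_chain.saturated_chain_Suc[OF saturated_chain.saturated_chain_0 _ saturated_carrier] by blast
  thus ?thesis using saturated_chain_parameter_powers[OF assms saturated_prime[OF P]] by force
qed

end

section \<open>Order filtrations and lengths of hypersurfaces\<close>

text \<open>Read as digits in base \<open>B\<close>, exponent vectors with entries below
  \<open>B\<close> get distinct weights, hence a total order on the monomials of one degree.\<close>

lemma digits_unique:
  fixes a b :: "nat \<Rightarrow> nat"
  assumes "(\<Sum>i<r. a i * B ^ i) = (\<Sum>i<r. b i * B ^ i)" "\<And>i. i < r \<Longrightarrow> a i < B" "\<And>i. i < r \<Longrightarrow> b i < B" "i < r"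
  shows "a i = b i"
  using assms
proof (induction r arbitrary: a b i)
  case (Suc r)
  have split: "(\<Sum>i<Suc r. c i * B ^ i) = c 0 + B * (\<Sum>i<r. c (Suc i) * B ^ i)" for c :: "nat \<Rightarrow> nat"
    by (simp add: sum.lessThan_Suc_shift sum_distrib_left ac_simps del: sum.lessThan_Suc)
  have eq: "a 0 + B * (\<Sum>i<r. a (Suc i) * B ^ i) = b 0 + B * (\<Sum>i<r. b (Suc i) * B ^ i)"
    using Suc.prems(1) by (simp only: split)
  have lt: "a 0 < B" "b 0 < B" using Suc.prems by auto
  have 0: "a 0 = b 0" using arg_cong[OF eq, of "\<lambda>n. n mod B"] lt by simp
  hence "(\<Sum>i<r. a (Suc i) * B ^ i) = (\<Sum>i<r. b (Suc i) * B ^ i)" using eq lt by simp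
  hence "a (Suc j) = b (Suc j)" if "j < r" for j
    using Suc.IH[of "\<lambda>i. a (Suc i)" "\<lambda>i. b (Suc i)" j] Suc.prems that by auto
  thus ?case using 0 Suc.prems(4) by (cases i) auto
qed simp

context cring
begin

lemma colength_le_Un_finite:
  assumes "finite G"
  shows "primeideal M R \<Longrightarrow> G \<subseteq> carrier R \<Longrightarrow> J \<subseteq> carrier R \<Longrightarrow>
    (\<And>p g. p \<in> M \<Longrightarrow> g \<in> G \<Longrightarrow> p \<otimes> g \<in> J) \<Longrightarrow> colength_le M (sat M (J \<union> G)) n \<Longrightarrow> saturated M J \<Longrightarrow> colength_le M J (n + card G)"
  using assms
proof (induction G arbitrary: J rule: finite_induct)
  case empty
  thus ?case by (simp add: sat_saturated)
next
  case (insert g G)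
  let ?J = "sat M (insert g J)"
  have up: "insert g J \<subseteq> ?J" using insert.prems by (intro sat_upper) auto
  have "colength_le M ?J (n + card G)"
  proof (rule insert.IH)
    have "sat M (?J \<union> G) = sat M (insert g J \<union> G)" by (rule sat_sat_Un) (use insert.prems in auto)
    thus "colength_le M (sat M (?J \<union> G)) n" using insert.prems by simp
    show "p \<otimes> h \<in> ?J" if "p \<in> M" "h \<in> G" for p h using insert.prems(4) that up by blast
  qed (use insert.prems sat_sub_carrier saturated_sat in auto)
  hence "colength_le M J (Suc (n + card G))"
    using colength_le_insert[of M g J] insert.prems by auto
  thus ?case using insert.hyps by simp
qed

end

text \<open>Modulo \<open>J0\<close>, the elements \<open>y i\<close> generate the maximal ideal of the localisation at \<open>M\<close>;
  \<open>Mk k\<close> below is the preimage of its \<open>k\<close>-th power.\<close>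

locale coordinates = noetherian_cring +
  fixes M J0 :: "'a set" and y :: "nat \<Rightarrow> 'a" and r :: nat
  assumes M: "primeideal M R" and J0: "saturated M J0" and y: "\<And>i. i < r \<Longrightarrow> y i \<in> M"
    and J0_sub: "J0 \<subseteq> M" and gen: "M \<subseteq> sat M (J0 \<union> y ` {..<r})"
begin

text \<open>Exponent vectors are total functions whose values from \<open>r\<close> on are not read,
  so one monomial has many vectors; counting later passes to extensional functions.\<close>

definition mon :: "(nat \<Rightarrow> nat) \<Rightarrow> 'a" where "mon \<nu> = finprod R (\<lambda>i. y i [^] \<nu> i) {..<r}"

definition deg :: "(nat \<Rightarrow> nat) \<Rightarrow> nat" where "deg \<nu> = sum \<nu> {..<r}"

definition Mk :: "nat \<Rightarrow> 'a set" where "Mk k = sat M (J0 \<union> {mon \<nu> | \<nu>. deg \<nu> = k})"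

lemma y_carrier: "i < r \<Longrightarrow> y i \<in> carrier R"
  using y M prime_ideal ideal_carr by blast

lemma mon_carrier: "mon \<nu> \<in> carrier R"
  unfolding mon_def by (rule finprod_closed) (auto intro: y_carrier)

lemma mon_add: "mon (\<lambda>i. \<nu> i + \<kappa> i) = mon \<nu> \<otimes> mon \<kappa>"
proof -
  have "mon (\<lambda>i. \<nu> i + \<kappa> i) = finprod R (\<lambda>i. y i [^] \<nu> i \<otimes> y i [^] \<kappa> i) {..<r}"
    unfolding mon_def by (rule finprod_cong') (auto simp: nat_pow_mult y_carrier)
  thus ?thesis unfolding mon_def by (simp add: finprod_multf y_carrier Pi_def)
qed

lemma mon_cong: "(\<And>i. i < r \<Longrightarrow> \<nu> i = \<kappa> i) \<Longrightarrow> mon \<nu> = mon \<kappa>"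
  unfolding mon_def by (rule finprod_cong') (auto simp: y_carrier)

lemma mon_single: "i < r \<Longrightarrow> mon (\<lambda>j. if j = i then n else 0) = y i [^] n"
proof -
  assume i: "i < r"
  have "mon (\<lambda>j. if j = i then n else 0) = finprod R (\<lambda>j. if i = j then y i [^] n else \<one>) {..<r}"
    unfolding mon_def using i by (intro finprod_cong') (auto simp: y_carrier)
  also have "\<dots> = y i [^] n"
    using finprod_singleton[of i "{..<r}" "\<lambda>_. y i [^] n"] i y_carrier by auto
  finally show ?thesis .
qed

lemma mon_zero: "mon (\<lambda>_. 0) = \<one>"
  unfolding mon_def by (simp add: finprod_one_eqI)

lemma deg_add: "deg (\<lambda>i. \<nu> i + \<kappa> i) = deg \<nu> + deg \<kappa>"
  by (simp add: deg_def sum.distrib)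

lemma deg_single: "i < r \<Longrightarrow> deg (\<lambda>j. if j = i then n else 0) = n"
  by (simp add: deg_def)

lemma Mk_gen: "J0 \<union> {mon \<nu> | \<nu>. deg \<nu> = k} \<subseteq> carrier R"
  using mon_carrier ideal_sub[OF saturated_ideal[OF J0]] by auto

lemma Mk_saturated: "saturated M (Mk k)"
  unfolding Mk_def by (rule saturated_sat)

lemma Mk_ideal: "ideal (Mk k) R"
  using Mk_saturated saturated_ideal by blast

lemma J0_Mk: "J0 \<subseteq> Mk k"
  unfolding Mk_def using sat_upper[OF Mk_gen] by blast

lemma mon_Mk: "deg \<nu> = k \<Longrightarrow> mon \<nu> \<in> Mk k"
  unfolding Mk_def using sat_upper[OF Mk_gen] by blast

lemma Mk_least: "saturated M E \<Longrightarrow> J0 \<subseteq> E \<Longrightarrow> (\<And>\<nu>. deg \<nu> = k \<Longrightarrow> mon \<nu> \<in> E) \<Longrightarrow> Mk k \<subseteq> E"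
  unfolding Mk_def by (intro sat_least) auto

lemma Mk_0: "Mk 0 = carrier R"
proof -
  have "\<one> \<in> Mk 0" using mon_Mk[of "\<lambda>_. 0" 0] mon_zero by (simp add: deg_def)
  thus ?thesis using ideal.one_imp_carrier[OF Mk_ideal] by blast
qed

lemma Mk_mon_mult:
  assumes "u \<in> Mk j" shows "mon \<kappa> \<otimes> u \<in> Mk (deg \<kappa> + j)"
proof -
  have "Mk j \<subseteq> {u \<in> carrier R. u \<otimes> mon \<kappa> \<in> Mk (deg \<kappa> + j)}"
  proof (rule Mk_least[OF colon_saturated[OF Mk_saturated mon_carrier]])
    show "J0 \<subseteq> {u \<in> carrier R. u \<otimes> mon \<kappa> \<in> Mk (deg \<kappa> + j)}"
      using J0_Mk ideal_mult_right[OF Mk_ideal _ mon_carrier] ideal_carr[OF saturated_ideal[OF J0]] by blast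
    show "mon \<nu> \<in> {u \<in> carrier R. u \<otimes> mon \<kappa> \<in> Mk (deg \<kappa> + j)}" if "deg \<nu> = j" for \<nu>
      using mon_Mk[of "\<lambda>i. \<nu> i + \<kappa> i"] that mon_carrier by (simp add: mon_add deg_add add.commute m_comm)
  qed
  thus ?thesis using assms mon_carrier m_comm ideal_carr[OF Mk_ideal] by auto
qed

lemma Mk_M_mult:
  assumes p: "p \<in> M" and u: "u \<in> Mk k" shows "p \<otimes> u \<in> Mk (Suc k)"
proof -
  have uc: "u \<in> carrier R" using u ideal_carr[OF Mk_ideal] by blast
  have "sat M (J0 \<union> y ` {..<r}) \<subseteq> {p \<in> carrier R. p \<otimes> u \<in> Mk (Suc k)}"
  proof (rule sat_least[OF colon_saturated[OF Mk_saturated uc]])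
    have "J0 \<subseteq> {p \<in> carrier R. p \<otimes> u \<in> Mk (Suc k)}"
      using J0_Mk ideal_mult_right[OF Mk_ideal _ uc] ideal_carr[OF saturated_ideal[OF J0]] by blast
    moreover have "y i \<otimes> u \<in> Mk (Suc k)" if "i < r" for i
      using Mk_mon_mult[OF u, of "\<lambda>j. if j = i then 1 else 0"] that y_carrier
      by (simp add: mon_single deg_single)
    ultimately show "J0 \<union> y ` {..<r} \<subseteq> {p \<in> carrier R. p \<otimes> u \<in> Mk (Suc k)}"
      using y_carrier by auto
  qed
  thus ?thesis using gen p by blast
qed

lemma deg_pos: "deg \<nu> > 0 \<Longrightarrow> \<exists>i<r. \<nu> i > 0"
  unfolding deg_def by (metis lessThan_iff not_gr0 sum.neutral)

lemma mon_diff: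
  assumes "\<And>i. i < r \<Longrightarrow> \<mu> i \<le> \<nu> i"
  shows "mon \<nu> = mon (\<lambda>i. \<nu> i - \<mu> i) \<otimes> mon \<mu>" "deg \<nu> = deg (\<lambda>i. \<nu> i - \<mu> i) + deg \<mu>"
  using assms unfolding mon_add[symmetric] deg_add[symmetric]
  by (auto intro!: mon_cong simp: deg_def)

text \<open>With \<open>Mk_M_mult\<close> this makes \<open>Mk (Suc k)\<close> the least saturated
  ideal that contains \<open>J0\<close> and all products from \<open>M\<close> and
  \<open>Mk k\<close>, the form in which Nakayama's lemma meets the filtration.\<close>

lemma Mk_Suc_least:
  assumes E: "saturated M E" "J0 \<subseteq> E" and mult: "\<And>p u. p \<in> M \<Longrightarrow> u \<in> Mk k \<Longrightarrow> p \<otimes> u \<in> E"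
  shows "Mk (Suc k) \<subseteq> E"
proof (rule Mk_least[OF E])
  fix \<nu> assume nu: "deg \<nu> = Suc k"
  then obtain i where i: "i < r" "\<nu> i > 0" using deg_pos by (metis zero_less_Suc)
  let ?\<mu> = "\<lambda>j. if j = i then 1 else 0"
  have "\<And>j. j < r \<Longrightarrow> ?\<mu> j \<le> \<nu> j" using i by auto
  note d = mon_diff[OF this]
  have "mon \<nu> = y i \<otimes> mon (\<lambda>j. \<nu> j - ?\<mu> j)"
    using d(1) mon_single[OF i(1), of 1] y_carrier[OF i(1)] mon_carrier m_comm by simp
  moreover have "mon (\<lambda>j. \<nu> j - ?\<mu> j) \<in> Mk k"
    using d(2) nu deg_single[OF i(1), of 1] by (intro mon_Mk) simp
  ultimately show "mon \<nu> \<in> E" using mult y i by simp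
qed

lemma Mk_dec: "Mk (Suc k) \<subseteq> Mk k"
  using M by (intro Mk_Suc_least Mk_saturated J0_Mk) (auto intro: ideal_mult[OF Mk_ideal] ideal_carr[OF prime_ideal])

lemma Mk_antimono: "j \<le> k \<Longrightarrow> Mk k \<subseteq> Mk j"
  by (induction rule: dec_induct) (use Mk_dec in auto)

text \<open>In a monomial of degree \<open>r * n\<close> some exponent is at least \<open>n\<close>.
  The factor \<open>t\<close> in the numerical bound of the theorem originates here.\<close>

lemma Mk_pigeonhole:
  assumes K: "saturated M K" "J0 \<subseteq> K" and r: "0 < r" and pow: "\<And>i. i < r \<Longrightarrow> y i [^] n \<in> K"
  shows "Mk (r * n) \<subseteq> K"
proof (rule Mk_least[OF K])
  fix \<nu> assume nu: "deg \<nu> = r * n"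
  have "\<exists>i<r. n \<le> \<nu> i"
  proof (rule ccontr)
    assume "\<not> ?thesis"
    hence "sum \<nu> {..<r} < sum (\<lambda>_. n) {..<r}" using r by (intro sum_strict_mono) auto
    thus False using nu by (simp add: deg_def)
  qed
  then obtain i where i: "i < r" "n \<le> \<nu> i" by auto
  let ?\<mu> = "\<lambda>j. if j = i then n else 0"
  have "\<And>j. j < r \<Longrightarrow> ?\<mu> j \<le> \<nu> j" using i by auto
  hence "mon \<nu> = mon (\<lambda>j. \<nu> j - ?\<mu> j) \<otimes> y i [^] n"
    using mon_diff(1)[of ?\<mu> \<nu>] mon_single[OF i(1)] by simp
  thus "mon \<nu> \<in> K" using pow[OF i(1)] ideal_mult[OF saturated_ideal[OF K(1)] _ mon_carrier] by simp
qed

text \<open>The ideals \<open>J + Mk k\<close> filter \<open>R/J\<close>. In each degree the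
  spanning monomials are killed by \<open>M\<close> modulo the next term of the filtration, so they
  contribute at most their number.\<close>

lemma colength_le_by_degree:
  assumes J: "saturated M J" and N: "Mk N \<subseteq> J" and F: "\<And>k. k < N \<Longrightarrow> finite (F k)"
    "\<And>k \<nu>. k < N \<Longrightarrow> \<nu> \<in> F k \<Longrightarrow> deg \<nu> = k"
    and span: "\<And>k. k < N \<Longrightarrow> Mk k \<subseteq> sat M (J \<union> Mk (Suc k) \<union> mon ` F k)"
  shows "colength_le M J (\<Sum>k<N. card (F k))"
proof -
  have Jc: "J \<subseteq> carrier R" using J saturated_ideal ideal_sub by blast
  have Mc: "Mk k \<subseteq> carrier R" for k using Mk_ideal ideal_sub by blast
  have Gc: "mon ` F k \<subseteq> carrier R" for k using mon_carrier by auto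
  have "k \<le> N \<Longrightarrow> colength_le M (sat M (J \<union> Mk k)) (\<Sum>i<k. card (F i))" for k
  proof (induction k)
    case 0
    have "Mk 0 \<subseteq> sat M (J \<union> Mk 0)" using sat_upper[of "J \<union> Mk 0" M] Jc Mc by blast
    thus ?case using colength_le_carrier Mk_0 by simp
  next
    case (Suc k)
    let ?J = "sat M (J \<union> Mk (Suc k))"
    have up: "J \<union> Mk (Suc k) \<subseteq> ?J" using sat_upper[of "J \<union> Mk (Suc k)" M] Jc Mc by blast
    have eq: "sat M (?J \<union> mon ` F k) = sat M (J \<union> Mk (Suc k) \<union> mon ` F k)"
      by (rule sat_sat_Un) (use Jc Mc Gc in auto)
    have "J \<union> Mk (Suc k) \<union> mon ` F k \<subseteq> sat M (J \<union> Mk (Suc k) \<union> mon ` F k)"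
      by (rule sat_upper) (use Jc Mc Gc in blast)
    hence "J \<subseteq> sat M (J \<union> Mk (Suc k) \<union> mon ` F k)" by blast
    hence "sat M (J \<union> Mk k) \<subseteq> sat M (?J \<union> mon ` F k)"
      unfolding eq using span[of k] Suc.prems by (intro sat_least[OF saturated_sat]) auto
    hence "colength_le M (sat M (?J \<union> mon ` F k)) (\<Sum>i<k. card (F i))"
      using colength_le_mono[OF Suc.IH] Suc.prems by simp
    moreover have "p \<otimes> g \<in> ?J" if p: "p \<in> M" and g: "g \<in> mon ` F k" for p g
    proof -
      obtain \<nu> where \<nu>: "\<nu> \<in> F k" "g = mon \<nu>" using g by auto
      have "deg \<nu> = k" using F(2)[OF _ \<nu>(1)] Suc.prems by simp
      from mon_Mk[OF this] have "g \<in> Mk k" unfolding \<nu>(2) .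
      thus ?thesis using Mk_M_mult p up by blast
    qed
    ultimately have "colength_le M ?J ((\<Sum>i<k. card (F i)) + card (mon ` F k))"
      using colength_le_Un_finite[OF _ M Gc sat_sub_carrier _ _ saturated_sat] F(1)[of k] Suc.prems by auto
    thus ?case by (rule colength_le_mono) (use card_image_le F(1)[of k] Suc.prems in auto)
  qed
  from this[of N] have "colength_le M (sat M (J \<union> Mk N)) (\<Sum>i<N. card (F i))" by simp
  moreover have "sat M (J \<union> Mk N) = J" using N sat_saturated[OF J] by (simp add: Un_absorb2)
  ultimately show ?thesis by simp
qed

section \<open>Leading monomials and lengths of hypersurfaces\<close>

definition weight :: "nat \<Rightarrow> (nat \<Rightarrow> nat) \<Rightarrow> nat" where "weight B \<nu> = (\<Sum>i<r. \<nu> i * B ^ i)"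

lemma weight_add: "weight B (\<lambda>i. \<nu> i + \<kappa> i) = weight B \<nu> + weight B \<kappa>"
  by (simp add: weight_def sum.distrib add_mult_distrib)

lemma component_le_deg: "i < r \<Longrightarrow> \<nu> i \<le> deg \<nu>"
  unfolding deg_def by (rule member_le_sum) auto

lemma weight_le: "0 < B \<Longrightarrow> weight B \<nu> \<le> deg \<nu> * B ^ r"
  unfolding weight_def deg_def sum_distrib_right
  by (intro sum_mono mult_le_mono2 power_increasing) auto

text \<open>A leading term in the associated graded ring, without forming that ring:
  \<open>f\<close> is followed to the last piece \<open>U j\<close> of the filtration by weight that
  contains it. There it is a multiple of one monomial modulo \<open>U (Suc j)\<close>, and the
  coefficient is a unit at \<open>M\<close>, since otherwise that term would lie in higher
  degree.\<close>

lemma leading_monomial: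
  assumes f: "f \<in> Mk s" "f \<notin> Mk (Suc s)" and B: "B = Suc s"
  shows "\<exists>\<mu>. deg \<mu> = s \<and>
    mon \<mu> \<in> sat M (insert f (Mk (Suc s) \<union> {mon \<nu> | \<nu>. deg \<nu> = s \<and> weight B \<mu> < weight B \<nu>}))"
proof -
  define U where "U j = sat M (Mk (Suc s) \<union> {mon \<nu> | \<nu>. deg \<nu> = s \<and> j \<le> weight B \<nu>})" for j
  have fc: "f \<in> carrier R" using f Mk_ideal ideal_carr by blast
  have gen: "Mk (Suc s) \<union> {mon \<nu> | \<nu>. deg \<nu> = s \<and> j \<le> weight B \<nu>} \<subseteq> carrier R" for j
    using mon_carrier ideal_sub[OF Mk_ideal] by auto
  note up = sat_upper[OF gen, where M=M, folded U_def]
  have Us: "saturated M (U j)" for j unfolding U_def by (rule saturated_sat)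
  have f0: "f \<in> U 0"
  proof -
    have "mon \<nu> \<in> U 0" if "deg \<nu> = s" for \<nu> using up[of 0] that by blast
    moreover have "J0 \<subseteq> U 0" using J0_Mk[of "Suc s"] up[of 0] by blast
    ultimately show ?thesis using Mk_least[OF Us[of 0], of s] f by blast
  qed
  \<comment> \<open>Monomials of degree \<open>s\<close> have weight at most
    \<open>s * B ^ r\<close>, so from this index on only \<open>Mk (Suc s)\<close> is left.\<close>
  let ?b = "Suc (s * B ^ r)"
  have "U ?b = Mk (Suc s)"
  proof -
    have e: "{mon \<nu> | \<nu>. deg \<nu> = s \<and> ?b \<le> weight B \<nu>} = {}"
    proof (rule equals0I)
      fix z assume "z \<in> {mon \<nu> | \<nu>. deg \<nu> = s \<and> ?b \<le> weight B \<nu>}"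
      then obtain \<nu> where nu: "deg \<nu> = s" "?b \<le> weight B \<nu>" by (elim CollectE exE conjE)
      have "0 < B" using B by (rule ssubst) (rule zero_less_Suc)
      from weight_le[OF this, of \<nu>] nu show False by (metis Suc_n_not_le_n order.trans)
    qed
    show ?thesis unfolding U_def e by (simp add: sat_saturated[OF Mk_saturated])
  qed
  hence ex: "\<exists>j. f \<notin> U j" using f(2) by metis
  define j where "j = (LEAST j. f \<notin> U j) - 1"
  have L: "f \<notin> U (LEAST j. f \<notin> U j)" by (rule LeastI_ex[OF ex])
  hence pos: "(LEAST j. f \<notin> U j) \<noteq> 0" using f0 by metis
  hence fj1: "f \<notin> U (Suc j)" using L by (simp add: j_def)
  have fj: "f \<in> U j" using not_less_Least[of j "\<lambda>j. f \<notin> U j"] pos by (simp add: j_def)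
  obtain \<mu> where mu: "deg \<mu> = s" "weight B \<mu> = j"
  proof (rule ccontr)
    assume "\<not> thesis"
    hence "{mon \<nu> | \<nu>. deg \<nu> = s \<and> j \<le> weight B \<nu>} = {mon \<nu> | \<nu>. deg \<nu> = s \<and> Suc j \<le> weight B \<nu>}"
      using that by (force simp: Suc_le_eq order.order_iff_strict)
    hence "U j = U (Suc j)" unfolding U_def by simp
    thus False using fj fj1 by simp
  qed
  \<comment> \<open>In degree \<open>s\<close> all exponents are at most \<open>s < B\<close>; hence
    a weight determines its monomial. This is the reason for \<open>B = Suc s\<close>.\<close>
  have same: "mon \<nu> = mon \<mu>" if "deg \<nu> = s" "weight B \<nu> = j" for \<nu>
  proof (rule mon_cong)
    fix i assume "i < r"
    thus "\<nu> i = \<mu> i" using digits_unique[of \<nu> B r \<mu> i] that mu component_le_deg[of _ \<nu>] component_le_deg[of _ \<mu>] B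
      by (simp add: weight_def less_Suc_eq_le)
  qed
  have "U j \<subseteq> sat M (insert (mon \<mu>) (U (Suc j)))"
  proof -
    have up2: "insert (mon \<mu>) (U (Suc j)) \<subseteq> sat M (insert (mon \<mu>) (U (Suc j)))"
      using mon_carrier ideal_sub[OF saturated_ideal[OF Us]] by (intro sat_upper) auto
    have "mon \<nu> \<in> insert (mon \<mu>) (U (Suc j))" if "deg \<nu> = s" "j \<le> weight B \<nu>" for \<nu>
    proof (cases "weight B \<nu> = j")
      case True thus ?thesis using same that by blast
    next
      case False
      hence "mon \<nu> \<in> {mon \<nu> | \<nu>. deg \<nu> = s \<and> Suc j \<le> weight B \<nu>}" using that by auto
      thus ?thesis using up[of "Suc j"] by blast
    qed
    hence "Mk (Suc s) \<union> {mon \<nu> | \<nu>. deg \<nu> = s \<and> j \<le> weight B \<nu>} \<subseteq> insert (mon \<mu>) (U (Suc j))"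
      using up[of "Suc j"] by blast
    thus ?thesis unfolding U_def[of j] using up2 by (intro sat_least[OF saturated_sat]) blast
  qed
  hence "f \<in> sat M (insert (mon \<mu>) (U (Suc j)))" using fj by blast
  then obtain t c where t: "t \<in> carrier R - M" "c \<in> carrier R" "t \<otimes> f \<ominus> c \<otimes> mon \<mu> \<in> U (Suc j)"
    using mem_sat_insert[OF M saturated_ideal[OF Us] mon_carrier] by blast
  have cM: "c \<notin> M"
  proof
    assume "c \<in> M"
    hence "c \<otimes> mon \<mu> \<in> U (Suc j)" using Mk_M_mult[OF _ mon_Mk[OF mu(1)]] up by blast
    hence "t \<otimes> f \<in> U (Suc j)" using ideal_minus_cancel[OF saturated_ideal[OF Us] t(3)] t fc by auto
    thus False using saturatedD[OF Us] t fc fj1 by blast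
  qed
  have "c \<otimes> mon \<mu> \<ominus> t \<otimes> f = (\<ominus> \<one>) \<otimes> (t \<otimes> f \<ominus> c \<otimes> mon \<mu>)"
    using t(1,2) fc mon_carrier[of \<mu>] by (simp, algebra)
  hence "c \<otimes> mon \<mu> \<ominus> t \<otimes> f \<in> U (Suc j)"
    using ideal_mult[OF saturated_ideal[OF Us] t(3), of "\<ominus> \<one>"] by simp
  hence "mon \<mu> \<in> sat M (insert f (U (Suc j)))"
    using mem_sat_insert[OF M saturated_ideal[OF Us] fc] cM t mon_carrier by blast
  moreover have "sat M (insert f (U (Suc j))) =
      sat M (insert f (Mk (Suc s) \<union> {mon \<nu> | \<nu>. deg \<nu> = s \<and> weight B \<mu> < weight B \<nu>}))"
    unfolding U_def sat_sat_insert[OF gen fc] by (simp add: mu(2) Suc_le_eq)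
  ultimately show ?thesis using mu(1) by auto
qed

text \<open>The monomials not divisible by a leading monomial of \<open>f\<close> span the successive quotients
  of the filtration, and there are at most \<open>s * N ^ (r - 1)\<close> of them in degrees below \<open>N\<close>.\<close>

lemma colength_le_hypersurface:
  assumes f: "f \<in> Mk s" "f \<notin> Mk (Suc s)" "f \<in> K" and K: "saturated M K" "J0 \<subseteq> K" and N: "Mk N \<subseteq> K" and r: "0 < r"
  shows "colength_le M K (s * N ^ (r - 1))"
proof -
  define B where "B = Suc s"
  obtain \<mu> where mu: "deg \<mu> = s" and lead:
    "mon \<mu> \<in> sat M (insert f (Mk (Suc s) \<union> {mon \<nu> | \<nu>. deg \<nu> = s \<and> weight B \<mu> < weight B \<nu>}))"
    using leading_monomial[OF f(1,2) B_def] by auto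
  \<comment> \<open>Extensional functions give every exponent pattern one representative; the last
    condition says that the leading monomial does not divide.\<close>
  define F where "F k = {\<nu> \<in> {..<r} \<rightarrow>\<^sub>E {..k}. deg \<nu> = k \<and> (\<exists>i<r. \<nu> i < \<mu> i)}" for k
  have finF: "finite (F k)" for k
    by (rule finite_subset[of _ "{..<r} \<rightarrow>\<^sub>E {..k}"]) (auto simp: F_def intro!: finite_PiE)
  have "colength_le M K (\<Sum>k<N. card (F k))"
  proof (rule colength_le_by_degree[OF K(1) N finF])
    fix k
    let ?V = "sat M (K \<union> Mk (Suc k) \<union> mon ` F k)"
    have "K \<union> Mk (Suc k) \<union> mon ` F k \<subseteq> carrier R"
      using ideal_sub[OF saturated_ideal[OF K(1)]] ideal_sub[OF Mk_ideal] mon_carrier by auto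
    note up = sat_upper[OF this, of M]
    \<comment> \<open>A monomial divisible by the leading one is rewritten, modulo \<open>K\<close>
      and higher degree, through monomials of the same degree and greater weight. Weights in degree
      \<open>k\<close> are at most \<open>k * B ^ r\<close>, so the induction runs on the distance
      to that bound.\<close>
    have mV: "mon \<nu> \<in> ?V" if "deg \<nu> = k" for \<nu>
      using that
    proof (induction "k * B ^ r - weight B \<nu>" arbitrary: \<nu> rule: less_induct)
      case less
      show ?case
      proof (cases "\<exists>i<r. \<nu> i < \<mu> i")
        case True
        have "restrict \<nu> {..<r} \<in> F k"
          using True less.prems component_le_deg[of _ \<nu>] by (auto simp: F_def deg_def)
        moreover have "mon (restrict \<nu> {..<r}) = mon \<nu>" by (rule mon_cong) simp
        ultimately show ?thesis using up by (metis UnI2 imageI subsetD)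
      next
        case False
        define \<kappa> where "\<kappa> = (\<lambda>i. \<nu> i - \<mu> i)"
        have le: "\<And>i. i < r \<Longrightarrow> \<mu> i \<le> \<nu> i" using False by auto
        have nu: "mon \<nu> = mon \<kappa> \<otimes> mon \<mu>" "deg \<nu> = deg \<kappa> + deg \<mu>"
          using mon_diff[OF le] by (simp_all add: \<kappa>_def)
        have wnu: "weight B \<nu> = weight B \<kappa> + weight B \<mu>"
          unfolding weight_add[symmetric] using le by (auto simp: weight_def \<kappa>_def intro!: sum.cong)
        let ?C = "{u \<in> carrier R. u \<otimes> mon \<kappa> \<in> ?V}"
        have "sat M (insert f (Mk (Suc s) \<union> {mon \<nu> | \<nu>. deg \<nu> = s \<and> weight B \<mu> < weight B \<nu>})) \<subseteq> ?C"
        proof (rule sat_least[OF colon_saturated[OF saturated_sat mon_carrier]])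
          have fc: "f \<in> carrier R" using f Mk_ideal ideal_carr by blast
          have "f \<otimes> mon \<kappa> \<in> K" using ideal_mult_right[OF saturated_ideal[OF K(1)] f(3) mon_carrier] .
          hence 1: "f \<in> ?C" using up fc by blast
          have 2: "u \<in> ?C" if u: "u \<in> Mk (Suc s)" for u
          proof -
            have uc: "u \<in> carrier R" using u Mk_ideal ideal_carr by blast
            have "u \<otimes> mon \<kappa> \<in> Mk (Suc k)"
              using Mk_mon_mult[OF u, of \<kappa>] nu(2) mu less.prems m_comm[OF uc mon_carrier] by simp
            thus ?thesis using up uc by blast
          qed
          have 3: "mon \<nu>' \<in> ?C" if n: "deg \<nu>' = s" "weight B \<mu> < weight B \<nu>'" for \<nu>'
          proof -
            let ?l = "\<lambda>i. \<nu>' i + \<kappa> i"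
            have dl: "deg ?l = k" using deg_add n nu(2) mu less.prems by simp
            have wl: "weight B \<nu> < weight B ?l" using weight_add wnu n(2) by simp
            moreover have "weight B ?l \<le> k * B ^ r" using weight_le[of B ?l] dl by (simp add: B_def)
            ultimately have "mon ?l \<in> ?V" using less.hyps[of ?l] dl by simp
            thus ?thesis using mon_carrier by (simp add: mon_add)
          qed
          show "insert f (Mk (Suc s) \<union> {mon \<nu> | \<nu>. deg \<nu> = s \<and> weight B \<mu> < weight B \<nu>}) \<subseteq> ?C"
            using 1 2 3 by blast
        qed
        hence "mon \<mu> \<otimes> mon \<kappa> \<in> ?V" using lead by blast
        thus ?thesis using nu(1) m_comm mon_carrier by simp
      qed
    qed
    show "Mk k \<subseteq> ?V" by (rule Mk_least[OF saturated_sat _ mV]) (use up K(2) in auto)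
  qed (auto simp: F_def)
  moreover have "(\<Sum>k<N. card (F k)) \<le> s * N ^ (r - 1)"
  proof -
    \<comment> \<open>A vector with some entry below that of \<mu> lies in some \<open>G j\<close>,
      where one coordinate has \<open>\<mu> j\<close> choices and each other one \<open>N\<close>;
      the \<open>\<mu> j\<close> add up to \<open>s\<close>.\<close>
    define G where "G j = ({..<r} \<rightarrow>\<^sub>E {..<N}) \<inter> {\<nu>. \<nu> j < \<mu> j}" for j
    have cG: "card (G j) \<le> \<mu> j * N ^ (r - 1)" if "j < r" for j
    proof -
      let ?H = "PiE {..<r} (\<lambda>i. if i = j then {..<\<mu> j} else {..<N})"
      have "G j \<subseteq> ?H"
      proof
        fix \<nu> assume "\<nu> \<in> G j"
        hence a: "\<nu> \<in> {..<r} \<rightarrow>\<^sub>E {..<N}" "\<nu> j < \<mu> j" by (simp_all add: G_def)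
        show "\<nu> \<in> ?H" by (rule PiE_I) (use a PiE_mem[OF a(1)] PiE_arb[OF a(1)] in \<open>simp_all split: if_split\<close>)
      qed
      hence "card (G j) \<le> card ?H" by (intro card_mono finite_PiE) auto
      also have "card ?H = (\<Prod>i<r. if i = j then \<mu> j else N)"
        by (simp add: card_PiE if_distrib cong: if_cong)
      also have "\<dots> = \<mu> j * (\<Prod>i\<in>{..<r} - {j}. N)"
        using that by (subst prod.remove[of _ j]) auto
      also have "\<dots> = \<mu> j * N ^ (r - 1)" using that by simp
      finally show ?thesis .
    qed
    have "(\<Sum>k<N. card (F k)) = card (\<Union>k<N. F k)"
      by (rule card_UN_disjoint[symmetric]) (use finF in \<open>auto simp: F_def\<close>)
    also have "\<dots> \<le> card (\<Union>j<r. G j)"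
    proof (rule card_mono)
      show "finite (\<Union>j<r. G j)" by (auto simp: G_def intro!: finite_Int finite_PiE)
      show "(\<Union>k<N. F k) \<subseteq> (\<Union>j<r. G j)"
      proof
        fix \<nu> assume "\<nu> \<in> (\<Union>k<N. F k)"
        then obtain k where k: "k < N" "\<nu> \<in> F k" by auto
        have "{..<r} \<rightarrow>\<^sub>E {..k} \<subseteq> {..<r} \<rightarrow>\<^sub>E {..<N}" using k(1) by (intro PiE_mono) auto
        hence "\<nu> \<in> {..<r} \<rightarrow>\<^sub>E {..<N}" using k(2) by (auto simp: F_def)
        thus "\<nu> \<in> (\<Union>j<r. G j)" using k by (auto simp: F_def G_def)
      qed
    qed
    also have "\<dots> \<le> (\<Sum>j<r. card (G j))" by (rule card_UN_le) simp
    also have "\<dots> \<le> (\<Sum>j<r. \<mu> j * N ^ (r - 1))" by (rule sum_mono) (use cG in auto)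
    also have "\<dots> = s * N ^ (r - 1)" using mu unfolding deg_def by (simp flip: sum_distrib_right)
    finally show ?thesis .
  qed
  ultimately show ?thesis using colength_le_mono by blast
qed

text \<open>Krull's intersection theorem. For \<open>E\<close> maximal among the saturated ideals
  over \<open>J0\<close> that miss \<open>u\<close>, the element \<open>u\<close> is killed by
  \<open>M\<close> modulo \<open>E\<close> and lies in every larger saturated ideal. This makes all
  elements of \<open>M\<close> nilpotent modulo \<open>E\<close>, so that \<open>E\<close> contains
  some \<open>Mk k\<close>.\<close>

lemma krull_intersection:
  assumes u: "u \<in> carrier R" "u \<notin> J0"
  shows "\<exists>k. u \<notin> Mk k"
proof (cases "r = 0")
  case True
  hence "deg \<nu> \<noteq> 1" for \<nu> unfolding deg_def by simp
  hence "Mk 1 \<subseteq> J0" by (intro Mk_least[OF J0]) blast+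
  thus ?thesis using u by blast
next
  case False
  obtain E where E: "saturated M E" "J0 \<subseteq> E" "u \<notin> E"
    and max: "\<And>K. saturated M K \<Longrightarrow> J0 \<subseteq> K \<Longrightarrow> u \<notin> K \<Longrightarrow> E \<subseteq> K \<Longrightarrow> K = E"
    using saturated_maximal_exists[OF J0, of "\<lambda>E. J0 \<subseteq> E \<and> u \<notin> E"] u by (metis order.refl)
  have Ei: "ideal E R" using E saturated_ideal by blast
  have add: "u \<in> sat M (insert v E)" if v: "v \<in> carrier R" "v \<notin> E" for v
  proof (rule ccontr)
    have up: "insert v E \<subseteq> sat M (insert v E)" using v ideal_sub[OF Ei] by (intro sat_upper) auto
    assume "u \<notin> sat M (insert v E)"
    hence "sat M (insert v E) = E" using max[OF saturated_sat] up E(2) by blast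
    thus False using up v by blast
  qed
  have Mu: "p \<otimes> u \<in> E" if p: "p \<in> M" for p
  proof (rule ccontr)
    have pc: "p \<in> carrier R" using p ideal_carr[OF prime_ideal[OF M]] by blast
    assume "p \<otimes> u \<notin> E"
    then obtain s c where s: "s \<in> carrier R - M" "c \<in> carrier R" "s \<otimes> u \<ominus> c \<otimes> (p \<otimes> u) \<in> E"
      using add[of "p \<otimes> u"] mem_sat_insert[OF M Ei, of "p \<otimes> u" u] pc u by auto
    have "s \<otimes> u \<ominus> c \<otimes> (p \<otimes> u) = (s \<ominus> c \<otimes> p) \<otimes> u" using s(1,2) pc u(1) by (simp, algebra)
    moreover have "s \<ominus> c \<otimes> p \<notin> M"
      using ideal_minus_cancel[OF prime_ideal[OF M], of s "c \<otimes> p"] s ideal_mult[OF prime_ideal[OF M] p s(2)] by blast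
    ultimately show False using saturatedD[OF E(1), of "s \<ominus> c \<otimes> p" u] s pc u E by auto
  qed
  have nil: "\<exists>n. z [^] (n::nat) \<in> E" if z: "z \<in> M" for z
  proof -
    have zc: "z \<in> carrier R" using z ideal_carr[OF prime_ideal[OF M]] by blast
    \<comment> \<open>Once the colon ideals of the powers of \<open>z\<close> are stationary, a
      presentation of \<open>u\<close> as a multiple of \<open>z ^ n\<close> modulo \<open>E\<close>
      collapses: \<open>zu\<close> lies in \<open>E\<close>, hence so does that multiple.\<close>
    define A where "A n = {c \<in> carrier R. c \<otimes> z [^] (n::nat) \<in> E}" for n
    have "\<exists>I \<in> range A. \<forall>K \<in> range A. I \<subseteq> K \<longrightarrow> K = I"
      by (rule ideal_maximal_exists) (use colon_ideal[OF Ei] zc in \<open>auto simp: A_def\<close>)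
    then obtain n where n: "\<And>m. A n \<subseteq> A m \<Longrightarrow> A m = A n" by auto
    have "A n \<subseteq> A (Suc n)"
    proof
      fix c assume c: "c \<in> A n"
      hence "c \<otimes> z [^] n \<otimes> z \<in> E" using ideal_mult_right[OF Ei _ zc] by (simp add: A_def)
      thus "c \<in> A (Suc n)" using c zc by (simp add: A_def m_assoc)
    qed
    hence st: "A (Suc n) = A n" by (rule n)
    show ?thesis
    proof (rule ccontr)
      assume "\<not> ?thesis"
      hence "u \<in> sat M (insert (z [^] n) E)" using add[of "z [^] n"] zc by auto
      then obtain s c where s: "s \<in> carrier R - M" "c \<in> carrier R" "s \<otimes> u \<ominus> c \<otimes> z [^] n \<in> E"
        using mem_sat_insert[OF M Ei, of "z [^] n" u] zc by auto
      have "z \<otimes> (s \<otimes> u \<ominus> c \<otimes> z [^] n) \<in> E" using ideal_mult[OF Ei s(3) zc] .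
      moreover have "z \<otimes> (s \<otimes> u \<ominus> c \<otimes> z [^] n) = s \<otimes> (z \<otimes> u) \<ominus> c \<otimes> (z [^] n \<otimes> z)"
        using s(1,2) zc u(1) nat_pow_closed[OF zc, of n] by (simp, algebra)
      ultimately have "s \<otimes> (z \<otimes> u) \<ominus> c \<otimes> z [^] Suc n \<in> E" by simp
      moreover have "s \<otimes> (z \<otimes> u) \<in> E" using ideal_mult[OF Ei Mu[OF z]] s by auto
      ultimately have "c \<otimes> z [^] Suc n \<in> E"
        using ideal_minus_cancel'[OF Ei] s(2) zc by blast
      hence "c \<in> A (Suc n)" using s by (simp add: A_def)
      hence "c \<in> A n" using st by simp
      hence "c \<otimes> z [^] n \<in> E" by (simp add: A_def)
      hence "s \<otimes> u \<in> E" using ideal_minus_cancel[OF Ei s(3)] s u by auto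
      thus False using saturatedD[OF E(1)] s u E by blast
    qed
  qed
  hence "\<forall>i\<in>{..<r}. \<exists>n. y i [^] (n::nat) \<in> E" using y by auto
  then obtain n where n: "\<And>i. i < r \<Longrightarrow> y i [^] (n i :: nat) \<in> E" by (metis lessThan_iff)
  define m where "m = sum n {..<r}"
  have "y i [^] m \<in> E" if "i < r" for i
  proof -
    have "n i \<le> m" unfolding m_def using that by (intro member_le_sum) auto
    hence "y i [^] m = y i [^] (m - n i) \<otimes> y i [^] n i" using y_carrier[OF that] by (simp add: nat_pow_mult)
    thus ?thesis using ideal_mult[OF Ei n[OF that]] y_carrier[OF that] by simp
  qed
  hence "Mk (r * m) \<subseteq> E" using Mk_pigeonhole[OF E(1,2)] False by simp
  thus ?thesis using E by blast
qed

lemma order_exists: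
  assumes u: "u \<in> carrier R" "u \<notin> J0"
  shows "\<exists>s. u \<in> Mk s \<and> u \<notin> Mk (Suc s)"
proof -
  have ex: "\<exists>k. u \<notin> Mk k" by (rule krull_intersection[OF u])
  define k where "k = (LEAST k. u \<notin> Mk k)"
  have "u \<notin> Mk k" unfolding k_def by (rule LeastI_ex[OF ex])
  moreover have "k \<noteq> 0" using \<open>u \<notin> Mk k\<close> u Mk_0 by metis
  moreover have "u \<in> Mk (k - 1)" using not_less_Least[of "k - 1" "\<lambda>k. u \<notin> Mk k"] \<open>k \<noteq> 0\<close>
    unfolding k_def[symmetric] by simp
  ultimately show ?thesis by (intro exI[of _ "k - 1"]) simp
qed

text \<open>A regular local ring is a domain: an element of order \<open>s\<close> in a prime of full coheight would
  bound the colength of the powers of the parameters by a multiple of \<open>q ^ (r - 1)\<close>, while that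
  colength is at least \<open>q ^ r\<close>.\<close>

lemma regular_imp_prime:
  assumes ch: "prime_path P r M" and P: "J0 \<subseteq> P"
  shows "J0 = P"
proof (rule ccontr)
  assume "J0 \<noteq> P"
  then obtain f where f: "f \<in> P" "f \<notin> J0" using P by auto
  have Pp: "primeideal P R" using prime_path_prime[OF ch] by simp
  obtain s where s: "f \<in> Mk s" "f \<notin> Mk (Suc s)"
    using order_exists[OF ideal_carr[OF prime_ideal[OF Pp] f(1)] f(2)] by auto
  have r: "0 < r"
  proof (rule ccontr)
    assume "\<not> 0 < r"
    hence "M \<subseteq> J0" using gen sat_saturated[OF J0] by simp
    thus False using f prime_path_sub[OF ch] by auto
  qed
  let ?ys = "map y [0..<r]"
  have ys: "set ?ys = y ` {..<r}" by (auto simp: atLeast0LessThan)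
  have only: "P' = M" if P': "primeideal P' R" "P \<subseteq> P'" "set ?ys \<subseteq> P'" "P' \<subseteq> M" for P'
  proof -
    have "sat M (J0 \<union> y ` {..<r}) \<subseteq> P'"
      using P' P ys by (intro sat_least saturated_prime) auto
    thus ?thesis using gen P'(4) by auto
  qed
  \<comment> \<open>Chosen above the constant \<open>s * r ^ (r - 1)\<close> that is left of the
    hypersurface bound after division by \<open>q ^ (r - 1)\<close>.\<close>
  define q where "q = Suc (s * r ^ (r - 1))"
  have ch': "prime_path P (length ?ys) M" using ch by simp
  have ysM: "set ?ys \<subseteq> M" using y by auto
  obtain I where I: "saturated M I" "P \<subseteq> I" "(\<lambda>y. y [^] q) ` set ?ys \<subseteq> I" "saturated_chain M I (q ^ length ?ys) (carrier R)"
    using parameter_powers_chain[OF ch' ysM only] by blast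
  have "Mk (r * q) \<subseteq> I" using I P r by (intro Mk_pigeonhole) (auto simp: ys)
  hence "colength_le M I (s * (r * q) ^ (r - 1))"
    using colength_le_hypersurface[OF s _ I(1) _ _ r] f I(2) P by blast
  hence "q ^ r \<le> s * (r * q) ^ (r - 1)" using I(1,4) unfolding colength_le_def by auto
  also have "\<dots> = s * r ^ (r - 1) * q ^ (r - 1)" by (simp add: power_mult_distrib)
  finally have "q * q ^ (r - 1) \<le> s * r ^ (r - 1) * q ^ (r - 1)" using r by (simp add: power_eq_if)
  moreover have "0 < q ^ (r - 1)" by (simp add: q_def)
  ultimately have "q \<le> s * r ^ (r - 1)" by (metis mult_le_cancel2)
  thus False by (simp add: q_def)
qed

end

section \<open>Regular sequences and depth\<close>

context cring
begin

definition nzd :: "'a set \<Rightarrow> 'a \<Rightarrow> bool" where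
  "nzd J x \<longleftrightarrow> (\<forall>u \<in> carrier R. x \<otimes> u \<in> J \<longrightarrow> u \<in> J)"

lemma nzdD: "nzd J x \<Longrightarrow> x \<otimes> u \<in> J \<Longrightarrow> u \<in> carrier R \<Longrightarrow> u \<in> J"
  by (simp add: nzd_def)

text \<open>Regular sequences on the localisation of \<open>R/J\<close> at \<open>M\<close>, with
  saturation after every step. For \<open>J\<close> inside the prime \<open>M\<close>, membership in
  \<open>M\<close> keeps all quotients nonzero.\<close>

fun reg :: "'a set \<Rightarrow> 'a set \<Rightarrow> 'a list \<Rightarrow> bool" where
  "reg M J [] \<longleftrightarrow> True"
| "reg M J (x # xs) \<longleftrightarrow> x \<in> M \<and> nzd J x \<and> reg M (sat M (insert x J)) xs"

lemma reg_set: "reg M J xs \<Longrightarrow> set xs \<subseteq> M"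
  by (induction xs arbitrary: J) auto

lemma reg_append:
  assumes "M \<subseteq> carrier R"
  shows "saturated M J \<Longrightarrow> set xs \<subseteq> M \<Longrightarrow> reg M J (xs @ ys) \<longleftrightarrow> reg M J xs \<and> reg M (sat M (J \<union> set xs)) ys"
proof (induction xs arbitrary: J)
  case Nil thus ?case by (simp add: sat_saturated)
next
  case (Cons x xs)
  have "sat M (sat M (insert x J) \<union> set xs) = sat M (insert x J \<union> set xs)"
    using Cons.prems assms ideal_sub[OF saturated_ideal[OF Cons.prems(1)]] by (intro sat_sat_Un) auto
  hence "sat M (sat M (insert x J) \<union> set xs) = sat M (J \<union> set (x # xs))" by simp
  thus ?case using Cons.IH[OF saturated_sat] Cons.prems by simp
qed

text \<open>Up to denominators, \<open>au = rb\<close> modulo \<open>J\<close> forces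
  \<open>r = ca\<close>, since \<open>b\<close> is regular modulo \<open>a\<close>; then
  \<open>a\<close> cancels from \<open>a(u - cb)\<close>. The other half of the exchange,
  \<open>nzd_swap_first\<close>, rests on Nakayama's lemma.\<close>

lemma nzd_swap:
  assumes M: "primeideal M R" and J: "saturated M J" and a: "a \<in> carrier R" "nzd J a"
    and b: "b \<in> carrier R" "nzd (sat M (insert a J)) b"
  shows "nzd (sat M (insert b J)) a"
  unfolding nzd_def
proof (intro ballI impI)
  fix u assume u: "u \<in> carrier R" "a \<otimes> u \<in> sat M (insert b J)"
  have Ji: "ideal J R" using J saturated_ideal by blast
  obtain s r where s: "s \<in> carrier R - M" "r \<in> carrier R" "s \<otimes> (a \<otimes> u) \<ominus> r \<otimes> b \<in> J"
    using u mem_sat_insert[OF M Ji b(1)] by blast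
  have sc: "s \<in> carrier R" using s by simp
  have up: "insert a J \<subseteq> sat M (insert a J)" using a ideal_sub[OF Ji] by (intro sat_upper) auto
  have "s \<otimes> (a \<otimes> u) = (s \<otimes> u) \<otimes> a" using sc a(1) u(1) by algebra
  hence "s \<otimes> (a \<otimes> u) \<in> sat M (insert a J)" using ideal_mult[OF sat_ideal, of a M "insert a J" "s \<otimes> u"] up sc u by auto
  hence "r \<otimes> b \<in> sat M (insert a J)"
    using ideal_minus_cancel'[OF sat_ideal, of "s \<otimes> (a \<otimes> u)" "r \<otimes> b"] s up b by blast
  hence "r \<in> sat M (insert a J)" using nzdD[OF b(2), of r] m_comm b(1) s(2) by simp
  then obtain t c where t: "t \<in> carrier R - M" "c \<in> carrier R" "t \<otimes> r \<ominus> c \<otimes> a \<in> J"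
    using mem_sat_insert[OF M Ji a(1)] by blast
  have tc: "t \<in> carrier R" using t by simp
  have "a \<otimes> ((t \<otimes> s) \<otimes> u \<ominus> c \<otimes> b) = t \<otimes> (s \<otimes> (a \<otimes> u) \<ominus> r \<otimes> b) \<oplus> b \<otimes> (t \<otimes> r \<ominus> c \<otimes> a)"
    using tc sc a(1) b(1) u(1) s(2) t(2) by algebra
  hence "a \<otimes> ((t \<otimes> s) \<otimes> u \<ominus> c \<otimes> b) \<in> J" using ideal_comb[OF Ji s(3) t(3) tc b(1)] by simp
  hence "(t \<otimes> s) \<otimes> u \<ominus> c \<otimes> b \<in> J" using nzdD[OF a(2)] tc sc u(1) t(2) b(1) by simp
  thus "u \<in> sat M (insert b J)" using mem_sat_insert[OF M Ji b(1)] prime_compl_mult[OF M t(1) s(1)] t(2) u(1) by blast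
qed

lemma nzd_pow: "x \<in> carrier R \<Longrightarrow> nzd J x \<Longrightarrow> nzd J (x [^] (n::nat))"
proof (induction n)
  case (Suc n)
  show ?case unfolding nzd_def
  proof (intro ballI impI)
    fix u assume u: "u \<in> carrier R" "x [^] Suc n \<otimes> u \<in> J"
    have "x [^] n \<otimes> (x \<otimes> u) \<in> J" using u Suc.prems by (simp add: m_assoc)
    thus "u \<in> J" using Suc nzdD u by (meson m_closed)
  qed
qed (simp add: nzd_def)

text \<open>A depth bound: the localisation of \<open>R/J\<close> at \<open>M\<close> has depth at least \<open>n\<close>.\<close>

definition depth_ge :: "'a set \<Rightarrow> 'a set \<Rightarrow> nat \<Rightarrow> bool" where
  "depth_ge M J n \<longleftrightarrow> (\<exists>xs. length xs = n \<and> reg M J xs)"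

lemma depth_ge_Suc: "depth_ge M J (Suc n) \<longleftrightarrow> (\<exists>x \<in> M. nzd J x \<and> depth_ge M (sat M (insert x J)) n)"
proof
  assume "depth_ge M J (Suc n)"
  then obtain x xs where "length xs = n" "reg M J (x # xs)"
    unfolding depth_ge_def by (auto simp: length_Suc_conv)
  thus "\<exists>x \<in> M. nzd J x \<and> depth_ge M (sat M (insert x J)) n" by (auto simp: depth_ge_def)
next
  assume "\<exists>x \<in> M. nzd J x \<and> depth_ge M (sat M (insert x J)) n"
  then obtain x xs where "length (x # xs) = Suc n \<and> reg M J (x # xs)" by (auto simp: depth_ge_def)
  thus "depth_ge M J (Suc n)" unfolding depth_ge_def by blast
qed

lemma ideal_pow_mem: "ideal J R \<Longrightarrow> x \<in> J \<Longrightarrow> 0 < n \<Longrightarrow> x [^] (n::nat) \<in> J"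
  by (cases n) (auto intro: ideal_mult ideal_carr)

section \<open>Prime avoidance\<close>

lemma prime_avoids_product:
  assumes "finite F" and P: "primeideal P R" and K: "ideal K R" "\<not> K \<subseteq> P"
  shows "(\<And>I. I \<in> F \<Longrightarrow> ideal I R \<and> \<not> I \<subseteq> P) \<Longrightarrow> \<exists>h \<in> K. h \<notin> P \<and> (\<forall>I \<in> F. h \<in> I)"
  using assms(1)
proof (induction F rule: finite_induct)
  case empty thus ?case using K by auto
next
  case (insert I F)
  then obtain h where h: "h \<in> K" "h \<notin> P" "\<forall>I \<in> F. h \<in> I" by auto
  obtain i where i: "i \<in> I" "i \<notin> P" using insert.prems by blast
  have ic: "i \<in> carrier R" and hc: "h \<in> carrier R"
    using i h insert.prems K ideal_carr by blast+
  have "i \<otimes> h \<notin> P" using primeD[OF P _ ic hc] i h by blast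
  moreover have "i \<otimes> h \<in> K" using ideal_mult[OF K(1) h(1) ic] .
  moreover have "i \<otimes> h \<in> L" if "L \<in> insert I F" for L
    using that ideal_mult[of L h i] ideal_mult_right[of I i h] insert.prems h i ic hc by auto
  ultimately show ?case by blast
qed

text \<open>With \<open>P\<close> minimal in the family, a choice that works for the other primes
  but fails at \<open>P\<close> is corrected by an element of \<open>K\<close> lying in all the
  others and not in \<open>P\<close>. The coset form later allows parameters to be altered modulo an
  ideal.\<close>

lemma prime_avoidance:
  assumes "finite F" and a: "a \<in> carrier R" and K: "ideal K R"
  shows "(\<And>P. P \<in> F \<Longrightarrow> primeideal P R \<and> \<not> (a \<in> P \<and> K \<subseteq> P)) \<Longrightarrow> \<exists>k \<in> K. \<forall>P \<in> F. a \<oplus> k \<notin> P"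
  using assms(1)
proof (induction "card F" arbitrary: F rule: less_induct)
  case less
  show ?case
  proof (cases "F = {}")
    case True thus ?thesis using ideal_zero[OF K] by blast
  next
    case False
    then obtain P where P: "P \<in> F" "\<And>Q. Q \<in> F \<Longrightarrow> Q \<subseteq> P \<Longrightarrow> P = Q"
      using finite_has_minimal[OF less.prems(2)] by blast
    have Pp: "primeideal P R" using P less.prems by blast
    have "card (F - {P}) < card F" using P less.prems by (meson card_Diff1_less)
    then obtain k where k: "k \<in> K" "\<forall>Q \<in> F - {P}. a \<oplus> k \<notin> Q"
      using less.hyps[of "F - {P}"] less.prems by auto
    have kc: "k \<in> carrier R" using k ideal_carr[OF K] by blast
    show ?thesis
    proof (cases "a \<oplus> k \<in> P")
      case False thus ?thesis using k by blast
    next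
      case True
      have "\<not> K \<subseteq> P"
      proof
        assume "K \<subseteq> P"
        moreover have "a = (a \<oplus> k) \<ominus> k" using a kc by algebra
        ultimately have "a \<in> P" using ideal_minus[OF prime_ideal[OF Pp] True, of k] k by (metis subsetD)
        thus False using \<open>K \<subseteq> P\<close> less.prems P by blast
      qed
      moreover have "ideal Q R \<and> \<not> Q \<subseteq> P" if "Q \<in> F - {P}" for Q
        using that P less.prems prime_ideal by blast
      ultimately obtain h where h: "h \<in> K" "h \<notin> P" "\<forall>Q \<in> F - {P}. h \<in> Q"
        using prime_avoids_product[OF finite_Diff[OF less.prems(2)] Pp K, of "{P}"] by blast
      have hc: "h \<in> carrier R" using h ideal_carr[OF K] by blast
      have eq: "a \<oplus> (k \<oplus> h) = (a \<oplus> k) \<oplus> h" using a kc hc by algebra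
      have "a \<oplus> (k \<oplus> h) \<notin> Q" if Q: "Q \<in> F" for Q
      proof
        assume A: "a \<oplus> (k \<oplus> h) \<in> Q"
        have Qi: "ideal Q R" using Q less.prems prime_ideal by blast
        show False
        proof (cases "Q = P")
          case True
          have "h = (a \<oplus> (k \<oplus> h)) \<ominus> (a \<oplus> k)" using a kc hc by algebra
          thus False using ideal_minus[OF Qi A, of "a \<oplus> k"] \<open>a \<oplus> k \<in> P\<close> True h(2) by metis
        next
          case False
          have "a \<oplus> k = (a \<oplus> (k \<oplus> h)) \<ominus> h" using a kc hc by algebra
          moreover have "h \<in> Q" "a \<oplus> k \<notin> Q" using h(3) k(2) False Q by auto
          ultimately show False using ideal_minus[OF Qi A, of h] by metis
        qed
      qed
      thus ?thesis using ideal_add[OF K k(1) h(1)] by blast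
    qed
  qed
qed

end

context noetherian_cring
begin

text \<open>If \<open>bu\<close> lies in \<open>J\<close>, then up to a denominator \<open>u\<close>
  is \<open>ra\<close> modulo \<open>J\<close>, and \<open>br\<close> lies in \<open>J\<close>
  again. So the elements killed by \<open>b\<close> are \<open>a\<close> times themselves modulo
  \<open>J\<close>, and Nakayama's lemma applies because \<open>a\<close> is in
  \<open>M\<close>.\<close>

lemma nzd_swap_first:
  assumes M: "primeideal M R" and J: "saturated M J" and a: "a \<in> M" "nzd J a"
    and b: "b \<in> carrier R" "nzd (sat M (insert a J)) b"
  shows "nzd J b"
proof -
  have Ji: "ideal J R" using J saturated_ideal by blast
  have ac: "a \<in> carrier R" using a ideal_carr[OF prime_ideal[OF M]] by blast
  let ?N = "{u \<in> carrier R. b \<otimes> u \<in> J}"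
  have up: "insert a J \<subseteq> sat M (insert a J)" using ac ideal_sub[OF Ji] by (intro sat_upper) auto
  have "?N \<subseteq> J"
  proof (rule nakayama[OF M J])
    fix E assume E: "saturated M E" "J \<subseteq> E" "\<And>p u. p \<in> M \<Longrightarrow> u \<in> ?N \<Longrightarrow> p \<otimes> u \<in> E"
    show "?N \<subseteq> E"
    proof
      fix u assume u: "u \<in> ?N"
      hence uc: "u \<in> carrier R" and bu: "b \<otimes> u \<in> J" by auto
      have "u \<in> sat M (insert a J)" using nzdD[OF b(2) _ uc] bu up by blast
      then obtain s r where s: "s \<in> carrier R - M" "r \<in> carrier R" "s \<otimes> u \<ominus> r \<otimes> a \<in> J"
        using mem_sat_insert[OF M Ji ac] by blast
      have sc: "s \<in> carrier R" using s by simp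
      have "a \<otimes> (b \<otimes> r) = s \<otimes> (b \<otimes> u) \<oplus> (\<ominus> b) \<otimes> (s \<otimes> u \<ominus> r \<otimes> a)"
        using sc ac b(1) uc s(2) by algebra
      hence "a \<otimes> (b \<otimes> r) \<in> J" using ideal_comb[OF Ji bu s(3) sc, of "\<ominus> b"] b(1) by simp
      hence "b \<otimes> r \<in> J" using nzdD[OF a(2)] b(1) s(2) by simp
      hence "a \<otimes> r \<in> E" using E(3)[OF a(1)] s(2) by simp
      hence "r \<otimes> a \<in> E" using m_comm ac s(2) by simp
      hence "s \<otimes> u \<in> E" using ideal_minus_cancel[OF saturated_ideal[OF E(1)], of "s \<otimes> u" "r \<otimes> a"] s E(2) sc uc by auto
      thus "u \<in> E" using saturatedD[OF E(1) _ s(1) uc] by blast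
    qed
  qed auto
  thus ?thesis unfolding nzd_def by blast
qed

lemma reg_swap:
  assumes M: "primeideal M R" and J: "saturated M J" and ab: "reg M J (a # b # xs)"
  shows "reg M J (b # a # xs)"
proof -
  have Mc: "M \<subseteq> carrier R" using ideal_sub[OF prime_ideal[OF M]] .
  have a: "a \<in> M" "nzd J a" and b: "b \<in> M" "nzd (sat M (insert a J)) b" using ab by auto
  have c: "a \<in> carrier R" "b \<in> carrier R" using a b Mc by auto
  have "sat M (insert b (sat M (insert a J))) = sat M (insert b (insert a J))"
    "sat M (insert a (sat M (insert b J))) = sat M (insert a (insert b J))"
    using c ideal_sub[OF saturated_ideal[OF J]] by (auto intro!: sat_sat_insert)
  thus ?thesis
    using ab nzd_swap[OF M J c(1) a(2) c(2) b(2)] nzd_swap_first[OF M J a c(2) b(2)] by (simp add: insert_commute)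
qed

lemma reg_to_front:
  assumes M: "primeideal M R"
  shows "saturated M J \<Longrightarrow> reg M J (xs @ a # ys) \<Longrightarrow> reg M J (a # xs @ ys)"
proof (induction xs arbitrary: J)
  case (Cons x xs)
  have "reg M (sat M (insert x J)) (xs @ a # ys)" using Cons.prems(2) by simp
  hence "reg M (sat M (insert x J)) (a # xs @ ys)" by (rule Cons.IH[OF saturated_sat])
  hence "reg M J (x # a # xs @ ys)" using Cons.prems by simp
  from reg_swap[OF M Cons.prems(1) this] show ?case by simp
qed simp

lemma reg_perm:
  assumes M: "primeideal M R"
  shows "saturated M J \<Longrightarrow> reg M J xs \<Longrightarrow> mset xs = mset ys \<Longrightarrow> reg M J ys"
proof (induction ys arbitrary: J xs)
  case (Cons a ys)
  have "a \<in> set xs" using Cons.prems(3) by (metis list.set_intros(1) mset_eq_setD)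
  then obtain us vs where xs: "xs = us @ a # vs" by (meson split_list)
  have "reg M J (a # us @ vs)" using reg_to_front[OF M Cons.prems(1)] Cons.prems(2) xs by blast
  moreover have "mset (us @ vs) = mset ys" using Cons.prems(3) xs by simp
  ultimately show ?case using Cons.IH[OF saturated_sat] by auto
qed simp

text \<open>The last element of a regular sequence may be replaced by a power, as powers of
  nonzerodivisors are nonzerodivisors; permutability brings every element to the end in
  turn.\<close>

lemma reg_powers:
  assumes M: "primeideal M R" and J: "saturated M J"
  shows "length xs = length ns \<Longrightarrow> reg M J (xs @ ys) \<Longrightarrow> (\<And>n. n \<in> set ns \<Longrightarrow> (0::nat) < n) \<Longrightarrow>
    reg M J (map2 (\<lambda>x n. x [^] n) xs ns @ ys)"
proof (induction xs ns arbitrary: ys rule: list_induct2)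
  case (Cons x xs n ns)
  let ?zs = "map2 (\<lambda>x n. x [^] n) xs ns @ ys"
  have Mc: "M \<subseteq> carrier R" using ideal_sub[OF prime_ideal[OF M]] .
  have "reg M J (xs @ ys @ [x])" by (rule reg_perm[OF M J Cons.prems(1)]) simp
  hence "reg M J (map2 (\<lambda>x n. x [^] n) xs ns @ ys @ [x])" using Cons.IH[of "ys @ [x]"] Cons.prems by simp
  hence r: "reg M J (?zs @ [x])" by simp
  have zM: "set ?zs \<subseteq> M" using reg_set[OF r] by simp
  have x: "reg M J ?zs" "x \<in> M" "nzd (sat M (J \<union> set ?zs)) x"
    using r reg_append[OF Mc J zM, of "[x]"] by auto
  have "nzd (sat M (J \<union> set ?zs)) (x [^] n)" using nzd_pow x(2,3) Mc by blast
  moreover have "x [^] n \<in> M" using ideal_pow_mem[OF prime_ideal[OF M] x(2)] Cons.prems by simp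
  ultimately have "reg M J (?zs @ [x [^] n])" using reg_append[OF Mc J zM, of "[x [^] n]"] x(1) by simp
  thus ?case by (rule reg_perm[OF M J]) simp
qed simp

text \<open>Only maximal annihilators are collected; they already cover the zero divisors. For
  finiteness, the elements with maximal annihilator lie in an ideal generated by a finite set
  \<open>U\<close> of them. For a further annihilator there would be an \<open>h\<close> outside it
  that kills all of \<open>U\<close> modulo \<open>J\<close>, hence the whole ideal.\<close>

lemma finite_associated_primes:
  assumes M: "primeideal M R" and J: "saturated M J"
  shows "\<exists>F. finite F \<and>
    (\<forall>P \<in> F. primeideal P R \<and> P \<subseteq> M \<and> (\<exists>v \<in> carrier R. v \<notin> J \<and> P = {c \<in> carrier R. c \<otimes> v \<in> J})) \<and>
    (\<forall>c \<in> carrier R. (\<forall>P \<in> F. c \<notin> P) \<longrightarrow> nzd J c)"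
proof -
  have Ji: "ideal J R" using J saturated_ideal by blast
  define col where "col v = {c \<in> carrier R. c \<otimes> v \<in> J}" for v
  define W where "W = {u \<in> carrier R. u \<notin> J \<and> (\<forall>w \<in> carrier R. w \<notin> J \<longrightarrow> col u \<subseteq> col w \<longrightarrow> col w = col u)}"
  have colI: "ideal (col v) R" if "v \<in> carrier R" for v using colon_ideal[OF Ji that] by (simp add: col_def)
  have Wp: "primeideal (col u) R \<and> col u \<subseteq> M" if u: "u \<in> W" for u
  proof -
    have uc: "u \<in> carrier R" "u \<notin> J" using u by (auto simp: W_def)
    obtain r where r: "r \<in> carrier R" "r \<otimes> u \<notin> J" "primeideal (col (r \<otimes> u)) R" "col (r \<otimes> u) \<subseteq> M"
      using associated_prime_exists[OF M J uc] unfolding col_def by blast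
    have "col u \<subseteq> col (r \<otimes> u)"
    proof
      fix c assume c: "c \<in> col u"
      hence cc: "c \<in> carrier R" "c \<otimes> u \<in> J" by (auto simp: col_def)
      have "c \<otimes> (r \<otimes> u) = r \<otimes> (c \<otimes> u)" using cc(1) r(1) uc(1) by algebra
      thus "c \<in> col (r \<otimes> u)" using ideal_mult[OF Ji cc(2) r(1)] cc by (simp add: col_def)
    qed
    hence "col (r \<otimes> u) = col u" using u r(1,2) uc by (simp add: W_def)
    thus ?thesis using r by simp
  qed
  have W_dom: "\<exists>w \<in> W. col u \<subseteq> col w" if u: "u \<in> carrier R" "u \<notin> J" for u
  proof -
    let ?S = "col ` {w \<in> carrier R. w \<notin> J \<and> col u \<subseteq> col w}"
    have "\<exists>I \<in> ?S. \<forall>K \<in> ?S. I \<subseteq> K \<longrightarrow> K = I"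
      by (rule ideal_maximal_exists) (use u colI in auto)
    then obtain w where w: "w \<in> carrier R" "w \<notin> J" "col u \<subseteq> col w"
      "\<And>v. v \<in> carrier R \<Longrightarrow> v \<notin> J \<Longrightarrow> col u \<subseteq> col v \<Longrightarrow> col w \<subseteq> col v \<Longrightarrow> col v = col w" by auto
    thus ?thesis by (intro bexI[of _ w]) (auto simp: W_def)
  qed
  have Wc: "W \<subseteq> carrier R" by (auto simp: W_def)
  define \<U> where "\<U> = {U. finite U \<and> U \<subseteq> W}"
  have "\<exists>I \<in> genideal R ` \<U>. \<forall>K \<in> genideal R ` \<U>. I \<subseteq> K \<longrightarrow> K = I"
  proof (rule ideal_maximal_exists)
    have "{} \<in> \<U>" by (simp add: \<U>_def)
    thus "genideal R ` \<U> \<noteq> {}" by blast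
    show "ideal I R" if "I \<in> genideal R ` \<U>" for I
      using that Wc genideal_ideal unfolding \<U>_def by blast
  qed
  then obtain U where U0: "U \<in> \<U>" and mx: "\<forall>K \<in> genideal R ` \<U>. Idl U \<subseteq> K \<longrightarrow> K = Idl U"
    by (elim bexE imageE) simp
  have U: "finite U" "U \<subseteq> W" using U0 by (auto simp: \<U>_def)
  have max: "Idl V = Idl U" if "finite V" "V \<subseteq> W" "Idl U \<subseteq> Idl V" for V
    using mx that unfolding \<U>_def by blast
  have Uc: "U \<subseteq> carrier R" using U Wc by blast
  have WU: "W \<subseteq> Idl U"
  proof
    fix u assume u: "u \<in> W"
    have c: "insert u U \<subseteq> carrier R" using u U Wc by blast
    have "Idl (insert u U) = Idl U"
      by (rule max) (use U u subset_Idl_subset[OF c, of U] in auto)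
    thus "u \<in> Idl U" using genideal_self[OF c] by blast
  qed
  have colU: "col u \<in> col ` U" if u: "u \<in> W" for u
  proof (rule ccontr)
    assume n: "col u \<notin> col ` U"
    have nsub: "\<not> col w \<subseteq> col u" if "w \<in> U" for w
    proof
      assume "col w \<subseteq> col u"
      moreover have "w \<in> W" "u \<in> carrier R" "u \<notin> J" using that U u by (auto simp: W_def)
      ultimately have "col u = col w" by (simp add: W_def)
      thus False using n that by blast
    qed
    have 1: "\<not> carrier R \<subseteq> col u" using prime_one Wp[OF u] by blast
    have 2: "ideal I R \<and> \<not> I \<subseteq> col u" if I: "I \<in> col ` U" for I
    proof -
      obtain w where w: "w \<in> U" "I = col w" using I by (elim imageE)
      hence "w \<in> carrier R" using Uc by blast
      thus ?thesis using colI nsub w by simp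
    qed
    have 3: "primeideal (col u) R" using Wp[OF u] by simp
    have "\<exists>h \<in> carrier R. h \<notin> col u \<and> (\<forall>I \<in> col ` U. h \<in> I)"
      by (rule prime_avoids_product[OF finite_imageI[OF U(1)] 3 oneideal 1]) (rule 2)
    then obtain h where h: "h \<in> carrier R" "h \<notin> col u" "\<forall>I \<in> col ` U. h \<in> I" by (elim bexE conjE)
    have "v \<in> carrier R \<and> v \<otimes> h \<in> J" if v: "v \<in> U" for v
    proof -
      have "v \<in> carrier R" "h \<otimes> v \<in> J" using v h(3) Uc by (auto simp: col_def)
      thus ?thesis using m_comm[OF h(1), of v] by simp
    qed
    hence "U \<subseteq> {v \<in> carrier R. v \<otimes> h \<in> J}" by blast
    hence "Idl U \<subseteq> {v \<in> carrier R. v \<otimes> h \<in> J}" by (rule genideal_minimal[OF colon_ideal[OF Ji h(1)]])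
    hence "u \<otimes> h \<in> J" "u \<in> carrier R" using WU u by auto
    hence "h \<in> col u" using h(1) m_comm[OF h(1), of u] by (simp add: col_def)
    thus False using h(2) by blast
  qed
  have "nzd J c" if c: "c \<in> carrier R" "\<forall>P \<in> col ` U. c \<notin> P" for c
    unfolding nzd_def
  proof (intro ballI impI, rule ccontr)
    fix u assume u: "u \<in> carrier R" "c \<otimes> u \<in> J" "u \<notin> J"
    obtain w where w: "w \<in> W" "col u \<subseteq> col w" using W_dom[OF u(1,3)] by blast
    have "c \<in> col u" using u c by (simp add: col_def)
    thus False using w colU c by blast
  qed
  moreover have "\<exists>v \<in> carrier R. v \<notin> J \<and> P = {c \<in> carrier R. c \<otimes> v \<in> J}" if "P \<in> col ` U" for P
    using that U unfolding W_def col_def by blast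
  moreover have "primeideal P R \<and> P \<subseteq> M" if "P \<in> col ` U" for P using that U Wp by blast
  ultimately show ?thesis using U(1) by (intro exI[of _ "col ` U"]) blast
qed

text \<open>Up to denominators, \<open>wu = u'v\<close> modulo \<open>J\<close>, and comparing with
  \<open>xu = rv\<close> puts \<open>xu'\<close> into \<open>J + w\<close>. So \<open>u'\<close> is
  a multiple of \<open>w\<close>, and cancelling \<open>w\<close> exhibits \<open>u\<close> as a
  multiple of \<open>v\<close>. Hence \<open>M\<close> is not associated to the quotient by
  \<open>v\<close> if it is not associated to that by \<open>w\<close>.\<close>

lemma associated_exchange:
  assumes M: "primeideal M R" and J: "saturated M J" and v: "v \<in> carrier R" "nzd J v" and w: "w \<in> carrier R" "nzd J w"
    and x: "x \<in> M" "nzd (sat M (insert w J)) x"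
    and u: "u \<in> carrier R" "\<And>c. c \<in> M \<Longrightarrow> c \<otimes> u \<in> sat M (insert v J)" and wM: "w \<in> M"
  shows "u \<in> sat M (insert v J)"
proof -
  have Ji: "ideal J R" using J saturated_ideal by blast
  have Mc: "M \<subseteq> carrier R" using ideal_sub[OF prime_ideal[OF M]] .
  have xc: "x \<in> carrier R" using x Mc by blast
  obtain s u' where s: "s \<in> carrier R - M" "u' \<in> carrier R" "s \<otimes> (w \<otimes> u) \<ominus> u' \<otimes> v \<in> J"
    using u(2)[OF wM] mem_sat_insert[OF M Ji v(1)] by blast
  have sc: "s \<in> carrier R" using s by simp
  obtain t r where t: "t \<in> carrier R - M" "r \<in> carrier R" "t \<otimes> (x \<otimes> u) \<ominus> r \<otimes> v \<in> J"
    using u(2)[OF x(1)] mem_sat_insert[OF M Ji v(1)] by blast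
  have tc: "t \<in> carrier R" using t by simp
  have "v \<otimes> (t \<otimes> (x \<otimes> u') \<ominus> (s \<otimes> r) \<otimes> w)
      = (s \<otimes> w) \<otimes> (t \<otimes> (x \<otimes> u) \<ominus> r \<otimes> v) \<oplus> (\<ominus> (t \<otimes> x)) \<otimes> (s \<otimes> (w \<otimes> u) \<ominus> u' \<otimes> v)"
    using sc tc v(1) w(1) xc u(1) s(2) t(2) by algebra
  hence "v \<otimes> (t \<otimes> (x \<otimes> u') \<ominus> (s \<otimes> r) \<otimes> w) \<in> J"
    using ideal_comb[OF Ji t(3) s(3), of "s \<otimes> w" "\<ominus> (t \<otimes> x)"] sc tc w xc by simp
  hence "t \<otimes> (x \<otimes> u') \<ominus> (s \<otimes> r) \<otimes> w \<in> J"
    using nzdD[OF v(2)] sc tc w(1) xc s(2) t(2) by simp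
  hence "x \<otimes> u' \<in> sat M (insert w J)"
    using mem_sat_insert[OF M Ji w(1)] t(1) sc xc s(2) t(2) by (meson m_closed)
  hence "u' \<in> sat M (insert w J)" using nzdD[OF x(2) _ s(2)] by blast
  then obtain q a where q: "q \<in> carrier R - M" "a \<in> carrier R" "q \<otimes> u' \<ominus> a \<otimes> w \<in> J"
    using mem_sat_insert[OF M Ji w(1)] by blast
  have qc: "q \<in> carrier R" using q by simp
  have "w \<otimes> ((q \<otimes> s) \<otimes> u \<ominus> a \<otimes> v) = q \<otimes> (s \<otimes> (w \<otimes> u) \<ominus> u' \<otimes> v) \<oplus> v \<otimes> (q \<otimes> u' \<ominus> a \<otimes> w)"
    using qc sc v(1) w(1) u(1) s(2) q(2) by algebra
  hence "w \<otimes> ((q \<otimes> s) \<otimes> u \<ominus> a \<otimes> v) \<in> J" using ideal_comb[OF Ji s(3) q(3) qc v(1)] by simp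
  hence "(q \<otimes> s) \<otimes> u \<ominus> a \<otimes> v \<in> J" using nzdD[OF w(2)] qc sc u(1) q(2) v(1) by simp
  thus ?thesis using mem_sat_insert[OF M Ji v(1)] prime_compl_mult[OF M q(1) s(1)] q(2) u(1) by blast
qed

text \<open>The nonzerodivisor \<open>v\<close> may be unrelated to the given regular sequence,
  which starts with some \<open>w\<close>. An element \<open>c\<close> regular modulo
  \<open>J\<close>, \<open>J + w\<close> and \<open>J + v\<close> mediates: induction applies to
  \<open>c\<close> modulo \<open>w\<close>, and then to \<open>v\<close> modulo
  \<open>c\<close>.\<close>

lemma depth_ge_quotient:
  assumes M: "primeideal M R"
  shows "saturated M J \<Longrightarrow> depth_ge M J (Suc j) \<Longrightarrow> v \<in> M \<Longrightarrow> nzd J v \<Longrightarrow> depth_ge M (sat M (insert v J)) j"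
proof (induction j arbitrary: J v)
  case 0 show ?case by (simp add: depth_ge_def)
next
  case (Suc j)
  note J = Suc.prems(1) and v = Suc.prems(3,4)
  have Mi: "ideal M R" using M prime_ideal by blast
  have Mc: "M \<subseteq> carrier R" using ideal_sub[OF Mi] .
  have Jc: "J \<subseteq> carrier R" using ideal_sub[OF saturated_ideal[OF J]] .
  obtain w where w: "w \<in> M" "nzd J w" "depth_ge M (sat M (insert w J)) (Suc j)" using Suc.prems(2) depth_ge_Suc by blast
  then obtain x where x: "x \<in> M" "nzd (sat M (insert w J)) x" using depth_ge_Suc by blast
  let ?Jw = "sat M (insert w J)" and ?Jv = "sat M (insert v J)"
  have ex: "\<exists>F. finite F \<and> (\<forall>P \<in> F. primeideal P R \<and> \<not> M \<subseteq> P) \<and> (\<forall>c \<in> carrier R. (\<forall>P \<in> F. c \<notin> P) \<longrightarrow> nzd I c)"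
    if I: "saturated M I" "\<forall>u \<in> carrier R. (\<forall>c \<in> M. c \<otimes> u \<in> I) \<longrightarrow> u \<in> I" for I
  proof -
    obtain F where F: "finite F"
      "\<forall>P \<in> F. primeideal P R \<and> P \<subseteq> M \<and> (\<exists>v \<in> carrier R. v \<notin> I \<and> P = {c \<in> carrier R. c \<otimes> v \<in> I})"
      "\<forall>c \<in> carrier R. (\<forall>P \<in> F. c \<notin> P) \<longrightarrow> nzd I c"
      using finite_associated_primes[OF M I(1)] by (elim exE conjE)
    have "\<not> M \<subseteq> P" if P: "P \<in> F" for P
    proof
      assume "M \<subseteq> P"
      moreover obtain u where "u \<in> carrier R" "u \<notin> I" "P = {c \<in> carrier R. c \<otimes> u \<in> I}"
        using bspec[OF F(2) P] by (elim conjE bexE)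
      ultimately show False using I(2) by blast
    qed
    hence "\<forall>P \<in> F. primeideal P R \<and> \<not> M \<subseteq> P" using F(2) by simp
    thus ?thesis using F(1,3) by (intro exI[of _ F] conjI)
  qed
  have 1: "\<forall>u \<in> carrier R. (\<forall>c \<in> M. c \<otimes> u \<in> J) \<longrightarrow> u \<in> J"
    using v(1) nzdD[OF v(2)] by blast
  have 2: "\<forall>u \<in> carrier R. (\<forall>c \<in> M. c \<otimes> u \<in> ?Jw) \<longrightarrow> u \<in> ?Jw"
    using x(1) nzdD[OF x(2)] by blast
  have 3: "\<forall>u \<in> carrier R. (\<forall>c \<in> M. c \<otimes> u \<in> ?Jv) \<longrightarrow> u \<in> ?Jv"
    using associated_exchange[OF M J _ v(2) _ w(2) x _ _ w(1)] v(1) w(1) Mc by blast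
  obtain F1 where F1: "finite F1" "\<forall>P \<in> F1. primeideal P R \<and> \<not> M \<subseteq> P"
    "\<forall>c \<in> carrier R. (\<forall>P \<in> F1. c \<notin> P) \<longrightarrow> nzd J c" using ex[OF J 1] by (elim exE conjE)
  obtain F2 where F2: "finite F2" "\<forall>P \<in> F2. primeideal P R \<and> \<not> M \<subseteq> P"
    "\<forall>c \<in> carrier R. (\<forall>P \<in> F2. c \<notin> P) \<longrightarrow> nzd ?Jw c" using ex[OF saturated_sat 2] by (elim exE conjE)
  obtain F3 where F3: "finite F3" "\<forall>P \<in> F3. primeideal P R \<and> \<not> M \<subseteq> P"
    "\<forall>c \<in> carrier R. (\<forall>P \<in> F3. c \<notin> P) \<longrightarrow> nzd ?Jv c" using ex[OF saturated_sat 3] by (elim exE conjE)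
  \<comment> \<open>\<open>M\<close> is associated to none of the three quotients, so their finitely
    many maximal associated primes do not cover it.\<close>
  have "\<exists>k \<in> M. \<forall>P \<in> F1 \<union> F2 \<union> F3. \<zero> \<oplus> k \<notin> P"
    by (rule prime_avoidance[OF _ zero_closed Mi]) (use F1 F2 F3 in blast)+
  then obtain c where c: "c \<in> M" "\<forall>P \<in> F1 \<union> F2 \<union> F3. c \<notin> P" using Mc by (metis l_zero subsetD)
  have cc: "c \<in> carrier R" "w \<in> carrier R" "v \<in> carrier R" using c w v Mc by auto
  have cn: "nzd J c" "nzd ?Jw c" "nzd ?Jv c" using F1(3) F2(3) F3(3) c cc by auto
  let ?Jc = "sat M (insert c J)"
  have comm: "sat M (insert a (sat M (insert b J))) = sat M (insert b (sat M (insert a J)))"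
    if "a \<in> carrier R" "b \<in> carrier R" for a b
    using sat_sat_insert[of "insert b J" a M] sat_sat_insert[of "insert a J" b M] that Jc by (simp add: insert_commute)
  have "depth_ge M (sat M (insert c ?Jw)) j" using Suc.IH[OF saturated_sat w(3) c(1) cn(2)] .
  hence "depth_ge M (sat M (insert w ?Jc)) j" using comm cc by simp
  moreover have "nzd ?Jc w" using nzd_swap[OF M J cc(2) w(2) cc(1) cn(2)] .
  ultimately have "depth_ge M ?Jc (Suc j)" using depth_ge_Suc w by blast
  moreover have "nzd ?Jc v" using nzd_swap[OF M J cc(3) v(2) cc(1) cn(3)] .
  ultimately have "depth_ge M (sat M (insert v ?Jc)) j" using Suc.IH[OF saturated_sat _ v(1)] by blast
  hence "depth_ge M (sat M (insert c ?Jv)) j" using comm cc by simp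
  thus ?case using depth_ge_Suc c cn by blast
qed

lemma depth_ge_quotient_list:
  assumes M: "primeideal M R"
  shows "saturated M J \<Longrightarrow> reg M J xs \<Longrightarrow> depth_ge M J (length xs + j) \<Longrightarrow> depth_ge M (sat M (J \<union> set xs)) j"
proof (induction xs arbitrary: J)
  case Nil thus ?case by (simp add: sat_saturated)
next
  case (Cons x xs)
  have Mc: "M \<subseteq> carrier R" using ideal_sub[OF prime_ideal[OF M]] .
  have x: "x \<in> M" "nzd J x" "reg M (sat M (insert x J)) xs" using Cons.prems by auto
  have "depth_ge M (sat M (insert x J)) (length xs + j)"
    using depth_ge_quotient[OF M Cons.prems(1) _ x(1,2)] Cons.prems(3) by simp
  hence "depth_ge M (sat M (sat M (insert x J) \<union> set xs)) j" using Cons.IH[OF saturated_sat x(3)] by blast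
  moreover have "sat M (sat M (insert x J) \<union> set xs) = sat M (insert x J \<union> set xs)"
    using x reg_set[OF x(3)] Mc ideal_sub[OF saturated_ideal[OF Cons.prems(1)]] by (intro sat_sat_Un) auto
  ultimately show ?case by simp
qed

text \<open>With \<open>x\<close> regular modulo \<open>J\<close>, Nakayama's lemma gives an element
  killed by \<open>P\<close> modulo \<open>J\<close> that is nonzero modulo \<open>J + x\<close>.
  The annihilator of a suitable multiple of it is a prime containing \<open>P\<close> and
  \<open>x\<close>, so it is strictly larger, while the depth fell by one.\<close>

lemma associated_prime_chain:
  assumes M: "primeideal M R"
  shows "saturated M J \<Longrightarrow> depth_ge M J j \<Longrightarrow> v \<in> carrier R \<Longrightarrow> v \<notin> J \<Longrightarrow> P = {c \<in> carrier R. c \<otimes> v \<in> J} \<Longrightarrow>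
    primeideal P R \<Longrightarrow> \<exists>n\<ge>j. prime_path P n M"
proof (induction j arbitrary: J v P)
  case 0
  have "P \<subseteq> M" using saturatedD[OF 0(1) _ _ 0(3)] 0(4,5) by blast
  thus ?case using 0(6) M by (cases "P = M") (auto intro: prime_path_0 prime_path_step)
next
  case (Suc j)
  note J = Suc.prems(1) and v = Suc.prems(3,4) and P = Suc.prems(5,6)
  have Ji: "ideal J R" using J saturated_ideal by blast
  obtain x where x: "x \<in> M" "nzd J x" "depth_ge M (sat M (insert x J)) j" using Suc.prems(2) depth_ge_Suc by blast
  have xc: "x \<in> carrier R" using x ideal_carr[OF prime_ideal[OF M]] by blast
  have xP: "x \<notin> P" using nzdD[OF x(2) _ v(1)] v(2) P(1) by blast
  have up: "insert x J \<subseteq> sat M (insert x J)" using xc ideal_sub[OF Ji] by (intro sat_upper) auto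
  let ?C = "{u \<in> carrier R. \<forall>c \<in> P. c \<otimes> u \<in> J}"
  have "v \<in> ?C" using v P(1) by auto
  have "\<not> ?C \<subseteq> sat M (insert x J)"
  proof
    assume sub: "?C \<subseteq> sat M (insert x J)"
    have "?C \<subseteq> J"
    proof (rule nakayama[OF M J])
      fix E assume E: "saturated M E" "J \<subseteq> E" "\<And>p u. p \<in> M \<Longrightarrow> u \<in> ?C \<Longrightarrow> p \<otimes> u \<in> E"
      show "?C \<subseteq> E"
      proof
        fix u assume u: "u \<in> ?C"
        hence uc: "u \<in> carrier R" by simp
        obtain s r where s: "s \<in> carrier R - M" "r \<in> carrier R" "s \<otimes> u \<ominus> r \<otimes> x \<in> J"
          using u sub mem_sat_insert[OF M Ji xc] by blast
        have sc: "s \<in> carrier R" using s by simp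
        have "c \<otimes> r \<in> J" if c: "c \<in> P" for c
        proof -
          have cc: "c \<in> carrier R" and cu: "c \<otimes> u \<in> J" using c P(1) u by auto
          have "x \<otimes> (c \<otimes> r) = s \<otimes> (c \<otimes> u) \<oplus> (\<ominus> c) \<otimes> (s \<otimes> u \<ominus> r \<otimes> x)"
            using sc cc uc s(2) xc by algebra
          hence "x \<otimes> (c \<otimes> r) \<in> J" using ideal_comb[OF Ji cu s(3) sc, of "\<ominus> c"] cc by simp
          thus ?thesis using nzdD[OF x(2)] cc s(2) by simp
        qed
        hence "x \<otimes> r \<in> E" using E(3)[OF x(1)] s(2) by simp
        hence "r \<otimes> x \<in> E" using m_comm xc s(2) by simp
        hence "s \<otimes> u \<in> E" using ideal_minus_cancel[OF saturated_ideal[OF E(1)], of "s \<otimes> u" "r \<otimes> x"] s E(2) sc uc by auto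
        thus "u \<in> E" using saturatedD[OF E(1) _ s(1) uc] by blast
      qed
    qed auto
    thus False using \<open>v \<in> ?C\<close> v by blast
  qed
  then obtain u where u: "u \<in> carrier R" "\<And>c. c \<in> P \<Longrightarrow> c \<otimes> u \<in> J" "u \<notin> sat M (insert x J)" by blast
  define Q where "Q r = {c \<in> carrier R. c \<otimes> (r \<otimes> u) \<in> sat M (insert x J)}" for r
  obtain r where r: "r \<in> carrier R" "r \<otimes> u \<notin> sat M (insert x J)" "primeideal (Q r) R"
    using associated_prime_exists[OF M saturated_sat u(1,3)] unfolding Q_def by blast
  have ru: "r \<otimes> u \<in> carrier R" using r u by simp
  have "P \<subseteq> Q r"
  proof
    fix c assume c: "c \<in> P"
    have cc: "c \<in> carrier R" using c P(1) by auto
    have "c \<otimes> (r \<otimes> u) = r \<otimes> (c \<otimes> u)" using cc r(1) u(1) by algebra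
    thus "c \<in> Q r" using ideal_mult[OF Ji u(2)[OF c] r(1)] up cc by (auto simp: Q_def)
  qed
  moreover have "x \<in> Q r" using ideal_mult_right[OF sat_ideal _ ru] up xc by (auto simp: Q_def)
  ultimately have sub: "P \<subset> Q r" using xP by blast
  obtain n where "n \<ge> j" "prime_path (Q r) n M" using Suc.IH[OF saturated_sat x(3) ru r(2) Q_def r(3)] by blast
  thus ?case using prime_path.prime_path_Suc[OF P(2) sub] by (intro exI[of _ "Suc n"]) simp
qed

text \<open>Associated primes have coheight at least the depth that is left after \<open>xs\<close>.
  By \<open>short\<close> a prime containing \<open>x\<close> has less, so \<open>x\<close> lies in
  no associated prime.\<close>

lemma nzd_from_chains:
  assumes M: "primeideal M R" and J: "saturated M J" and xs: "reg M J xs" and depth_ge: "depth_ge M J n" "length xs \<le> n"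
    and x: "x \<in> carrier R"
    and short: "\<And>P m. prime_path P m M \<Longrightarrow> J \<union> set xs \<subseteq> P \<Longrightarrow> x \<in> P \<Longrightarrow> m < n - length xs"
  shows "nzd (sat M (J \<union> set xs)) x"
  unfolding nzd_def
proof (intro ballI impI, rule ccontr)
  let ?I = "sat M (J \<union> set xs)"
  have Mc: "M \<subseteq> carrier R" using ideal_sub[OF prime_ideal[OF M]] .
  fix u assume u: "u \<in> carrier R" "x \<otimes> u \<in> ?I" "u \<notin> ?I"
  define Q where "Q r = {c \<in> carrier R. c \<otimes> (r \<otimes> u) \<in> ?I}" for r
  obtain r where r: "r \<in> carrier R" "r \<otimes> u \<notin> ?I" "primeideal (Q r) R"
    using associated_prime_exists[OF M saturated_sat u(1,3)] unfolding Q_def by blast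
  have ru: "r \<otimes> u \<in> carrier R" using r u by simp
  have "depth_ge M ?I (n - length xs)" using depth_ge_quotient_list[OF M J xs, of "n - length xs"] depth_ge by simp
  then obtain m where m: "m \<ge> n - length xs" "prime_path (Q r) m M"
    using associated_prime_chain[OF M saturated_sat _ ru r(2) Q_def r(3)] by blast
  have "J \<union> set xs \<subseteq> ?I"
    using ideal_sub[OF saturated_ideal[OF J]] reg_set[OF xs] Mc by (intro sat_upper) auto
  hence "J \<union> set xs \<subseteq> Q r" using colon_carr_subset[OF sat_ideal ru] unfolding Q_def by blast
  moreover have "x \<in> Q r"
  proof -
    have "x \<otimes> (r \<otimes> u) = r \<otimes> (x \<otimes> u)" using x r(1) u(1) by algebra
    thus ?thesis using ideal_mult[OF sat_ideal u(2) r(1)] x by (simp add: Q_def)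
  qed
  ultimately show False using short[OF m(2)] m(1) by simp
qed

text \<open>By Krull's height theorem every prime over \<open>J\<close> and the first
  \<open>k + 1\<close> parameters has coheight below the depth left after \<open>k\<close> of them,
  so \<open>nzd_from_chains\<close> applies at each stage.\<close>

lemma parameters_regular:
  assumes M: "primeideal M R" and J: "saturated M J" and depth_ge: "depth_ge M J (length xs)" and xs: "set xs \<subseteq> M"
    and only: "\<And>P. primeideal P R \<Longrightarrow> J \<subseteq> P \<Longrightarrow> set xs \<subseteq> P \<Longrightarrow> P \<subseteq> M \<Longrightarrow> P = M"
  shows "reg M J xs"
proof -
  have Mc: "M \<subseteq> carrier R" using ideal_sub[OF prime_ideal[OF M]] .
  have "k \<le> length xs \<Longrightarrow> reg M J (take k xs)" for k
  proof (induction k)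
    case (Suc k)
    let ?t = "take k xs" and ?x = "xs ! k"
    have t: "reg M J ?t" "length ?t = k" "set ?t \<subseteq> M" using Suc xs set_take_subset[of k xs] by auto
    have xM: "?x \<in> M" using Suc.prems xs nth_mem[of k xs] by auto
    have "nzd (sat M (J \<union> set ?t)) ?x"
    proof (rule nzd_from_chains[OF M J t(1) depth_ge])
      fix P m assume P: "prime_path P m M" "J \<union> set ?t \<subseteq> P" "?x \<in> P"
      have "xs = ?t @ ?x # drop (Suc k) xs" using Suc.prems by (simp add: id_take_nth_drop)
      hence sx: "set xs = set ?t \<union> {?x} \<union> set (drop (Suc k) xs)"
        by (metis Un_insert_right insert_is_Un list.simps(15) set_append sup_bot_right Un_assoc)
      have "m \<le> length (drop (Suc k) xs)"
      proof (rule prime_path_length_le[OF P(1)])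
        show "set (drop (Suc k) xs) \<subseteq> M" using sx xs by blast
        fix P' assume P': "primeideal P' R" "P \<subseteq> P'" "set (drop (Suc k) xs) \<subseteq> P'" "P' \<subseteq> M"
        have "J \<subseteq> P'" using P(2) P'(2) by blast
        moreover have "set xs \<subseteq> P'" unfolding sx using P(2,3) P'(2,3) by auto
        ultimately show "P' = M" using only[OF P'(1) _ _ P'(4)] by simp
      qed
      thus "m < length xs - length ?t" using Suc.prems t by simp
    qed (use Suc.prems t xM Mc in auto)
    hence "reg M J (?t @ [?x])" using reg_append[OF Mc J t(3)] t(1) xM by simp
    thus ?case using Suc.prems by (simp add: take_Suc_conv_app_nth)
  qed simp
  from this[of "length xs"] show ?thesis by simp
qed

section \<open>Minimal primes over an ideal\<close>

lemma finitely_many_minimal_primes: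
  assumes "ideal J R"
  shows "\<exists>F. finite F \<and> (\<forall>P \<in> F. primeideal P R \<and> J \<subseteq> P) \<and> (\<forall>Q. primeideal Q R \<and> J \<subseteq> Q \<longrightarrow> (\<exists>P \<in> F. P \<subseteq> Q))"
  using assms
proof (induction rule: noetherian_induct)
  case (step J)
  show ?case
  proof (cases "primeideal J R")
    case True thus ?thesis by (intro exI[of _ "{J}"]) auto
  next
    case False
    show ?thesis
    proof (cases "\<one> \<in> J")
      case True
      hence "\<not> (primeideal Q R \<and> J \<subseteq> Q)" for Q using prime_one by blast
      thus ?thesis by (intro exI[of _ "{}"]) blast
    next
      case one: False
      obtain a b where ab: "a \<in> carrier R" "b \<in> carrier R" "a \<otimes> b \<in> J" "a \<notin> J" "b \<notin> J"
        using False primeI[OF step(1) one] by blast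
      have Jc: "insert a J \<subseteq> carrier R" "insert b J \<subseteq> carrier R" using ab ideal_sub[OF step(1)] by auto
      have up: "insert a J \<subseteq> Idl (insert a J)" "insert b J \<subseteq> Idl (insert b J)"
        using genideal_self[OF Jc(1)] genideal_self[OF Jc(2)] by auto
      have "J \<subset> Idl (insert a J)" "J \<subset> Idl (insert b J)" using up ab by auto
      note sub = this
      obtain F where F: "finite F" "\<forall>P \<in> F. primeideal P R \<and> Idl (insert a J) \<subseteq> P"
          "\<forall>Q. primeideal Q R \<and> Idl (insert a J) \<subseteq> Q \<longrightarrow> (\<exists>P \<in> F. P \<subseteq> Q)"
        using step(2)[OF genideal_ideal[OF Jc(1)] sub(1)] by (elim exE conjE)
      obtain G where G: "finite G" "\<forall>P \<in> G. primeideal P R \<and> Idl (insert b J) \<subseteq> P"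
          "\<forall>Q. primeideal Q R \<and> Idl (insert b J) \<subseteq> Q \<longrightarrow> (\<exists>P \<in> G. P \<subseteq> Q)"
        using step(2)[OF genideal_ideal[OF Jc(2)] sub(2)] by (elim exE conjE)
      have "\<exists>P \<in> F \<union> G. P \<subseteq> Q" if Q: "primeideal Q R" "J \<subseteq> Q" for Q
      proof -
        have "a \<in> Q \<or> b \<in> Q" using primeD[OF Q(1) _ ab(1,2)] ab(3) Q(2) by blast
        thus ?thesis
        proof
          assume "a \<in> Q"
          hence "Idl (insert a J) \<subseteq> Q" using genideal_minimal[OF prime_ideal[OF Q(1)]] Q(2) by simp
          thus ?thesis using F(3) Q(1) by blast
        next
          assume "b \<in> Q"
          hence "Idl (insert b J) \<subseteq> Q" using genideal_minimal[OF prime_ideal[OF Q(1)]] Q(2) by simp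
          thus ?thesis using G(3) Q(1) by blast
        qed
      qed
      moreover have "primeideal P R \<and> J \<subseteq> P" if "P \<in> F \<union> G" for P
        using that F(2) G(2) sub by (meson UnE order.trans psubset_imp_subset)
      ultimately show ?thesis using F(1) G(1) by (intro exI[of _ "F \<union> G"] conjI ballI allI impI) simp_all
    qed
  qed
qed

definition min_over :: "'a set \<Rightarrow> 'a set \<Rightarrow> bool" where
  "min_over J P \<longleftrightarrow> primeideal P R \<and> J \<subseteq> P \<and> (\<forall>Q. primeideal Q R \<and> J \<subseteq> Q \<and> Q \<subseteq> P \<longrightarrow> Q = P)"

lemma finite_min_over: "ideal J R \<Longrightarrow> finite {P. min_over J P}"
proof -
  assume J: "ideal J R"
  obtain F where F: "finite F" "\<forall>P \<in> F. primeideal P R \<and> J \<subseteq> P"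
    "\<forall>Q. primeideal Q R \<and> J \<subseteq> Q \<longrightarrow> (\<exists>P \<in> F. P \<subseteq> Q)" using finitely_many_minimal_primes[OF J] by (elim exE conjE)
  have "P \<in> F" if P: "min_over J P" for P
  proof -
    have "primeideal P R \<and> J \<subseteq> P" using P by (simp add: min_over_def)
    then obtain P' where P': "P' \<in> F" "P' \<subseteq> P" using F(3) by (elim allE impE bexE)
    hence "P' = P" using P F(2) by (simp add: min_over_def)
    thus ?thesis using P' by simp
  qed
  hence "{P. min_over J P} \<subseteq> F" by auto
  thus ?thesis using F(1) finite_subset by blast
qed

lemma min_over_exists:
  assumes J: "ideal J R" and Q: "primeideal Q R" "J \<subseteq> Q"
  shows "\<exists>P. min_over J P \<and> P \<subseteq> Q"
proof -
  obtain F where F: "finite F" "\<forall>P \<in> F. primeideal P R \<and> J \<subseteq> P"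
    "\<forall>Q. primeideal Q R \<and> J \<subseteq> Q \<longrightarrow> (\<exists>P \<in> F. P \<subseteq> Q)" using finitely_many_minimal_primes[OF J] by (elim exE conjE)
  let ?G = "{P \<in> F. P \<subseteq> Q}"
  have "\<exists>P \<in> F. P \<subseteq> Q" using F(3) Q by simp
  hence G: "finite ?G" "?G \<noteq> {}" using F(1) by auto
  obtain P where P: "P \<in> ?G" "\<forall>P' \<in> ?G. P' \<subseteq> P \<longrightarrow> P = P'"
    using finite_has_minimal[OF G] by (elim bexE)
  have "Q' = P" if Q': "primeideal Q' R" "J \<subseteq> Q'" "Q' \<subseteq> P" for Q'
  proof -
    obtain P' where P': "P' \<in> F" "P' \<subseteq> Q'" using F(3) Q'(1,2) by meson
    moreover have "P' \<subseteq> P" "P' \<subseteq> Q" using P' P(1) Q'(3) by auto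
    ultimately have "P = P'" using P(2) by simp
    thus ?thesis using P' Q'(3) by simp
  qed
  hence "min_over J P" using P(1) F(2) by (simp add: min_over_def)
  thus ?thesis using P(1) by blast
qed

text \<open>After localisation at \<open>P\<close>, the prime is the annihilator of some
  \<open>g\<close> modulo \<open>sat P J\<close>. To return to \<open>J\<close>, \<open>g\<close> is
  multiplied by an \<open>s\<close> outside \<open>P\<close> with the annihilator of
  \<open>sg\<close> as large as possible; this annihilator absorbs all denominators.\<close>

lemma min_over_associated:
  assumes J: "saturated M J" and P: "min_over J P" and PM: "P \<subseteq> M"
  shows "\<exists>b \<in> carrier R. b \<notin> J \<and> P = {c \<in> carrier R. c \<otimes> b \<in> J}"
proof -
  have Ji: "ideal J R" using J saturated_ideal by blast
  have Pp: "primeideal P R" and JP: "J \<subseteq> P" using P by (auto simp: min_over_def)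
  have "sat P J \<subseteq> P" by (rule sat_least[OF saturated_prime[OF Pp] JP]) simp
  hence one: "\<one> \<notin> sat P J" using prime_one[OF Pp] by blast
  define col where "col g = {c \<in> carrier R. c \<otimes> g \<in> sat P J}" for g
  obtain g where g: "g \<in> carrier R" "g \<notin> sat P J" "primeideal (col g) R" "col g \<subseteq> P"
    using associated_prime_exists[OF Pp saturated_sat one_closed one] unfolding col_def by auto
  have "J \<subseteq> col g"
    using sat_upper[OF ideal_sub[OF Ji], of P] colon_carr_subset[OF sat_ideal g(1)] unfolding col_def by blast
  hence eq: "col g = P" using P g by (simp add: min_over_def)
  define A where "A s = {c \<in> carrier R. c \<otimes> (s \<otimes> g) \<in> J}" for s
  have "\<exists>I \<in> A ` (carrier R - P). \<forall>K \<in> A ` (carrier R - P). I \<subseteq> K \<longrightarrow> K = I"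
    by (rule ideal_maximal_exists) (use prime_compl_one[OF Pp] colon_ideal[OF Ji] g(1) in \<open>auto simp: A_def\<close>)
  then obtain s where s: "s \<in> carrier R - P" and mx: "\<forall>K \<in> A ` (carrier R - P). A s \<subseteq> K \<longrightarrow> K = A s"
    by (elim bexE imageE) simp
  have max: "A t = A s" if "t \<in> carrier R - P" "A s \<subseteq> A t" for t using mx that by simp
  have sc: "s \<in> carrier R" using s by simp
  have "P \<subseteq> A s"
  proof
    fix c assume "c \<in> P"
    hence c: "c \<in> carrier R" "c \<otimes> g \<in> sat P J" using eq by (auto simp: col_def)
    then obtain t where t: "t \<in> carrier R - P" "t \<otimes> (c \<otimes> g) \<in> J" using mem_sat_ideal[OF Pp Ji] by blast
    have tc: "t \<in> carrier R" using t by simp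
    have "A s \<subseteq> A (t \<otimes> s)"
    proof
      fix z assume "z \<in> A s"
      hence z: "z \<in> carrier R" "z \<otimes> (s \<otimes> g) \<in> J" by (auto simp: A_def)
      have "z \<otimes> ((t \<otimes> s) \<otimes> g) = t \<otimes> (z \<otimes> (s \<otimes> g))" using z(1) tc sc g(1) by algebra
      thus "z \<in> A (t \<otimes> s)" using ideal_mult[OF Ji z(2) tc] z by (simp add: A_def)
    qed
    hence "A (t \<otimes> s) = A s" using max prime_compl_mult[OF Pp t(1) s] by blast
    moreover have "c \<otimes> ((t \<otimes> s) \<otimes> g) = s \<otimes> (t \<otimes> (c \<otimes> g))" using c(1) tc sc g(1) by algebra
    hence "c \<in> A (t \<otimes> s)" using ideal_mult[OF Ji t(2) sc] c by (simp add: A_def)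
    ultimately show "c \<in> A s" by simp
  qed
  moreover have "A s \<subseteq> P"
  proof
    fix c assume "c \<in> A s"
    hence c: "c \<in> carrier R" "c \<otimes> (s \<otimes> g) \<in> J" by (auto simp: A_def)
    have "s \<otimes> (c \<otimes> g) = c \<otimes> (s \<otimes> g)" using c(1) sc g(1) by algebra
    hence "\<exists>t \<in> carrier R - P. t \<otimes> (c \<otimes> g) \<in> J" using s c(2) by (intro bexI[of _ s]) simp_all
    hence "c \<otimes> g \<in> sat P J" using mem_sat_ideal[OF Pp Ji] c(1) g(1) by simp
    thus "c \<in> P" using c eq by (auto simp: col_def)
  qed
  moreover have "s \<otimes> g \<notin> J" using mem_sat_ideal[OF Pp Ji] s g by auto
  ultimately show ?thesis using sc g(1) unfolding A_def by (intro bexI[of _ "s \<otimes> g"]) auto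
qed

text \<open>A nonzerodivisor modulo \<open>J\<close> avoids the minimal primes over \<open>J\<close>
  inside \<open>M\<close>, since these are associated. Every member of the sequence therefore adds a
  prime at the bottom.\<close>

lemma regular_sequence_chain:
  assumes M: "primeideal M R" and P: "primeideal P R" "P \<subseteq> M"
  shows "saturated M J \<Longrightarrow> reg M J xs \<Longrightarrow> J \<subseteq> P \<Longrightarrow> set xs \<subseteq> P \<Longrightarrow> \<exists>P0 n. prime_path P0 n P \<and> J \<subseteq> P0 \<and> length xs \<le> n"
proof (induction xs arbitrary: J)
  case Nil thus ?case using prime_path_0[OF P(1)] by auto
next
  case (Cons x xs)
  have Mc: "M \<subseteq> carrier R" using ideal_sub[OF prime_ideal[OF M]] .
  have x: "x \<in> M" "nzd J x" "reg M (sat M (insert x J)) xs" using Cons.prems by auto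
  have up: "insert x J \<subseteq> sat M (insert x J)"
    using x Mc ideal_sub[OF saturated_ideal[OF Cons.prems(1)]] by (intro sat_upper) auto
  have "sat M (insert x J) \<subseteq> P" using Cons.prems by (intro sat_least saturated_prime P) auto
  then obtain P1 n where P1: "prime_path P1 n P" "sat M (insert x J) \<subseteq> P1" "length xs \<le> n"
    using Cons.IH[OF saturated_sat x(3)] Cons.prems by auto
  have P1p: "primeideal P1 R" "P1 \<subseteq> M" using prime_path_prime[OF P1(1)] prime_path_sub[OF P1(1)] P by auto
  obtain P0 where P0: "min_over J P0" "P0 \<subseteq> P1"
    using min_over_exists[OF saturated_ideal[OF Cons.prems(1)] P1p(1)] up P1(2) by blast
  obtain b where b: "b \<in> carrier R" "b \<notin> J" "P0 = {c \<in> carrier R. c \<otimes> b \<in> J}"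
    using min_over_associated[OF Cons.prems(1) P0(1)] P0(2) P1p(2) by blast
  have "x \<notin> P0" using nzdD[OF x(2) _ b(1)] b by blast
  hence "P0 \<subset> P1" using P0(2) up P1(2) by blast
  hence "prime_path P0 (Suc n) P" using prime_path.prime_path_Suc[OF _ _ P1(1)] P0 by (simp add: min_over_def)
  thus ?case using P0 P1(3) by (intro exI[of _ P0] exI[of _ "Suc n"]) (simp add: min_over_def)
qed

end

section \<open>Colon-killers in Cohen-Macaulay rings\<close>

context noetherian_cring
begin

text \<open>\<open>c\<close> kills the defect of \<open>Xs @ [x]\<close> from being regular on
  \<open>R/E\<close> in its last step, for all sequences of length \<open>i + 1\<close> regular on
  \<open>R/Z\<close> at once. \<open>E\<close> varies because the induction passes to quotients of
  \<open>R/Z\<close>.\<close>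

definition colon_killer :: "'a set \<Rightarrow> 'a set \<Rightarrow> nat \<Rightarrow> 'a set \<Rightarrow> 'a \<Rightarrow> bool" where
  "colon_killer M Z i E c \<longleftrightarrow> (\<forall>Xs x u. reg M Z (Xs @ [x]) \<and> length Xs = i \<and> u \<in> carrier R \<and> x \<otimes> u \<in> sat M (E \<union> set Xs)
     \<longrightarrow> c \<otimes> u \<in> sat M (E \<union> set Xs))"

lemma colon_killerD:
  "colon_killer M Z i E c \<Longrightarrow> reg M Z (Xs @ [x]) \<Longrightarrow> length Xs = i \<Longrightarrow> u \<in> carrier R \<Longrightarrow> x \<otimes> u \<in> sat M (E \<union> set Xs)
     \<Longrightarrow> c \<otimes> u \<in> sat M (E \<union> set Xs)"
  by (simp add: colon_killer_def)

lemma colon_killer_mult: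
  assumes "colon_killer M Z i E c" "c \<in> carrier R" "d \<in> carrier R"
  shows "colon_killer M Z i E (d \<otimes> c)" "colon_killer M Z i E (c \<otimes> d)"
proof -
  show 1: "colon_killer M Z i E (d \<otimes> c)"
    unfolding colon_killer_def
  proof (intro allI impI, elim conjE)
    fix Xs x u assume a: "reg M Z (Xs @ [x])" "length Xs = i" "u \<in> carrier R" "x \<otimes> u \<in> sat M (E \<union> set Xs)"
    have "d \<otimes> (c \<otimes> u) \<in> sat M (E \<union> set Xs)" using ideal_mult[OF sat_ideal colon_killerD[OF assms(1) a] assms(3)] .
    thus "(d \<otimes> c) \<otimes> u \<in> sat M (E \<union> set Xs)" using assms a by (simp add: m_assoc)
  qed
  thus "colon_killer M Z i E (c \<otimes> d)" using m_comm assms by simp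
qed

lemma colon_killer_upto:
  assumes W: "\<one> \<in> W" "W \<subseteq> carrier R" "\<And>a b. a \<in> W \<Longrightarrow> b \<in> W \<Longrightarrow> a \<otimes> b \<in> W"
  shows "(\<And>j. j < i \<Longrightarrow> \<exists>c \<in> W. colon_killer M Z j E c) \<Longrightarrow> \<exists>c \<in> W. \<forall>j<i. colon_killer M Z j E c"
proof (induction i)
  case 0 thus ?case using W by auto
next
  case (Suc i)
  obtain c where c: "c \<in> W" "\<forall>j<i. colon_killer M Z j E c" using Suc by (meson less_SucI)
  obtain d where d: "d \<in> W" "colon_killer M Z i E d" using Suc.prems by blast
  have "c \<in> carrier R" "d \<in> carrier R" using c d W by auto
  hence "\<forall>j<Suc i. colon_killer M Z j E (c \<otimes> d)" using c(2) d(2) colon_killer_mult by (auto simp: less_Suc_eq)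
  thus ?case using W(3)[OF c(1) d(1)] by blast
qed

context
  fixes M Z
  assumes M: "primeideal M R" and Z: "saturated M Z"
begin

lemma M_carrier: "M \<subseteq> carrier R"
  using ideal_sub[OF prime_ideal[OF M]] .

lemma Z_carrier: "Z \<subseteq> carrier R"
  using ideal_sub[OF saturated_ideal[OF Z]] .

text \<open>If \<open>Xs\<close> were regular on \<open>R/(E + g)\<close>, the intersection of
  \<open>(g)\<close> and \<open>(Xs)\<close> modulo \<open>E\<close> would be \<open>g(Xs)\<close>.
  In general each member of \<open>Xs\<close> costs one factor \<open>c\<close>, the killer of its
  colon on \<open>R/(E + g)\<close>.\<close>

lemma kill_intersection:
  assumes E: "saturated M E" and ZE: "Z \<subseteq> E" and g: "g \<in> carrier R" and c: "c \<in> carrier R"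
  shows "reg M Z Xs \<Longrightarrow> (\<And>j. j < length Xs \<Longrightarrow> colon_killer M Z j (sat M (insert g E)) c) \<Longrightarrow>
    v \<in> sat M (insert g E) \<Longrightarrow> v \<in> sat M (E \<union> set Xs) \<Longrightarrow>
    \<exists>s \<in> carrier R - M. \<exists>r \<in> sat M (Z \<union> set Xs). s \<otimes> (c [^] length Xs \<otimes> v) \<ominus> r \<otimes> g \<in> E"
proof (induction Xs arbitrary: v rule: rev_induct)
  case Nil
  have v: "v \<in> E" "v \<in> carrier R" using Nil sat_saturated[OF E] ideal_carr[OF saturated_ideal[OF E]] by auto
  have "\<one> \<otimes> (c [^] (0::nat) \<otimes> v) \<ominus> \<zero> \<otimes> g = v" using v(2) g by (simp, algebra)
  hence "\<one> \<otimes> (c [^] (0::nat) \<otimes> v) \<ominus> \<zero> \<otimes> g \<in> E" using v(1) by (simp only:)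
  thus ?case using prime_compl_one[OF M] ideal_zero[OF sat_ideal] by (intro bexI[of _ \<one>] bexI[of _ \<zero>]) simp_all
next
  case (snoc x Y)
  let ?E' = "sat M (insert g E)" and ?N = "sat M (E \<union> set Y)" and ?N' = "sat M (insert g E \<union> set Y)"
  have Ei: "ideal E R" using E saturated_ideal by blast
  have Ec: "E \<subseteq> carrier R" using ideal_sub[OF Ei] .
  have YxM: "set (Y @ [x]) \<subseteq> M" using reg_set[OF snoc.prems(1)] .
  have YM: "set Y \<subseteq> M" and xM: "x \<in> M" using YxM by auto
  have Yc: "set Y \<subseteq> carrier R" and xc: "x \<in> carrier R" using YM xM M_carrier by auto
  have regY: "reg M Z Y" using reg_append[OF M_carrier Z YM] snoc.prems(1) by blast
  have vc: "v \<in> carrier R" using sat_carr snoc.prems(3) by blast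
  have EY: "E \<union> set Y \<subseteq> carrier R" "insert g E \<union> set Y \<subseteq> carrier R" using Ec Yc g by auto
  have "sat M (E \<union> set (Y @ [x])) = sat M (insert x ?N)" using sat_sat_insert[OF EY(1) xc, of M] by simp
  then obtain s u where s: "s \<in> carrier R - M" "u \<in> carrier R" "s \<otimes> v \<ominus> u \<otimes> x \<in> ?N"
    using snoc.prems(4) mem_sat_insert[OF M sat_ideal xc] by blast
  have sc: "s \<in> carrier R" using s by simp
  have NN': "?N \<subseteq> ?N'" by (rule sat_mono) auto
  have E'N': "?E' \<subseteq> ?N'" by (rule sat_mono) auto
  have "s \<otimes> v \<in> ?N'" using ideal_mult[OF sat_ideal snoc.prems(3) sc] E'N' by blast
  hence "u \<otimes> x \<in> ?N'" using ideal_minus_cancel'[OF sat_ideal, of "s \<otimes> v" "u \<otimes> x"] s(2,3) NN' xc by blast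
  hence "x \<otimes> u \<in> ?N'" using m_comm[OF xc s(2)] by simp
  moreover have eq1: "sat M (?E' \<union> set Y) = ?N'" using sat_sat_Un[of "insert g E" "set Y" M] Ec Yc g by simp
  ultimately have "c \<otimes> u \<in> ?N'"
    using colon_killerD[OF snoc.prems(2)[of "length Y"] snoc.prems(1) refl s(2)] by simp
  moreover have "?N' = sat M (insert g ?N)" using sat_sat_insert[OF EY(1) g, of M] by simp
  ultimately obtain t r where t: "t \<in> carrier R - M" "r \<in> carrier R" "t \<otimes> (c \<otimes> u) \<ominus> r \<otimes> g \<in> ?N"
    using mem_sat_insert[OF M sat_ideal g] by blast
  have tc: "t \<in> carrier R" using t by simp
  \<comment> \<open>Modulo \<open>E\<close> and \<open>Y\<close>, \<open>sv\<close> is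
    \<open>ux\<close> and \<open>tcu\<close> is \<open>rg\<close>. Subtracting \<open>xrg\<close>
    from \<open>tscv\<close> therefore lands in the smaller ideal without \<open>x\<close>, where
    induction applies.\<close>
  define v' where "v' = (t \<otimes> s \<otimes> c) \<otimes> v \<ominus> (x \<otimes> r) \<otimes> g"
  have "v' = (t \<otimes> c) \<otimes> (s \<otimes> v \<ominus> u \<otimes> x) \<oplus> x \<otimes> (t \<otimes> (c \<otimes> u) \<ominus> r \<otimes> g)"
    unfolding v'_def using tc sc c vc s(2) xc t(2) g by algebra
  hence v'N: "v' \<in> ?N" using ideal_comb[OF sat_ideal s(3) t(3)] tc c xc by simp
  have gE': "g \<in> ?E'" using sat_upper'[of g "insert g E"] g by simp
  have v'E': "v' \<in> ?E'" unfolding v'_def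
    using ideal_minus[OF sat_ideal ideal_mult[OF sat_ideal snoc.prems(3)] ideal_mult[OF sat_ideal gE']] tc sc c xc t(2) by simp
  obtain s2 r2 where s2: "s2 \<in> carrier R - M" "r2 \<in> sat M (Z \<union> set Y)"
    "s2 \<otimes> (c [^] length Y \<otimes> v') \<ominus> r2 \<otimes> g \<in> E"
    using snoc.IH[OF regY _ v'E' v'N] snoc.prems(2) by force
  have s2c: "s2 \<in> carrier R" and r2c: "r2 \<in> carrier R" using s2 sat_carr by auto
  have sat: "c [^] length Y \<in> carrier R" using c by simp
  define r' where "r' = (s2 \<otimes> c [^] length Y \<otimes> r) \<otimes> x \<oplus> r2"
  have "s2 \<otimes> (c [^] length Y \<otimes> v') \<ominus> r2 \<otimes> g
      = (s2 \<otimes> t \<otimes> s) \<otimes> ((c [^] length Y \<otimes> c) \<otimes> v) \<ominus> r' \<otimes> g"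
    unfolding v'_def r'_def using sat s2c r2c tc sc c vc xc t(2) g by algebra
  hence "(s2 \<otimes> t \<otimes> s) \<otimes> (c [^] length (Y @ [x]) \<otimes> v) \<ominus> r' \<otimes> g \<in> E" using s2(3) by simp
  moreover have "r' \<in> sat M (Z \<union> set (Y @ [x]))"
  proof -
    have "x \<in> sat M (Z \<union> set (Y @ [x]))" using xc by (intro sat_upper') auto
    moreover have "r2 \<in> sat M (Z \<union> set (Y @ [x]))" using s2(2) sat_mono[of "Z \<union> set Y" "Z \<union> set (Y @ [x])" M] by auto
    ultimately show ?thesis unfolding r'_def using s2c sat t(2) by (simp add: ideal_add[OF sat_ideal] ideal_mult[OF sat_ideal])
  qed
  moreover have "s2 \<otimes> t \<otimes> s \<in> carrier R - M" using prime_compl_mult[OF M] s(1) t(1) s2(1) by blast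
  ultimately show ?case by blast
qed

text \<open>Multiplication by \<open>b\<close> takes the relation into \<open>R/Z\<close>, where
  \<open>x\<close> is regular. So \<open>ub\<close> lies in \<open>Z + Xs\<close> as well as in
  \<open>Z + b\<close>, and \<open>kill_intersection\<close> frees the factor \<open>b\<close>,
  leaving \<open>c ^ i\<close> times \<open>u\<close> in \<open>P + Xs\<close>.\<close>

lemma colon_killer_annihilator:
  assumes b: "b \<in> carrier R" and P: "P = {c \<in> carrier R. c \<otimes> b \<in> Z}" and c: "c \<in> carrier R"
    and colon_killer: "\<And>j. j < i \<Longrightarrow> colon_killer M Z j (sat M (insert b Z)) c"
  shows "colon_killer M Z i P (c [^] i)"
  unfolding colon_killer_def
proof (intro allI impI, elim conjE)
  fix Xs x u assume a: "reg M Z (Xs @ [x])" "length Xs = i" "u \<in> carrier R" "x \<otimes> u \<in> sat M (P \<union> set Xs)"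
  let ?N = "sat M (Z \<union> set Xs)"
  have Zi: "ideal Z R" using Z saturated_ideal by blast
  have XM: "set Xs \<subseteq> M" and xM: "x \<in> M" using reg_set[OF a(1)] by auto
  have Xc: "set Xs \<subseteq> carrier R" and xc: "x \<in> carrier R" using XM xM M_carrier by auto
  have rX: "reg M Z Xs" "nzd ?N x" using a(1) reg_append[OF M_carrier Z XM, of "[x]"] by auto
  have up: "Z \<union> set Xs \<subseteq> ?N" by (rule sat_upper) (use Z_carrier Xc in auto)
  have "sat M (P \<union> set Xs) \<subseteq> {w \<in> carrier R. w \<otimes> b \<in> ?N}"
  proof (rule sat_least[OF colon_saturated[OF saturated_sat b]])
    have "w \<in> carrier R \<and> w \<otimes> b \<in> ?N" if "w \<in> P \<union> set Xs" for w
    proof (cases "w \<in> P")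
      case True thus ?thesis using P up by blast
    next
      case False
      hence "w \<in> set Xs" using that by simp
      hence "w \<in> ?N" "w \<in> carrier R" using up Xc by auto
      thus ?thesis using ideal_mult_right[OF sat_ideal _ b] by blast
    qed
    thus "P \<union> set Xs \<subseteq> {w \<in> carrier R. w \<otimes> b \<in> ?N}" by blast
  qed
  hence "(x \<otimes> u) \<otimes> b \<in> ?N" using a(4) by blast
  hence "x \<otimes> (u \<otimes> b) \<in> ?N" using xc a(3) b by (simp add: m_assoc)
  hence ub: "u \<otimes> b \<in> ?N" using nzdD[OF rX(2)] a(3) b by simp
  have "b \<in> sat M (insert b Z)" using b by (intro sat_upper') auto
  hence "u \<otimes> b \<in> sat M (insert b Z)" using ideal_mult[OF sat_ideal _ a(3)] by blast
  then obtain s r where s: "s \<in> carrier R - M" "r \<in> ?N" "s \<otimes> (c [^] length Xs \<otimes> (u \<otimes> b)) \<ominus> r \<otimes> b \<in> Z"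
    using kill_intersection[OF Z subset_refl b c rX(1) _ _ ub] colon_killer a(2) by blast
  have sc: "s \<in> carrier R" and rc: "r \<in> carrier R" using s sat_carr by auto
  have sat: "c [^] length Xs \<in> carrier R" using c by simp
  have "s \<otimes> (c [^] length Xs \<otimes> (u \<otimes> b)) \<ominus> r \<otimes> b = (s \<otimes> (c [^] length Xs \<otimes> u) \<ominus> r) \<otimes> b"
    using sat sc rc b a(3) by algebra
  hence "s \<otimes> (c [^] length Xs \<otimes> u) \<ominus> r \<in> P" using s(3) P sc rc sat a(3) by simp
  moreover have ZP: "Z \<subseteq> P" unfolding P using colon_carr_subset[OF Zi b] .
  ultimately have "s \<otimes> (c [^] length Xs \<otimes> u) \<ominus> r \<in> sat M (P \<union> set Xs)" "r \<in> sat M (P \<union> set Xs)"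
    using sat_upper[of "P \<union> set Xs" M] sat_mono[of "Z \<union> set Xs" "P \<union> set Xs" M] s(2) P Xc by auto
  hence "s \<otimes> (c [^] length Xs \<otimes> u) \<in> sat M (P \<union> set Xs)"
    using ideal_minus_cancel[OF sat_ideal] sc sat a(3) by blast
  hence "c [^] length Xs \<otimes> u \<in> sat M (P \<union> set Xs)" using saturatedD[OF saturated_sat _ s(1)] sat a(3) by blast
  thus "c [^] i \<otimes> u \<in> sat M (P \<union> set Xs)" using a(2) by simp
qed

text \<open>\<open>R/E\<close> is an extension of \<open>R/(E + g)\<close> by \<open>R/P\<close>,
  and each factor has its task: \<open>c\<close> kills the colon on the quotient,
  \<open>c ^ i\<close> corrects the intersection with \<open>(g)\<close>, and \<open>c2\<close>
  kills the colon on \<open>R/P\<close>, embedded by multiplication with \<open>g\<close>.\<close>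

lemma colon_killer_extension:
  assumes E: "saturated M E" and ZE: "Z \<subseteq> E" and g: "g \<in> carrier R" and c: "c \<in> carrier R" "c2 \<in> carrier R"
    and P: "P = {c \<in> carrier R. c \<otimes> g \<in> E}"
    and colon_killer: "\<And>j. j \<le> i \<Longrightarrow> colon_killer M Z j (sat M (insert g E)) c" and ckP: "colon_killer M Z i P c2"
  shows "colon_killer M Z i E (c2 \<otimes> c [^] i \<otimes> c)"
  unfolding colon_killer_def
proof (intro allI impI, elim conjE)
  fix Xs x u assume a: "reg M Z (Xs @ [x])" "length Xs = i" "u \<in> carrier R" "x \<otimes> u \<in> sat M (E \<union> set Xs)"
  let ?N = "sat M (E \<union> set Xs)" and ?E' = "sat M (insert g E)"
  have Ei: "ideal E R" using E saturated_ideal by blast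
  have Ec: "E \<subseteq> carrier R" using ideal_sub[OF Ei] .
  have XM: "set Xs \<subseteq> M" and xM: "x \<in> M" using reg_set[OF a(1)] by auto
  have Xc: "set Xs \<subseteq> carrier R" and xc: "x \<in> carrier R" using XM xM M_carrier by auto
  have rX: "reg M Z Xs" using a(1) reg_append[OF M_carrier Z XM, of "[x]"] by auto
  have EX: "E \<union> set Xs \<subseteq> carrier R" using Ec Xc by auto
  have up: "E \<union> set Xs \<subseteq> ?N" by (rule sat_upper[OF EX])
  have eq: "sat M (?E' \<union> set Xs) = sat M (insert g ?N)"
    using sat_sat_Un[of "insert g E" "set Xs" M] sat_sat_insert[OF EX g, of M] Ec Xc g by simp
  have "?N \<subseteq> sat M (insert g E \<union> set Xs)" by (rule sat_mono) auto
  hence "?N \<subseteq> sat M (?E' \<union> set Xs)" using sat_sat_Un[of "insert g E" "set Xs" M] Ec Xc g by simp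
  hence "c \<otimes> u \<in> sat M (?E' \<union> set Xs)" using colon_killerD[OF colon_killer[OF order.refl] a(1-3)] a(4) by blast
  then obtain s r where s: "s \<in> carrier R - M" "r \<in> carrier R" "s \<otimes> (c \<otimes> u) \<ominus> r \<otimes> g \<in> ?N"
    unfolding eq using mem_sat_insert[OF M sat_ideal g] by blast
  have sc: "s \<in> carrier R" using s by simp
  have "(x \<otimes> r) \<otimes> g = (s \<otimes> c) \<otimes> (x \<otimes> u) \<oplus> (\<ominus> x) \<otimes> (s \<otimes> (c \<otimes> u) \<ominus> r \<otimes> g)"
    using sc c(1) s(2) xc a(3) g by algebra
  hence v: "(x \<otimes> r) \<otimes> g \<in> ?N" using ideal_comb[OF sat_ideal a(4) s(3), of "s \<otimes> c" "\<ominus> x"] sc c xc by simp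
  have "g \<in> ?E'" using g by (intro sat_upper') auto
  hence "(x \<otimes> r) \<otimes> g \<in> ?E'" using ideal_mult[OF sat_ideal] xc s(2) by simp
  then obtain t r' where t: "t \<in> carrier R - M" "r' \<in> sat M (Z \<union> set Xs)"
    "t \<otimes> (c [^] length Xs \<otimes> ((x \<otimes> r) \<otimes> g)) \<ominus> r' \<otimes> g \<in> E"
    using kill_intersection[OF E ZE g c(1) rX _ _ v] colon_killer a(2) by force
  have tc: "t \<in> carrier R" and rc': "r' \<in> carrier R" using t sat_carr by auto
  define d where "d = c [^] i"
  have dc: "d \<in> carrier R" using c by (simp add: d_def)
  have "t \<otimes> (d \<otimes> ((x \<otimes> r) \<otimes> g)) \<ominus> r' \<otimes> g = (x \<otimes> (t \<otimes> d \<otimes> r) \<ominus> r') \<otimes> g"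
    using dc tc rc' xc s(2) g by algebra
  hence "x \<otimes> (t \<otimes> d \<otimes> r) \<ominus> r' \<in> P" using t(3) a(2) P tc dc s(2) rc' xc by (simp add: d_def)
  moreover have "Z \<subseteq> P" using ZE colon_carr_subset[OF Ei g] P by blast
  moreover have "P \<union> set Xs \<subseteq> sat M (P \<union> set Xs)" by (rule sat_upper) (use P Xc in auto)
  moreover have "sat M (Z \<union> set Xs) \<subseteq> sat M (P \<union> set Xs)" using \<open>Z \<subseteq> P\<close> by (intro sat_mono) auto
  ultimately have "x \<otimes> (t \<otimes> d \<otimes> r) \<in> sat M (P \<union> set Xs)"
    using ideal_minus_cancel[OF sat_ideal, of "x \<otimes> (t \<otimes> d \<otimes> r)" r'] t(2) xc tc dc s(2) by blast
  hence 1: "c2 \<otimes> (t \<otimes> d \<otimes> r) \<in> sat M (P \<union> set Xs)" using colon_killerD[OF ckP a(1,2)] tc dc s(2) by simp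
  have "sat M (P \<union> set Xs) \<subseteq> {w \<in> carrier R. w \<otimes> g \<in> ?N}"
  proof (rule sat_least[OF colon_saturated[OF saturated_sat g]])
    have "w \<in> carrier R \<and> w \<otimes> g \<in> ?N" if "w \<in> P \<union> set Xs" for w
    proof (cases "w \<in> P")
      case True thus ?thesis using P up by blast
    next
      case False
      hence "w \<in> set Xs" using that by simp
      hence "w \<in> ?N" "w \<in> carrier R" using up Xc by auto
      thus ?thesis using ideal_mult_right[OF sat_ideal _ g] by blast
    qed
    thus "P \<union> set Xs \<subseteq> {w \<in> carrier R. w \<otimes> g \<in> ?N}" by blast
  qed
  hence 2: "(c2 \<otimes> (t \<otimes> d \<otimes> r)) \<otimes> g \<in> ?N" using 1 by blast
  have "(t \<otimes> s) \<otimes> ((c2 \<otimes> d \<otimes> c) \<otimes> u) = (c2 \<otimes> d \<otimes> t) \<otimes> (s \<otimes> (c \<otimes> u) \<ominus> r \<otimes> g) \<oplus> \<one> \<otimes> ((c2 \<otimes> (t \<otimes> d \<otimes> r)) \<otimes> g)"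
    using c tc sc dc s(2) a(3) g by algebra
  hence "(t \<otimes> s) \<otimes> ((c2 \<otimes> d \<otimes> c) \<otimes> u) \<in> ?N"
    using ideal_comb[OF sat_ideal s(3) 2, of "c2 \<otimes> d \<otimes> t" \<one>] c dc tc by simp
  hence "(c2 \<otimes> d \<otimes> c) \<otimes> u \<in> ?N"
    using saturatedD[OF saturated_sat _ prime_compl_mult[OF M t(1) s(1)]] c dc a(3) by simp
  thus "(c2 \<otimes> c [^] i \<otimes> c) \<otimes> u \<in> ?N" by (simp add: d_def)
qed

text \<open>The multiplier \<open>w\<close> kills the submodule generated by \<open>g\<close>
  outright, so that only the colon on the quotient remains to be treated.\<close>

lemma colon_killer_extension_torsion:
  assumes E: "saturated M E" and g: "g \<in> carrier R" and c: "c \<in> carrier R" and w: "w \<in> carrier R" "w \<otimes> g \<in> E"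
    and colon_killer: "colon_killer M Z i (sat M (insert g E)) c"
  shows "colon_killer M Z i E (w \<otimes> c)"
  unfolding colon_killer_def
proof (intro allI impI, elim conjE)
  fix Xs x u assume a: "reg M Z (Xs @ [x])" "length Xs = i" "u \<in> carrier R" "x \<otimes> u \<in> sat M (E \<union> set Xs)"
  let ?N = "sat M (E \<union> set Xs)" and ?E' = "sat M (insert g E)"
  have Ec: "E \<subseteq> carrier R" using ideal_sub[OF saturated_ideal[OF E]] .
  have Xc: "set Xs \<subseteq> carrier R" using reg_set[OF a(1)] M_carrier by auto
  have EX: "E \<union> set Xs \<subseteq> carrier R" using Ec Xc by auto
  have up: "E \<union> set Xs \<subseteq> ?N" by (rule sat_upper[OF EX])
  have eq0: "sat M (?E' \<union> set Xs) = sat M (insert g E \<union> set Xs)"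
    using sat_sat_Un[of "insert g E" "set Xs" M] Ec Xc g by simp
  have eq: "sat M (?E' \<union> set Xs) = sat M (insert g ?N)" using eq0 sat_sat_insert[OF EX g, of M] by simp
  have "?N \<subseteq> sat M (insert g E \<union> set Xs)" by (rule sat_mono) auto
  hence "c \<otimes> u \<in> sat M (?E' \<union> set Xs)" using colon_killerD[OF colon_killer a(1-3)] a(4) eq0 by blast
  then obtain s r where s: "s \<in> carrier R - M" "r \<in> carrier R" "s \<otimes> (c \<otimes> u) \<ominus> r \<otimes> g \<in> ?N"
    unfolding eq using mem_sat_insert[OF M sat_ideal g] by blast
  have sc: "s \<in> carrier R" using s by simp
  have wg: "w \<otimes> g \<in> ?N" using w up by blast
  have "s \<otimes> ((w \<otimes> c) \<otimes> u) = w \<otimes> (s \<otimes> (c \<otimes> u) \<ominus> r \<otimes> g) \<oplus> r \<otimes> (w \<otimes> g)"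
    using sc c w(1) s(2) a(3) g by algebra
  hence "s \<otimes> ((w \<otimes> c) \<otimes> u) \<in> ?N" using ideal_comb[OF sat_ideal s(3) wg w(1) s(2)] by simp
  thus "(w \<otimes> c) \<otimes> u \<in> ?N" using saturatedD[OF saturated_sat _ s(1)] c w a(3) by simp
qed

text \<open>A colon-killer works uniformly for all sequences that are regular modulo \<open>Z\<close>. A prime
  filtration reduces to the cyclic modules \<open>R/P\<close> with \<open>P = Z : b\<close>; there \<open>R/P\<close> embeds into
  \<open>R/Z\<close> with cyclic cokernel, so that sequences of length \<open>i\<close> on \<open>R/P\<close> reduce to shorter
  sequences on the cokernel.\<close>

lemma uniform_colon_killer:
  assumes W: "\<one> \<in> W" "W \<subseteq> carrier R" "\<And>a b. a \<in> W \<Longrightarrow> b \<in> W \<Longrightarrow> a \<otimes> b \<in> W"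
    and good: "\<And>P. primeideal P R \<Longrightarrow> Z \<subseteq> P \<Longrightarrow> P \<subseteq> M \<Longrightarrow> P \<inter> W = {} \<Longrightarrow>
      \<exists>b \<in> carrier R. P = {c \<in> carrier R. c \<otimes> b \<in> Z}"
  shows "saturated M E \<Longrightarrow> Z \<subseteq> E \<Longrightarrow> \<exists>c \<in> W. colon_killer M Z i E c"
proof (induction i arbitrary: E rule: less_induct)
  case (less i)
  have Wpow: "c [^] (n::nat) \<in> W" if "c \<in> W" for c n
    by (induction n) (use W that in auto)
  have low: "\<exists>c \<in> W. \<forall>j<i. colon_killer M Z j E c" if "saturated M E" "Z \<subseteq> E" for E
    using colon_killer_upto[OF W] less.IH that by blast
  have "saturated M E \<longrightarrow> Z \<subseteq> E \<longrightarrow> (\<exists>c \<in> W. colon_killer M Z i E c)"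
    using saturated_ideal[OF less.prems(1)]
  proof (induction rule: noetherian_induct)
    case (step E)
    show ?case
    proof (intro impI)
      assume E: "saturated M E" and ZE: "Z \<subseteq> E"
      have Ec: "E \<subseteq> carrier R" using ideal_sub[OF step(1)] .
      show "\<exists>c \<in> W. colon_killer M Z i E c"
      proof (cases "\<one> \<in> E")
        case True
        hence "carrier R \<subseteq> sat M (E \<union> set Xs)" for Xs
          using ideal.one_imp_carrier[OF sat_ideal, of M "E \<union> set Xs"] sat_upper'[of \<one> "E \<union> set Xs" M] by simp
        hence "colon_killer M Z i E \<one>" unfolding colon_killer_def by auto
        thus ?thesis using W(1) by blast
      next
        case False
        then obtain g where g: "g \<in> carrier R" "g \<notin> E"
          "primeideal {c \<in> carrier R. c \<otimes> g \<in> E} R" "{c \<in> carrier R. c \<otimes> g \<in> E} \<subseteq> M"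
          using associated_prime_exists[OF M E one_closed] by auto
        define P where "P = {c \<in> carrier R. c \<otimes> g \<in> E}"
        let ?E' = "sat M (insert g E)"
        have up: "insert g E \<subseteq> ?E'" by (rule sat_upper) (use g Ec in auto)
        have "E \<subset> ?E'" using up g by auto
        then obtain c0 where c0: "c0 \<in> W" "colon_killer M Z i ?E' c0"
          using step(2)[OF sat_ideal] saturated_sat ZE by blast
        \<comment> \<open>The factor \<open>R/P\<close> is either killed by a multiplier in
          \<open>W\<close>, or \<open>P\<close> is one of the primes that \<open>good\<close>
          presents as annihilators modulo \<open>Z\<close>.\<close>
        show ?thesis
        proof (cases "P \<inter> W = {}")
          case False
          then obtain w where w: "w \<in> W" "w \<in> carrier R" "w \<otimes> g \<in> E" by (auto simp: P_def)
          have "colon_killer M Z i E (w \<otimes> c0)"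
            using colon_killer_extension_torsion[OF E g(1) _ w(2,3) c0(2)] c0(1) W(2) by blast
          thus ?thesis using W(3) w c0 by blast
        next
          case True
          have "Z \<subseteq> P" using ZE colon_carr_subset[OF step(1) g(1)] unfolding P_def by blast
          then obtain b where b: "b \<in> carrier R" "P = {c \<in> carrier R. c \<otimes> b \<in> Z}"
            using good[of P] g(3,4) True unfolding P_def by blast
          have Zb: "Z \<subseteq> sat M (insert b Z)" using sat_upper[of "insert b Z" M] b Z_carrier by auto
          obtain c1 where c1: "c1 \<in> W" "\<forall>j<i. colon_killer M Z j (sat M (insert b Z)) c1" using low[OF saturated_sat Zb] by blast
          have c1c: "c1 \<in> carrier R" "c0 \<in> carrier R" using c1 c0 W by auto
          have ckP: "colon_killer M Z i P (c1 [^] i)" using colon_killer_annihilator[OF b c1c(1)] c1(2) by blast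
          have ZE': "Z \<subseteq> ?E'" using ZE up by auto
          obtain c2 where c2: "c2 \<in> W" "\<forall>j<i. colon_killer M Z j ?E' c2" using low[OF saturated_sat ZE'] by blast
          have c2c: "c2 \<in> carrier R" using c2 W by auto
          define c where "c = c0 \<otimes> c2"
          have cW: "c \<in> W" "c \<in> carrier R" unfolding c_def using W c0 c2 by auto
          have "colon_killer M Z j ?E' c" if "j \<le> i" for j
            unfolding c_def using colon_killer_mult c0 c2 c1c c2c that by (cases "j = i") auto
          hence "colon_killer M Z i E (c1 [^] i \<otimes> c [^] i \<otimes> c)"
            using colon_killer_extension[OF E ZE g(1) cW(2) _ P_def _ ckP] c1c by simp
          moreover have "c1 [^] i \<otimes> c [^] i \<otimes> c \<in> W" using W(3) Wpow c1(1) cW(1) by blast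
          ultimately show ?thesis by blast
        qed
      qed
    qed
  qed
  thus ?case using less.prems by blast
qed

end

text \<open>Dividing by a maximal regular sequence \<open>zs\<close> inside \<open>K\<close> reduces
  \<open>K\<close> to height zero: its minimal primes become minimal, hence associated, over
  \<open>Z\<close>, as \<open>uniform_colon_killer\<close> requires. The \<open>xs\<close> are
  changed by elements of \<open>K\<close>, invisible modulo \<open>K\<close>, to become regular
  modulo \<open>Z\<close>.\<close>

lemma cohen_macaulay_colon_killer:
  assumes M: "primeideal M R" and K: "saturated M K" and KM: "K \<subseteq> M"
    and depth_ge: "depth_ge M (sat M {}) n" and ht: "\<And>P m. prime_path P m M \<Longrightarrow> m \<le> n"
    and equi: "\<And>P. min_over K P \<Longrightarrow> prime_path P (length xs) M" "\<And>P m. min_over K P \<Longrightarrow> prime_path P m M \<Longrightarrow> m \<le> length xs"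
    and xs: "set xs \<subseteq> M" and only: "\<And>P. primeideal P R \<Longrightarrow> K \<subseteq> P \<Longrightarrow> set xs \<subseteq> P \<Longrightarrow> P \<subseteq> M \<Longrightarrow> P = M"
  shows "\<exists>xs' c. length xs' = length xs \<and> (\<forall>i < length xs. xs' ! i \<ominus> xs ! i \<in> K) \<and> set xs' \<subseteq> M \<and>
    c \<in> carrier R \<and> (\<forall>P. min_over K P \<longrightarrow> c \<notin> P) \<and>
    (\<forall>ns Xs x u. length ns = length xs \<and> (\<forall>n \<in> set ns. 0 < n) \<and>
       mset (Xs @ [x]) = mset (map2 (\<lambda>x n. x [^] (n::nat)) xs' ns) \<and> u \<in> carrier R \<and> x \<otimes> u \<in> sat M (K \<union> set Xs)
       \<longrightarrow> c \<otimes> u \<in> sat M (K \<union> set Xs))"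
proof -
  define t where "t = length xs"
  have Mi: "ideal M R" using M prime_ideal by blast
  have Mc: "M \<subseteq> carrier R" using ideal_sub[OF Mi] .
  have Ki: "ideal K R" using K saturated_ideal by blast
  have Kc: "K \<subseteq> carrier R" using ideal_sub[OF Ki] .
  let ?D = "sat M {}"
  have DM: "?D \<subseteq> P" if "primeideal P R" "P \<subseteq> M" for P using sat_least[OF saturated_prime[OF that]] by simp
  have bound: "length zs \<le> n" if r: "reg M ?D zs" for zs
  proof -
    obtain P0 k where "prime_path P0 k M" "length zs \<le> k"
      using regular_sequence_chain[OF M M subset_refl saturated_sat r DM[OF M subset_refl] reg_set[OF r]] by auto
    thus ?thesis using ht by force
  qed
  define Q where "Q zs \<longleftrightarrow> reg M ?D zs \<and> set zs \<subseteq> K" for zs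
  have "Q []" by (simp add: Q_def)
  moreover have "\<forall>zs. Q zs \<longrightarrow> length zs < Suc n" using bound by (auto simp: Q_def le_imp_less_Suc)
  ultimately obtain zs where zs: "Q zs" and zmax: "\<And>ys. Q ys \<Longrightarrow> length ys \<le> length zs"
    using ex_has_greatest_nat[of Q "[]" length "Suc n"] by blast
  have rz: "reg M ?D zs" and zK: "set zs \<subseteq> K" using zs by (auto simp: Q_def)
  have zM: "set zs \<subseteq> M" using reg_set[OF rz] .
  define Z where "Z = sat M (?D \<union> set zs)"
  define h where "h = length zs"
  have Zs: "saturated M Z" unfolding Z_def by (rule saturated_sat)
  have Zi: "ideal Z R" using Zs saturated_ideal by blast
  have Zc: "Z \<subseteq> carrier R" using ideal_sub[OF Zi] .
  have zZ: "set zs \<subseteq> Z" unfolding Z_def using sat_upper[of "?D \<union> set zs" M] zM Mc sat_sub_carrier[of M "{}"] by auto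
  have DZ: "?D \<subseteq> Z" unfolding Z_def using sat_upper[of "?D \<union> set zs" M] zM Mc sat_sub_carrier[of M "{}"] by auto
  have ZK: "Z \<subseteq> K" unfolding Z_def using sat_least[OF K, of "{}"] zK by (intro sat_least[OF K]) auto
  have hn: "h \<le> n" using bound[OF rz] by (simp add: h_def)
  have dpZ: "depth_ge M Z (n - h)" unfolding Z_def using depth_ge_quotient_list[OF M saturated_sat rz, of "n - h"] depth_ge hn by (simp add: h_def)
  have nonzd: "\<not> nzd Z k" if k: "k \<in> K" for k
  proof
    assume "nzd Z k"
    hence "reg M ?D (zs @ [k])" using reg_append[OF Mc saturated_sat zM, of "{}" "[k]"] rz k KM unfolding Z_def by auto
    hence "Q (zs @ [k])" using zK k by (simp add: Q_def)
    thus False using zmax by fastforce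
  qed
  have chain_min: "h + t \<le> n" if p: "min_over K P" for P
  proof -
    have Pp: "primeideal P R" "K \<subseteq> P" "P \<subseteq> M" using p prime_path_sub[OF equi(1)[OF p]] by (auto simp: min_over_def)
    obtain P0 k where P0: "prime_path P0 k P" "length zs \<le> k"
      using regular_sequence_chain[OF M Pp(1,3) saturated_sat rz DM[OF Pp(1,3)]] zK Pp(2) by blast
    have "prime_path P0 (k + t) M" using prime_path_trans[OF P0(1) equi(1)[OF p]] by (simp add: t_def)
    thus ?thesis using ht P0(2) by (fastforce simp: h_def)
  qed
  \<comment> \<open>By maximality of \<open>zs\<close>, \<open>K\<close> consists of zero divisors
    modulo \<open>Z\<close> and so lies in an associated prime. Depth bounds the coheight of that
    prime below by \<open>n - h\<close>, equidimensionality bounds it above by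
    \<open>t\<close>.\<close>
  have nht: "h + t = n"
  proof -
    obtain F where F: "finite F"
      "\<forall>P \<in> F. primeideal P R \<and> P \<subseteq> M \<and> (\<exists>v \<in> carrier R. v \<notin> Z \<and> P = {c \<in> carrier R. c \<otimes> v \<in> Z})"
      "\<forall>c \<in> carrier R. (\<forall>P \<in> F. c \<notin> P) \<longrightarrow> nzd Z c"
      using finite_associated_primes[OF M Zs] by (elim exE conjE)
    have "\<exists>P \<in> F. K \<subseteq> P"
    proof (rule ccontr)
      assume "\<not> ?thesis"
      hence "\<exists>k \<in> K. \<forall>P \<in> F. \<zero> \<oplus> k \<notin> P"
        by (intro prime_avoidance[OF F(1) zero_closed Ki]) (use F(2) in simp)
      then obtain k where k: "k \<in> K" "\<forall>P \<in> F. k \<notin> P" using Kc by (metis l_zero subsetD)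
      thus False using nonzd F(3) Kc by blast
    qed
    then obtain P where P: "P \<in> F" "K \<subseteq> P" by (elim bexE)
    have Pp: "primeideal P R" using F(2) P(1) by simp
    obtain v where v: "v \<in> carrier R" "v \<notin> Z" "P = {c \<in> carrier R. c \<otimes> v \<in> Z}"
      using bspec[OF F(2) P(1)] by (elim conjE bexE)
    obtain m where m: "m \<ge> n - h" "prime_path P m M" using associated_prime_chain[OF M Zs dpZ v Pp] by (elim exE conjE)
    obtain p where p: "min_over K p" "p \<subseteq> P" using min_over_exists[OF Ki Pp P(2)] by (elim exE conjE)
    have "m \<le> t"
    proof (cases "p = P")
      case True thus ?thesis using equi(2)[OF p(1)] m by (simp add: t_def)
    next
      case False
      hence "p \<subset> P" using p(2) by auto
      hence "prime_path p (Suc m) M" using prime_path.prime_path_Suc[OF _ _ m(2)] p(1) by (simp add: min_over_def)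
      thus ?thesis using equi(2)[OF p(1)] by (fastforce simp: t_def)
    qed
    thus ?thesis using m(1) chain_min[OF p(1)] by simp
  qed
  \<comment> \<open>A prime \<open>T\<close> over \<open>Z\<close> strictly inside \<open>P\<close>
    would give a chain through \<open>T\<close> and \<open>P\<close> up to \<open>M\<close> with
    more than \<open>h + t = n\<close> steps.\<close>
  have minZ: "min_over Z P" if p: "min_over K P" for P
    unfolding min_over_def
  proof (intro conjI allI impI)
    have Pp: "primeideal P R" "K \<subseteq> P" "P \<subseteq> M" using p prime_path_sub[OF equi(1)[OF p]] by (auto simp: min_over_def)
    show "primeideal P R" "Z \<subseteq> P" using Pp ZK by auto
    fix T assume T: "primeideal T R \<and> Z \<subseteq> T \<and> T \<subseteq> P"
    show "T = P"
    proof (rule ccontr)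
      assume ne: "T \<noteq> P"
      have TM: "T \<subseteq> M" "primeideal T R" using T Pp by auto
      obtain P0 k where P0: "prime_path P0 k T" "length zs \<le> k"
        using regular_sequence_chain[OF M TM(2,1) saturated_sat rz DM[OF TM(2,1)]] zZ T by blast
      have "T \<subset> P" using T ne by auto
      from prime_path_trans[OF prime_path_trans[OF P0(1) prime_path_step[OF TM(2) Pp(1) this]] equi(1)[OF p]]
      have "k + Suc 0 + t \<le> n" using ht by (simp add: t_def)
      thus False using P0(2) nht by (simp add: h_def)
    qed
  qed
  define W where "W = {c \<in> carrier R. \<forall>P. min_over K P \<longrightarrow> c \<notin> P}"
  have mp: "primeideal P R" if "min_over K P" for P using that by (simp add: min_over_def)
  have W: "\<one> \<in> W" "W \<subseteq> carrier R" unfolding W_def using prime_one mp by auto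
  have Wm: "a \<otimes> b \<in> W" if ab: "a \<in> W" "b \<in> W" for a b
  proof -
    have "a \<otimes> b \<notin> P" if P: "min_over K P" for P
      using primeD[OF mp[OF P], of a b] ab P by (auto simp: W_def)
    thus ?thesis using ab by (simp add: W_def)
  qed
  \<comment> \<open>By prime avoidance, a prime that misses \<open>W\<close> lies in one of the
    finitely many minimal primes of \<open>K\<close>; it equals that prime, which is minimal over
    \<open>Z\<close>.\<close>
  have good: "\<exists>b \<in> carrier R. P = {c \<in> carrier R. c \<otimes> b \<in> Z}"
    if P: "primeideal P R" "Z \<subseteq> P" "P \<subseteq> M" "P \<inter> W = {}" for P
  proof -
    have "\<exists>p. min_over K p \<and> P \<subseteq> p"
    proof (rule ccontr)
      assume "\<not> ?thesis"
      hence "\<exists>k \<in> P. \<forall>p \<in> {p. min_over K p}. \<zero> \<oplus> k \<notin> p"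
        by (intro prime_avoidance[OF finite_min_over[OF Ki] zero_closed prime_ideal[OF P(1)]]) (auto simp: min_over_def)
      then obtain k where k: "k \<in> P" "\<forall>p. min_over K p \<longrightarrow> k \<notin> p"
        using ideal_carr[OF prime_ideal[OF P(1)]] by (metis l_zero mem_Collect_eq)
      hence "k \<in> W" using ideal_carr[OF prime_ideal[OF P(1)]] by (simp add: W_def)
      thus False using k P(4) by blast
    qed
    then obtain p where p: "min_over K p" "P \<subseteq> p" by (elim exE conjE)
    have "P = p" using minZ[OF p(1)] P(1,2) p(2) by (simp add: min_over_def)
    thus ?thesis using min_over_associated[OF Zs minZ[OF p(1)]] P(3) by blast
  qed
  \<comment> \<open>The index is \<open>t - 1\<close> because the sequences \<open>Xs @ [x]\<close>
    have length \<open>t\<close>; for \<open>t = 0\<close> there are none.\<close>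
  obtain c where c: "c \<in> W" "colon_killer M Z (t - 1) K c" using uniform_colon_killer[OF M Zs W Wm good K ZK] by blast
  have "k \<le> t \<Longrightarrow> \<exists>xs'. length xs' = k \<and> (\<forall>i<k. xs' ! i \<ominus> xs ! i \<in> K) \<and> reg M Z xs'" for k
  proof (induction k)
    case (Suc k)
    then obtain xs' where xs': "length xs' = k" "\<forall>i<k. xs' ! i \<ominus> xs ! i \<in> K" "reg M Z xs'" by auto
    have x'M: "set xs' \<subseteq> M" using reg_set[OF xs'(3)] .
    let ?I = "sat M (Z \<union> set xs')" and ?a = "xs ! k"
    have kx: "k < length xs" using Suc.prems by (simp add: t_def)
    have aM: "?a \<in> M" using xs nth_mem[OF kx] by auto
    have ac: "?a \<in> carrier R" using aM Mc by auto
    have up: "Z \<union> set xs' \<subseteq> ?I" by (rule sat_upper) (use Zc x'M Mc in auto)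
    have dpI: "depth_ge M ?I (t - k)" using depth_ge_quotient_list[OF M Zs xs'(3), of "t - k"] dpZ nht xs'(1) Suc.prems by auto
    obtain F where F: "finite F"
      "\<forall>P \<in> F. primeideal P R \<and> P \<subseteq> M \<and> (\<exists>v \<in> carrier R. v \<notin> ?I \<and> P = {c \<in> carrier R. c \<otimes> v \<in> ?I})"
      "\<forall>c \<in> carrier R. (\<forall>P \<in> F. c \<notin> P) \<longrightarrow> nzd ?I c"
      using finite_associated_primes[OF M saturated_sat[of M "Z \<union> set xs'"]] by (elim exE conjE)
    \<comment> \<open>A prime associated to \<open>Z + xs'\<close> has coheight at least
      \<open>t - k\<close>, whereas one that contains \<open>K\<close> and the first
      \<open>k + 1\<close> parameters has smaller coheight. So the coset of \<open>xs ! k\<close>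
      modulo \<open>K\<close> is not covered.\<close>
    have "\<not> (?a \<in> P \<and> K \<subseteq> P)" if P: "P \<in> F" for P
    proof
      assume aP: "?a \<in> P \<and> K \<subseteq> P"
      have Pp: "primeideal P R" using F(2) P by simp
      obtain v where v: "v \<in> carrier R" "v \<notin> ?I" "P = {c \<in> carrier R. c \<otimes> v \<in> ?I}"
        using bspec[OF F(2) P] by (elim conjE bexE)
      obtain m where m: "m \<ge> t - k" "prime_path P m M" using associated_prime_chain[OF M saturated_sat dpI v Pp] by (elim exE conjE)
      have IP: "?I \<subseteq> P" unfolding v(3) using colon_carr_subset[OF sat_ideal v(1)] .
      have xP: "xs ! i \<in> P" if i: "i < k" for i
      proof -
        have "xs' ! i \<in> set xs'" using i xs'(1) by simp
        hence "xs' ! i \<in> P" using up IP by blast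
        moreover have "xs' ! i \<ominus> xs ! i \<in> P" using xs'(2) i aP by blast
        moreover have "xs ! i \<in> set xs" using i kx by simp
        hence "xs ! i \<in> carrier R" using xs Mc by blast
        ultimately show ?thesis using ideal_minus_cancel'[OF prime_ideal[OF Pp]] by blast
      qed
      have "m \<le> length (drop (Suc k) xs)"
      proof (rule prime_path_length_le[OF m(2)])
        show "set (drop (Suc k) xs) \<subseteq> M" using xs set_drop_subset[of "Suc k" xs] by auto
        fix P' assume P': "primeideal P' R" "P \<subseteq> P'" "set (drop (Suc k) xs) \<subseteq> P'" "P' \<subseteq> M"
        have "y \<in> P'" if y: "y \<in> set xs" for y
        proof -
          obtain i where i: "i < length xs" "y = xs ! i" using y by (auto simp: in_set_conv_nth)
          consider "i < k" | "i = k" | "Suc k \<le> i" by linarith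
          thus ?thesis
          proof cases
            case 3
            hence "y = drop (Suc k) xs ! (i - Suc k)" "i - Suc k < length (drop (Suc k) xs)" using i by auto
            hence "y \<in> set (drop (Suc k) xs)" by (metis nth_mem)
            thus ?thesis using P'(3) by auto
          qed (use i xP aP P'(2) in auto)
        qed
        thus "P' = M" using only[OF P'(1) _ _ P'(4)] aP P'(2) by blast
      qed
      thus False using m(1) kx by (simp add: t_def)
    qed
    hence "\<exists>k' \<in> K. \<forall>P \<in> F. ?a \<oplus> k' \<notin> P"
      by (intro prime_avoidance[OF F(1) ac Ki]) (use F(2) in simp)
    then obtain k' where k': "k' \<in> K" "\<forall>P \<in> F. ?a \<oplus> k' \<notin> P" by (elim bexE)
    have k'c: "k' \<in> carrier R" using k' Kc by auto
    let ?x = "?a \<oplus> k'"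
    have "nzd ?I ?x" using F(3) k' ac k'c by simp
    moreover have "?x \<in> M" using ideal_add[OF Mi aM] k' KM by auto
    ultimately have "reg M Z (xs' @ [?x])" using reg_append[OF Mc Zs x'M] xs'(3) by simp
    moreover have "?x \<ominus> ?a = k'" using ac k'c by algebra
    hence "\<forall>i<Suc k. (xs' @ [?x]) ! i \<ominus> xs ! i \<in> K"
      using xs'(1,2) k'(1) by (auto simp: nth_append less_Suc_eq)
    ultimately show ?case using xs'(1) by (intro exI[of _ "xs' @ [?x]"]) simp
  qed simp
  then obtain xs' where xs': "length xs' = t" "\<forall>i<t. xs' ! i \<ominus> xs ! i \<in> K" "reg M Z xs'" by auto
  have "c \<otimes> u \<in> sat M (K \<union> set Xs)"
    if a: "length ns = t" "\<forall>n \<in> set ns. (0::nat) < n" "mset (Xs @ [x]) = mset (map2 (\<lambda>x n. x [^] n) xs' ns)"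
      "u \<in> carrier R" "x \<otimes> u \<in> sat M (K \<union> set Xs)" for ns Xs x u
  proof -
    have "reg M Z (map2 (\<lambda>x n. x [^] n) xs' ns @ [])"
      using reg_powers[OF M Zs, of xs' ns "[]"] xs' a(1,2) by simp
    hence "reg M Z (Xs @ [x])" using reg_perm[OF M Zs] a(3) by (metis append_Nil2)
    moreover have "length Xs = t - 1" using arg_cong[OF a(3), of size] xs'(1) a(1) by simp
    ultimately show ?thesis using colon_killerD[OF c(2)] a(4,5) by blast
  qed
  thus ?thesis using xs' c(1) reg_set[OF xs'(3)] unfolding t_def[symmetric] W_def
    by (intro exI[of _ xs'] exI[of _ c]) auto
qed

end

section \<open>Frobenius powers and tight closure\<close>

context cring
begin

text \<open>Multiplying by \<open>a\<close> and by \<open>b\<close> gives the sums of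
  \<open>A\<close> and \<open>B\<close>, which Pascal's rule combines after a shift of index; the
  term of \<open>B\<close> at \<open>Suc n\<close> vanishes.\<close>

lemma binomial_expansion:
  assumes a: "a \<in> carrier R" and b: "b \<in> carrier R"
  shows "(a \<oplus> b) [^] n = (\<Oplus>k\<in>{..n}. [(n choose k)] \<cdot> (a [^] k \<otimes> b [^] (n - k)))"
proof (induction n)
  case 0 thus ?case using a b by simp
next
  case (Suc n)
  define f where "f k = [(n choose k)] \<cdot> (a [^] k \<otimes> b [^] (n - k))" for k
  define A where "A k = [(n choose k)] \<cdot> (a [^] Suc k \<otimes> b [^] (n - k))" for k
  define B where "B k = [(n choose k)] \<cdot> (a [^] k \<otimes> b [^] (Suc n - k))" for k
  have fc: "f k \<in> carrier R" "A k \<in> carrier R" "B k \<in> carrier R" for k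
    using a b by (auto simp: f_def A_def B_def)
  have "(\<Oplus>k\<in>{..n}. f k) \<otimes> a = (\<Oplus>k\<in>{..n}. f k \<otimes> a)"
    using finsum_ldistr[of "{..n}" a f] a fc by auto
  also have "\<dots> = (\<Oplus>k\<in>{..n}. A k)"
  proof (rule add.finprod_cong')
    fix k show "f k \<otimes> a = A k" unfolding f_def A_def
      using a b by (simp add: add_pow_ldistr add_pow_rdistr m_ac)
  qed (use fc in auto)
  finally have Sa: "(\<Oplus>k\<in>{..n}. f k) \<otimes> a = (\<Oplus>k\<in>{..n}. A k)" .
  have "(\<Oplus>k\<in>{..n}. f k) \<otimes> b = (\<Oplus>k\<in>{..n}. f k \<otimes> b)"
    using finsum_ldistr[of "{..n}" b f] b fc by auto
  also have "\<dots> = (\<Oplus>k\<in>{..n}. B k)"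
  proof (rule add.finprod_cong')
    fix k assume k: "k \<in> {..n}"
    show "f k \<otimes> b = B k" unfolding f_def B_def
      using a b k by (simp add: add_pow_ldistr m_assoc Suc_diff_le)
  qed (use fc in auto)
  finally have Sb: "(\<Oplus>k\<in>{..n}. f k) \<otimes> b = (\<Oplus>k\<in>{..n}. B k)" .
  have "B (Suc n) = \<zero>" by (simp add: B_def binomial_eq_0)
  hence "(\<Oplus>k\<in>{..n}. B k) = (\<Oplus>k\<in>{..Suc n}. B k)"
    using finsum_Suc[of B n] fc by (simp add: Pi_def)
  also have "\<dots> = (\<Oplus>k\<in>{..n}. B (Suc k)) \<oplus> B 0" using finsum_Suc2[of B n] fc by (simp add: Pi_def)
  finally have Bs: "(\<Oplus>k\<in>{..n}. B k) = (\<Oplus>k\<in>{..n}. B (Suc k)) \<oplus> B 0" .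
  define h where "h k = [(Suc n choose k)] \<cdot> (a [^] k \<otimes> b [^] (Suc n - k))" for k
  have hc: "h k \<in> carrier R" for k using a b by (simp add: h_def)
  have hAB: "h (Suc k) = A k \<oplus> B (Suc k)" for k
    unfolding h_def A_def B_def using a b by (simp add: add.nat_pow_mult)
  have "(\<Oplus>k\<in>{..Suc n}. h k) = (\<Oplus>k\<in>{..n}. h (Suc k)) \<oplus> h 0"
    using finsum_Suc2[of h n] hc by (simp add: Pi_def)
  also have "(\<Oplus>k\<in>{..n}. h (Suc k)) = (\<Oplus>k\<in>{..n}. A k) \<oplus> (\<Oplus>k\<in>{..n}. B (Suc k))"
    unfolding hAB using add.finprod_multf[of A "{..n}" "\<lambda>k. B (Suc k)"] fc by auto
  also have "h 0 = B 0" by (simp add: h_def B_def)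
  finally have "(\<Oplus>k\<in>{..Suc n}. h k) = (\<Oplus>k\<in>{..n}. A k) \<oplus> (\<Oplus>k\<in>{..n}. B k)"
    using Bs fc by (simp add: a_assoc)
  also have "\<dots> = (\<Oplus>k\<in>{..n}. f k) \<otimes> (a \<oplus> b)"
    using Sa Sb a b fc by (simp add: r_distr)
  also have "\<dots> = (a \<oplus> b) [^] Suc n" using Suc by (simp add: f_def)
  finally show ?case by (simp add: h_def)
qed

end

locale char_p_cring = cring +
  fixes p :: nat
  assumes p_prime: "Factorial_Ring.prime p" and char_p: "[p] \<cdot> \<one> = \<zero>"
begin

lemma p_mult_zero: "x \<in> carrier R \<Longrightarrow> p dvd n \<Longrightarrow> [n] \<cdot> x = \<zero>"
proof -
  assume x: "x \<in> carrier R" and "p dvd n"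
  then obtain m where m: "n = p * m" by auto
  have "[p] \<cdot> x = ([p] \<cdot> \<one>) \<otimes> x" using x add_pow_ldistr[of \<one> x p] by simp
  hence "[p] \<cdot> x = \<zero>" using char_p x by simp
  thus ?thesis using x add.nat_pow_pow[of x m p] m by simp
qed

lemma frobenius_p:
  assumes a: "a \<in> carrier R" and b: "b \<in> carrier R"
  shows "(a \<oplus> b) [^] p = a [^] p \<oplus> b [^] p"
proof -
  have p: "0 < p" using p_prime prime_gt_0_nat by blast
  then obtain n where n: "p = Suc n" using gr0_implies_Suc by blast
  define h where "h k = [(p choose k)] \<cdot> (a [^] k \<otimes> b [^] (p - k))" for k
  have hc: "h k \<in> carrier R" for k using a b by (simp add: h_def)
  have mid: "h (Suc k) = \<zero>" if "k < n" for k
  proof -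
    have "p dvd (p choose Suc k)" using dvd_choose_prime[of "Suc k" p] that p_prime n by auto
    thus ?thesis unfolding h_def using p_mult_zero a b by simp
  qed
  have "(a \<oplus> b) [^] p = (\<Oplus>k\<in>{..Suc n}. h k)" using binomial_expansion[OF a b, of p] n by (simp add: h_def)
  also have "\<dots> = (\<Oplus>k\<in>{..n}. h (Suc k)) \<oplus> h 0"
    using finsum_Suc2[of h n] hc by (simp add: Pi_def)
  also have "(\<Oplus>k\<in>{..n}. h (Suc k)) = h (Suc n)"
  proof (cases n)
    case 0 thus ?thesis using hc by simp
  next
    case (Suc m)
    have "(\<Oplus>k\<in>{..m}. h (Suc k)) = \<zero>"
      by (rule add.finprod_one_eqI) (use mid Suc in auto)
    thus ?thesis using Suc finsum_Suc[of "\<lambda>k. h (Suc k)" m] hc by (simp add: Pi_def)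
  qed
  also have "h (Suc n) = a [^] p" using n a by (simp add: h_def)
  also have "h 0 = b [^] p" using b by (simp add: h_def)
  finally show ?thesis .
qed

lemma frobenius:
  assumes a: "a \<in> carrier R" and b: "b \<in> carrier R"
  shows "(a \<oplus> b) [^] (p ^ e) = a [^] (p ^ e) \<oplus> b [^] (p ^ e)"
proof (induction e)
  case (Suc e)
  have "(a \<oplus> b) [^] (p ^ Suc e) = ((a \<oplus> b) [^] (p ^ e)) [^] p" using a b by (simp add: nat_pow_pow mult.commute)
  also have "\<dots> = (a [^] (p ^ e)) [^] p \<oplus> (b [^] (p ^ e)) [^] p" using Suc frobenius_p a b by simp
  finally show ?case using a b by (simp add: nat_pow_pow mult.commute)
qed (use a b in simp)

lemma p_power_pos: "0 < p ^ e"
  using p_prime prime_gt_0_nat by simp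

text \<open>Additivity of the Frobenius map is what makes this an ideal; claims about the powers of
  all elements of an ideal can then be tested on generators.\<close>

lemma frobenius_preimage_ideal:
  assumes K: "ideal K R" shows "ideal {u \<in> carrier R. u [^] (p ^ e) \<in> K} R"
proof (rule cring_idealI)
  have "\<zero> [^] (p ^ e) = \<zero>" using nat_pow_zero[of "p ^ e"] p_power_pos[of e] by simp
  thus "\<zero> \<in> {u \<in> carrier R. u [^] (p ^ e) \<in> K}" using ideal_zero[OF K] by simp
  show "a \<oplus> b \<in> {u \<in> carrier R. u [^] (p ^ e) \<in> K}"
    if "a \<in> {u \<in> carrier R. u [^] (p ^ e) \<in> K}" "b \<in> {u \<in> carrier R. u [^] (p ^ e) \<in> K}" for a b
    using that ideal_add[OF K] by (simp add: frobenius)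
  show "r \<otimes> a \<in> {u \<in> carrier R. u [^] (p ^ e) \<in> K}"
    if "a \<in> {u \<in> carrier R. u [^] (p ^ e) \<in> K}" "r \<in> carrier R" for a r
    using that ideal_mult[OF K] by (simp add: nat_pow_distrib)
qed auto

lemma frobenius_Idl:
  assumes T: "T \<subseteq> carrier R" and K: "ideal K R" and TK: "\<And>u. u \<in> T \<Longrightarrow> u [^] (p ^ e) \<in> K" and u: "u \<in> Idl T"
  shows "u [^] (p ^ e) \<in> K"
proof -
  have "Idl T \<subseteq> {u \<in> carrier R. u [^] (p ^ e) \<in> K}"
    by (rule genideal_minimal[OF frobenius_preimage_ideal[OF K]]) (use T TK in auto)
  thus ?thesis using u by blast
qed

end

section \<open>Frobenius powers of ideals and tight closure\<close>

context cring
begin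

lemma frob_power_ideal: "J \<subseteq> carrier R \<Longrightarrow> ideal (frob_power R J q) R"
  unfolding frob_power_def by (rule genideal_ideal) auto

lemma frob_power_mem: "J \<subseteq> carrier R \<Longrightarrow> u \<in> J \<Longrightarrow> u [^] q \<in> frob_power R J q"
  unfolding frob_power_def by (rule subsetD[OF genideal_self]) auto

lemma frob_power_least: "ideal K R \<Longrightarrow> (\<And>u. u \<in> J \<Longrightarrow> u [^] q \<in> K) \<Longrightarrow> frob_power R J q \<subseteq> K"
  unfolding frob_power_def by (rule genideal_minimal) auto

lemma frob_power_mono: "J \<subseteq> J' \<Longrightarrow> J' \<subseteq> carrier R \<Longrightarrow> frob_power R J q \<subseteq> frob_power R J' q"
  by (rule frob_power_least[OF frob_power_ideal]) (auto intro: frob_power_mem)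

lemma tight_closure_mono:
  assumes "J \<subseteq> J'" "J' \<subseteq> carrier R" shows "tight_closure R p J \<subseteq> tight_closure R p J'"
  unfolding tight_closure_def using frob_power_mono[OF assms] by blast

lemma tight_closure_carrier: "tight_closure R p J \<subseteq> carrier R"
  by (auto simp: tight_closure_def)

lemma ring_zero_compl_one: "\<one> \<in> ring_zero_compl R"
  unfolding ring_zero_compl_def using prime_one by (auto simp: minimal_prime_def)

lemma ring_zero_compl_mult:
  assumes "a \<in> ring_zero_compl R" "b \<in> ring_zero_compl R" shows "a \<otimes> b \<in> ring_zero_compl R"
proof -
  have ab: "a \<in> carrier R" "b \<in> carrier R" using assms by (auto simp: ring_zero_compl_def)
  have "a \<otimes> b \<notin> P" if P: "minimal_prime R P" for P
  proof -
    have "primeideal P R" using P by (simp add: minimal_prime_def)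
    moreover have "a \<notin> P" "b \<notin> P" using assms P by (auto simp: ring_zero_compl_def)
    ultimately show ?thesis using primeD ab by blast
  qed
  thus ?thesis using ab by (auto simp: ring_zero_compl_def)
qed

lemma subset_tight_closure:
  assumes J: "J \<subseteq> carrier R" shows "J \<subseteq> tight_closure R p J"
proof
  fix u assume u: "u \<in> J"
  have "\<one> \<otimes> u [^] (p ^ e) \<in> frob_power R J (p ^ e)" for e
    using frob_power_mem[OF J u, of "p ^ e"] J u by auto
  thus "u \<in> tight_closure R p J"
    unfolding tight_closure_def using ring_zero_compl_one u J by blast
qed

text \<open>The multiplier of \<open>u\<close> is kept: its test at exponent \<open>e + k\<close>
  becomes the test of the power at exponent \<open>k\<close>, since the Frobenius power of exponent
  \<open>e + k\<close> lies in the iterated one.\<close>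

lemma power_tight_closure:
  assumes J: "J \<subseteq> carrier R" and u: "u \<in> tight_closure R p J"
  shows "u [^] (p ^ e) \<in> tight_closure R p (frob_power R J (p ^ e))"
proof -
  obtain c N where c: "c \<in> ring_zero_compl R" "u \<in> carrier R"
    "\<And>e. e \<ge> N \<Longrightarrow> c \<otimes> u [^] (p ^ e) \<in> frob_power R J (p ^ e)"
    using u unfolding tight_closure_def by blast
  let ?F = "frob_power R J (p ^ e)"
  have F: "?F \<subseteq> carrier R" using ideal_sub[OF frob_power_ideal[OF J]] .
  have "c \<otimes> (u [^] (p ^ e)) [^] (p ^ k) \<in> frob_power R ?F (p ^ k)" if k: "k \<ge> N" for k
  proof -
    have "frob_power R J (p ^ (e + k)) \<subseteq> frob_power R ?F (p ^ k)"
    proof (rule frob_power_least[OF frob_power_ideal[OF F]])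
      fix v assume v: "v \<in> J"
      have "(v [^] (p ^ e)) [^] (p ^ k) \<in> frob_power R ?F (p ^ k)"
        using frob_power_mem[OF F frob_power_mem[OF J v]] .
      thus "v [^] (p ^ (e + k)) \<in> frob_power R ?F (p ^ k)" using v J by (simp add: nat_pow_pow power_add subset_iff)
    qed
    moreover have "c \<otimes> u [^] (p ^ (e + k)) \<in> frob_power R J (p ^ (e + k))" using c(3) k by simp
    ultimately show ?thesis using c(2) by (auto simp: nat_pow_pow power_add)
  qed
  thus ?thesis unfolding tight_closure_def using c(1,2) by blast
qed

end

text \<open>Locality at \<open>M\<close> enters as saturation of all ideals, the form in which
  \<open>nakayama\<close> uses it.\<close>

locale char_p_local = noetherian_cring + char_p_cring +
  fixes M :: "'a set"
  assumes M: "primeideal M R" and saturated: "\<And>J. ideal J R \<Longrightarrow> saturated M J"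
begin

text \<open>An element of the tight closure of \<open>(Xs)\<close> has the form
  \<open>v + yw\<close> with \<open>v\<close> in \<open>(Xs)\<close>. Frobenius separates the
  summands and the uniform multiplier \<open>c\<close> cancels the powers of \<open>y\<close>, so
  \<open>w\<close> is again in the tight closure and Nakayama's lemma finishes. Started from
  \<open>yw\<close> in \<open>(Xs)\<close>, the same cancellation shows that \<open>y\<close> is
  regular modulo \<open>(Xs)\<close>.\<close>

lemma tight_closure_delete:
  assumes Xs: "set Xs \<subseteq> carrier R" and y: "y \<in> M" and c: "c \<in> ring_zero_compl R"
    and colon_killer: "\<And>e u. u \<in> carrier R \<Longrightarrow> y [^] (p ^ e) \<otimes> u \<in> Idl ((\<lambda>x. x [^] (p ^ e)) ` set Xs) \<Longrightarrow>
      c \<otimes> u \<in> Idl ((\<lambda>x. x [^] (p ^ e)) ` set Xs)"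
    and closed: "tight_closure R p (Idl (insert y (set Xs))) = Idl (insert y (set Xs))"
  shows "tight_closure R p (Idl (set Xs)) = Idl (set Xs)"
    and "w \<in> carrier R \<Longrightarrow> y \<otimes> w \<in> Idl (set Xs) \<Longrightarrow> w \<in> Idl (set Xs)"
proof -
  let ?J = "Idl (set Xs)"
  have yc: "y \<in> carrier R" using y ideal_carr[OF prime_ideal[OF M]] by blast
  have cc: "c \<in> carrier R" using c by (simp add: ring_zero_compl_def)
  have Ji: "ideal ?J R" using genideal_ideal[OF Xs] .
  have Jc: "?J \<subseteq> carrier R" using ideal_sub[OF Ji] .
  have yX: "insert y (set Xs) \<subseteq> carrier R" using Xs yc by simp
  have frobJ: "frob_power R ?J (p ^ e) = Idl ((\<lambda>x. x [^] (p ^ e)) ` set Xs)" for e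
  proof
    have im: "(\<lambda>x. x [^] (p ^ e)) ` set Xs \<subseteq> carrier R" using Xs by auto
    show "frob_power R ?J (p ^ e) \<subseteq> Idl ((\<lambda>x. x [^] (p ^ e)) ` set Xs)"
      by (rule frob_power_least[OF genideal_ideal[OF im]], rule frobenius_Idl[OF Xs genideal_ideal[OF im]])
        (use genideal_self[OF im] in auto)
    show "Idl ((\<lambda>x. x [^] (p ^ e)) ` set Xs) \<subseteq> frob_power R ?J (p ^ e)"
      by (rule genideal_minimal[OF frob_power_ideal[OF Jc]])
        (use genideal_self[OF Xs] frob_power_mem[OF Jc] in auto)
  qed
  have step: "w \<in> tight_closure R p ?J"
    if w: "w \<in> carrier R" and d: "d \<in> ring_zero_compl R"
      "\<And>e. e \<ge> N \<Longrightarrow> d \<otimes> (y \<otimes> w) [^] (p ^ e) \<in> frob_power R ?J (p ^ e)" for w d N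
  proof -
    have dc: "d \<in> carrier R" using d by (simp add: ring_zero_compl_def)
    have "(c \<otimes> d) \<otimes> w [^] (p ^ e) \<in> frob_power R ?J (p ^ e)" if e: "e \<ge> N" for e
    proof -
      have "d \<otimes> (y \<otimes> w) [^] (p ^ e) = y [^] (p ^ e) \<otimes> (d \<otimes> w [^] (p ^ e))"
        using dc yc w by (simp add: nat_pow_distrib m_lcomm)
      hence "y [^] (p ^ e) \<otimes> (d \<otimes> w [^] (p ^ e)) \<in> Idl ((\<lambda>x. x [^] (p ^ e)) ` set Xs)"
        using d(2)[OF e] frobJ by simp
      hence "c \<otimes> (d \<otimes> w [^] (p ^ e)) \<in> frob_power R ?J (p ^ e)" using colon_killer[of "d \<otimes> w [^] (p ^ e)" e] frobJ dc w by simp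
      thus ?thesis using cc dc w by (simp add: m_assoc)
    qed
    thus ?thesis unfolding tight_closure_def using w ring_zero_compl_mult[OF c d(1)] by blast
  qed
  have "tight_closure R p ?J \<subseteq> ?J"
  proof (rule nakayama[OF M saturated[OF Ji] tight_closure_carrier])
    fix E assume E: "saturated M E" "?J \<subseteq> E" "\<And>q u. q \<in> M \<Longrightarrow> u \<in> tight_closure R p ?J \<Longrightarrow> q \<otimes> u \<in> E"
    have Ei: "ideal E R" using E saturated_ideal by blast
    show "tight_closure R p ?J \<subseteq> E"
    proof
      fix u assume u: "u \<in> tight_closure R p ?J"
      have uc: "u \<in> carrier R" using u tight_closure_carrier by blast
      have "?J \<subseteq> Idl (insert y (set Xs))"
        using genideal_minimal[OF genideal_ideal[OF yX]] genideal_self[OF yX] by auto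
      hence "u \<in> Idl (insert y (set Xs))"
        using u tight_closure_mono[OF _ ideal_sub[OF genideal_ideal[OF yX]]] closed by blast
      moreover have "Idl (insert y (set Xs)) \<subseteq> {k \<in> carrier R. \<exists>r \<in> carrier R. k \<ominus> r \<otimes> y \<in> ?J}"
      proof (rule genideal_minimal[OF ideal_insert[OF Ji yc]])
        have "y \<ominus> \<one> \<otimes> y = \<zero>" using yc by algebra
        hence "y \<ominus> \<one> \<otimes> y \<in> ?J" using ideal_zero[OF Ji] by (simp only:)
        hence 1: "y \<in> {k \<in> carrier R. \<exists>r \<in> carrier R. k \<ominus> r \<otimes> y \<in> ?J}" using yc by blast
        have 2: "x \<in> {k \<in> carrier R. \<exists>r \<in> carrier R. k \<ominus> r \<otimes> y \<in> ?J}" if x: "x \<in> set Xs" for x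
        proof -
          have xc: "x \<in> carrier R" using x Xs by blast
          have "x \<ominus> \<zero> \<otimes> y = x" using xc yc by algebra
          hence "x \<ominus> \<zero> \<otimes> y \<in> ?J" using x genideal_self[OF Xs] by (simp only: subset_iff)
          thus ?thesis using xc by blast
        qed
        show "insert y (set Xs) \<subseteq> {k \<in> carrier R. \<exists>r \<in> carrier R. k \<ominus> r \<otimes> y \<in> ?J}" using 1 2 by blast
      qed
      ultimately obtain w where w: "w \<in> carrier R" "u \<ominus> w \<otimes> y \<in> ?J" by blast
      define v where "v = u \<ominus> w \<otimes> y"
      have vc: "v \<in> carrier R" and vJ: "v \<in> ?J" using w uc yc by (simp_all add: v_def)
      obtain d N where d: "d \<in> ring_zero_compl R"
        "\<And>e. e \<ge> N \<Longrightarrow> d \<otimes> u [^] (p ^ e) \<in> frob_power R ?J (p ^ e)"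
        using u unfolding tight_closure_def by blast
      have dc: "d \<in> carrier R" using d by (simp add: ring_zero_compl_def)
      have "d \<otimes> (y \<otimes> w) [^] (p ^ e) \<in> frob_power R ?J (p ^ e)" if e: "e \<ge> N" for e
      proof -
        have Fi: "ideal (frob_power R ?J (p ^ e)) R" using frob_power_ideal[OF Jc] .
        have "u = v \<oplus> y \<otimes> w" unfolding v_def using uc w(1) yc by algebra
        hence eq: "u [^] (p ^ e) = v [^] (p ^ e) \<oplus> (y \<otimes> w) [^] (p ^ e)" using frobenius vc yc w by simp
        have pc: "v [^] (p ^ e) \<in> carrier R" "(y \<otimes> w) [^] (p ^ e) \<in> carrier R" using vc yc w by auto
        have "d \<otimes> (y \<otimes> w) [^] (p ^ e) = \<one> \<otimes> (d \<otimes> u [^] (p ^ e)) \<oplus> (\<ominus> d) \<otimes> v [^] (p ^ e)"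
          unfolding eq using pc dc by algebra
        thus ?thesis using ideal_comb[OF Fi d(2)[OF e] frob_power_mem[OF Jc vJ], of \<one> "\<ominus> d"] dc by simp
      qed
      hence "w \<in> tight_closure R p ?J" by (rule step[OF w(1) d(1)])
      hence "y \<otimes> w \<in> E" using E(3)[OF y] by blast
      hence "w \<otimes> y \<in> E" using m_comm[OF yc w(1)] by simp
      thus "u \<in> E" using ideal_minus_cancel[OF Ei, of u "w \<otimes> y"] w(2) E(2) uc by blast
    qed
  qed
  thus sat: "tight_closure R p ?J = ?J" using subset_tight_closure[OF Jc, of p] by blast
  show "w \<in> ?J" if w: "w \<in> carrier R" "y \<otimes> w \<in> ?J"
  proof -
    have "\<one> \<otimes> (y \<otimes> w) [^] (p ^ e) \<in> frob_power R ?J (p ^ e)" for e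
      using frob_power_mem[OF Jc w(2)] yc w(1) by simp
    hence "w \<in> tight_closure R p ?J" using step[OF w(1) ring_zero_compl_one, of 0] by blast
    thus ?thesis using sat by simp
  qed
qed

text \<open>Multiplication by \<open>x\<close> carries the tight closure for exponent
  \<open>k\<close> into the tightly closed ideal for \<open>k + 1\<close>. Dividing by
  \<open>x\<close> again is possible because \<open>x ^ (k + 1)\<close> is regular modulo
  \<open>(Xs)\<close> by \<open>tight_closure_delete\<close>.\<close>

lemma tight_closure_lower_exponent:
  assumes Xs: "set Xs \<subseteq> carrier R" and x: "x \<in> M" and k: "0 < (k::nat)" and c: "c \<in> ring_zero_compl R"
    and colon_killer: "\<And>e u. u \<in> carrier R \<Longrightarrow> (x [^] Suc k) [^] (p ^ e) \<otimes> u \<in> Idl ((\<lambda>x. x [^] (p ^ e)) ` set Xs) \<Longrightarrow>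
      c \<otimes> u \<in> Idl ((\<lambda>x. x [^] (p ^ e)) ` set Xs)"
    and closed: "tight_closure R p (Idl (insert (x [^] Suc k) (set Xs))) = Idl (insert (x [^] Suc k) (set Xs))"
  shows "tight_closure R p (Idl (insert (x [^] k) (set Xs))) = Idl (insert (x [^] k) (set Xs))"
proof -
  let ?J = "Idl (set Xs)" and ?y = "x [^] Suc k"
  let ?K = "Idl (insert (x [^] k) (set Xs))" and ?L = "Idl (insert ?y (set Xs))"
  have xc: "x \<in> carrier R" using x ideal_carr[OF prime_ideal[OF M]] by blast
  have yc: "?y \<in> carrier R" using xc by simp
  have yM: "?y \<in> M" using ideal_pow_mem[OF prime_ideal[OF M] x] by blast
  have Ji: "ideal ?J R" using genideal_ideal[OF Xs] .
  have kX: "insert (x [^] k) (set Xs) \<subseteq> carrier R" and yX: "insert ?y (set Xs) \<subseteq> carrier R" using Xs xc by auto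
  have Ki: "ideal ?K R" and Li: "ideal ?L R" using genideal_ideal[OF kX] genideal_ideal[OF yX] by auto
  have Kc: "?K \<subseteq> carrier R" and Lc: "?L \<subseteq> carrier R" using ideal_sub Ki Li by auto
  have "u \<in> ?K" if u: "u \<in> tight_closure R p ?K" for u
  proof -
    have uc: "u \<in> carrier R" using u tight_closure_carrier by blast
    obtain d N where d: "d \<in> ring_zero_compl R"
      "\<And>e. e \<ge> N \<Longrightarrow> d \<otimes> u [^] (p ^ e) \<in> frob_power R ?K (p ^ e)"
      using u unfolding tight_closure_def by blast
    have dc: "d \<in> carrier R" using d by (simp add: ring_zero_compl_def)
    have "d \<otimes> (x \<otimes> u) [^] (p ^ e) \<in> frob_power R ?L (p ^ e)" if e: "e \<ge> N" for e
    proof -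
      let ?C = "{w \<in> carrier R. w \<otimes> x [^] (p ^ e) \<in> frob_power R ?L (p ^ e)}"
      have Fi: "ideal (frob_power R ?L (p ^ e)) R" using frob_power_ideal[OF Lc] .
      have Ci: "ideal ?C R" using colon_ideal[OF Fi] xc by simp
      have gens: "z \<otimes> x \<in> ?L" if z: "z \<in> insert (x [^] k) (set Xs)" for z
      proof (cases "z = x [^] k")
        case True thus ?thesis using genideal_self[OF yX] by auto
      next
        case False
        hence "z \<in> ?L" using z genideal_self[OF yX] by auto
        thus ?thesis using ideal_mult_right[OF Li _ xc] by blast
      qed
      have "frob_power R ?K (p ^ e) \<subseteq> ?C"
      proof (rule frob_power_least[OF Ci], rule frobenius_Idl[OF kX Ci])
        fix z assume z: "z \<in> insert (x [^] k) (set Xs)"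
        have zc: "z \<in> carrier R" using z kX by blast
        have "(z \<otimes> x) [^] (p ^ e) \<in> frob_power R ?L (p ^ e)" using frob_power_mem[OF Lc gens[OF z]] .
        thus "z [^] (p ^ e) \<in> ?C" using zc xc by (simp add: nat_pow_distrib)
      qed
      hence "(d \<otimes> u [^] (p ^ e)) \<otimes> x [^] (p ^ e) \<in> frob_power R ?L (p ^ e)" using d(2)[OF e] by blast
      thus ?thesis using dc uc xc by (simp add: nat_pow_distrib m_ac)
    qed
    hence "x \<otimes> u \<in> tight_closure R p ?L" unfolding tight_closure_def using d(1) xc uc by blast
    hence "x \<otimes> u \<in> ?L" using closed by simp
    moreover have "?L \<subseteq> {z \<in> carrier R. \<exists>r \<in> carrier R. z \<ominus> r \<otimes> ?y \<in> ?J}"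
    proof (rule genideal_minimal[OF ideal_insert[OF Ji yc]])
      have "?y \<ominus> \<one> \<otimes> ?y = \<zero>" using yc by algebra
      hence "?y \<ominus> \<one> \<otimes> ?y \<in> ?J" using ideal_zero[OF Ji] by (simp only:)
      hence 1: "?y \<in> {z \<in> carrier R. \<exists>r \<in> carrier R. z \<ominus> r \<otimes> ?y \<in> ?J}" using yc by blast
      have 2: "z \<in> {z \<in> carrier R. \<exists>r \<in> carrier R. z \<ominus> r \<otimes> ?y \<in> ?J}" if z: "z \<in> set Xs" for z
      proof -
        have zc: "z \<in> carrier R" using z Xs by blast
        have "z \<ominus> \<zero> \<otimes> ?y = z" using zc yc by algebra
        hence "z \<ominus> \<zero> \<otimes> ?y \<in> ?J" using z genideal_self[OF Xs] by (simp only: subset_iff)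
        thus ?thesis using zc by blast
      qed
      show "insert ?y (set Xs) \<subseteq> {z \<in> carrier R. \<exists>r \<in> carrier R. z \<ominus> r \<otimes> ?y \<in> ?J}" using 1 2 by blast
    qed
    ultimately obtain r where r: "r \<in> carrier R" "x \<otimes> u \<ominus> r \<otimes> ?y \<in> ?J" by blast
    have xk: "x [^] k \<in> carrier R" using xc by simp
    define w where "w = u \<ominus> r \<otimes> x [^] k"
    have wc: "w \<in> carrier R" using uc r xk by (simp add: w_def)
    \<comment> \<open>The relation for \<open>xw\<close> is multiplied by \<open>x ^ k\<close>,
      since regularity is known for \<open>x ^ (k + 1)\<close>.\<close>
    have "?y \<otimes> w = x [^] k \<otimes> (x \<otimes> u \<ominus> r \<otimes> (x [^] k \<otimes> x))"
      unfolding w_def nat_pow_Suc using xk xc uc r(1) by algebra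
    hence "?y \<otimes> w \<in> ?J" using ideal_mult[OF Ji r(2) xk] by simp
    hence "w \<in> ?J" using tight_closure_delete(2)[OF Xs yM c colon_killer closed wc] by blast
    moreover have "?J \<subseteq> ?K" using genideal_minimal[OF Ki] genideal_self[OF kX] by auto
    moreover have "r \<otimes> x [^] k \<in> ?K" using ideal_mult[OF Ki _ r(1)] genideal_self[OF kX] by auto
    ultimately show "u \<in> ?K" using ideal_minus_cancel[OF Ki, of u "r \<otimes> x [^] k"] uc unfolding w_def by blast
  qed
  thus ?thesis using subset_tight_closure[OF Kc, of p] by blast
qed

text \<open>The exponents are lowered from \<open>q\<close> to \<open>1\<close> one unit at a time.\<close>

lemma tight_closure_descent:
  assumes xs: "set xs \<subseteq> M" and c: "c \<in> ring_zero_compl R"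
    and colon_killer: "\<And>ns Xs x u. length ns = length xs \<Longrightarrow> (\<forall>n \<in> set ns. 0 < n) \<Longrightarrow>
       mset (Xs @ [x]) = mset (map2 (\<lambda>x n. x [^] (n::nat)) xs ns) \<Longrightarrow> u \<in> carrier R \<Longrightarrow>
       x \<otimes> u \<in> Idl (set Xs) \<Longrightarrow> c \<otimes> u \<in> Idl (set Xs)"
    and closed: "tight_closure R p (Idl ((\<lambda>x. x [^] q) ` set xs)) = Idl ((\<lambda>x. x [^] q) ` set xs)"
    and q: "0 < (q::nat)"
  shows "tight_closure R p (Idl (set xs)) = Idl (set xs)"
proof -
  have Mc: "M \<subseteq> carrier R" using ideal_sub[OF prime_ideal[OF M]] .
  have xsc: "set xs \<subseteq> carrier R" using xs Mc by blast
  define L where "L ns = map2 (\<lambda>x n. x [^] (n::nat)) xs ns" for ns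
  \<comment> \<open>The claim covers all exponent vectors with entries up to \<open>q\<close>,
    because lowering one entry leaves the constant vectors; the induction runs on the total defect
    from \<open>q\<close>.\<close>
  have main: "length ns = length xs \<Longrightarrow> (\<forall>n \<in> set ns. 0 < n \<and> n \<le> q) \<Longrightarrow>
    tight_closure R p (Idl (set (L ns))) = Idl (set (L ns))" for ns
  proof (induction "length ns * q - sum_list ns" arbitrary: ns rule: less_induct)
    case less
    show ?case
    proof (cases "\<forall>j<length ns. ns ! j = q")
      case True
      hence "ns = replicate (length xs) q" using less.prems(1) by (intro nth_equalityI) auto
      hence "L ns = map (\<lambda>x. x [^] q) xs" unfolding L_def
        by (intro nth_equalityI) auto
      thus ?thesis using closed by simp
    next
      case False
      then obtain j where j: "j < length ns" "ns ! j \<noteq> q" by blast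
      hence jq: "ns ! j < q" "0 < ns ! j" using less.prems(2) nth_mem[OF j(1)] by (auto simp: order.order_iff_strict)
      define k where "k = ns ! j"
      define ns' where "ns' = ns[j := Suc k]"
      have len': "length ns' = length xs" using less.prems(1) by (simp add: ns'_def)
      have bnd': "\<forall>n \<in> set ns'. 0 < n \<and> n \<le> q"
        using less.prems(2) jq set_update_subset_insert[of ns j "Suc k"] by (auto simp: ns'_def k_def)
      have sum': "sum_list ns' = Suc (sum_list ns)"
        using j(1) by (simp add: ns'_def k_def sum_list_update)
      have "sum_list ns' \<le> length ns' * q" using sum_list_mono[of ns' "\<lambda>x. x" "\<lambda>_. q"] bnd' by (simp add: sum_list_triv)
      hence lt: "length ns' * q - sum_list ns' < length ns * q - sum_list ns"
        using sum' by (simp add: ns'_def)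
      have IH: "tight_closure R p (Idl (set (L ns'))) = Idl (set (L ns'))"
        by (rule less.hyps[OF lt len' bnd'])
      define Xs where "Xs = take j (L ns) @ drop (Suc j) (L ns)"
      let ?x = "xs ! j"
      have jl: "j < length (L ns)" "j < length xs" using j less.prems(1) by (auto simp: L_def)
      have Lj: "L ns ! j = ?x [^] k" using j jl less.prems(1) by (simp add: L_def k_def)
      have split: "L ns = take j (L ns) @ (?x [^] k) # drop (Suc j) (L ns)"
        using id_take_nth_drop[OF jl(1)] Lj by simp
      have "L ns' = (L ns)[j := ?x [^] Suc k]"
      proof (rule nth_equalityI)
        fix i assume i: "i < length (L ns')"
        hence il: "i < length xs" "i < length ns" using less.prems(1) by (auto simp: L_def ns'_def)
        show "L ns' ! i = (L ns)[j := ?x [^] Suc k] ! i"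
          using il jl j by (cases "i = j") (simp_all add: L_def ns'_def)
      qed (use less.prems(1) in \<open>simp add: L_def ns'_def\<close>)
      hence split': "L ns' = take j (L ns) @ (?x [^] Suc k) # drop (Suc j) (L ns)"
        using jl by (simp add: upd_conv_take_nth_drop)
      have sets: "set (L ns) = insert (?x [^] k) (set Xs)" "set (L ns') = insert (?x [^] Suc k) (set Xs)"
        using arg_cong[OF split, of set] arg_cong[OF split', of set] by (auto simp: Xs_def)
      have Lc: "set (L ns) \<subseteq> carrier R" using xsc by (auto simp: L_def dest!: set_zip_leftD)
      have Xsc: "set Xs \<subseteq> carrier R" using Lc sets by blast
      have xM: "?x \<in> M" using xs nth_mem[OF jl(2)] by blast
      have xc: "?x \<in> carrier R" using xM Mc by blast
      have "tight_closure R p (Idl (insert (?x [^] k) (set Xs))) = Idl (insert (?x [^] k) (set Xs))"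
      proof (rule tight_closure_lower_exponent[OF Xsc xM _ c])
        show "0 < k" using jq by (simp add: k_def)
        fix e u assume u: "u \<in> carrier R" "(?x [^] Suc k) [^] (p ^ e) \<otimes> u \<in> Idl ((\<lambda>x. x [^] (p ^ e)) ` set Xs)"
        \<comment> \<open>Raising to the power \<open>p ^ e\<close> multiplies the exponent vector,
          and singling out one entry reorders the list. This is why the killer is stated for all
          vectors and all orderings.\<close>
        let ?ns = "map (\<lambda>n. n * p ^ e) ns'" and ?Ys = "map (\<lambda>x. x [^] (p ^ e)) Xs"
        have "L ?ns = map (\<lambda>x. x [^] (p ^ e)) (L ns')"
        proof (rule nth_equalityI)
          fix i assume "i < length (L ?ns)"
          hence i: "i < length xs" "i < length ns'" by (auto simp: L_def)
          have "xs ! i \<in> carrier R" using xsc nth_mem[OF i(1)] by blast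
          thus "L ?ns ! i = map (\<lambda>x. x [^] (p ^ e)) (L ns') ! i" using i by (simp add: L_def nat_pow_pow)
        qed (simp add: L_def)
        hence "mset (?Ys @ [(?x [^] Suc k) [^] (p ^ e)]) = mset (L ?ns)"
          unfolding split' Xs_def by (simp add: ac_simps)
        moreover have "\<forall>n \<in> set ?ns. 0 < n" using bnd' p_power_pos by auto
        ultimately show "c \<otimes> u \<in> Idl ((\<lambda>x. x [^] (p ^ e)) ` set Xs)"
          using colon_killer[of ?ns ?Ys "(?x [^] Suc k) [^] (p ^ e)" u] len' u by (simp add: L_def)
      next
        show "tight_closure R p (Idl (insert (?x [^] Suc k) (set Xs))) = Idl (insert (?x [^] Suc k) (set Xs))"
          using IH sets(2) by simp
      qed
      thus ?thesis using sets(1) by simp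
    qed
  qed
  have "L (replicate (length xs) 1) = xs"
    unfolding L_def using xsc by (intro nth_equalityI) (auto simp: subset_iff)
  thus ?thesis using main[of "replicate (length xs) 1"] q by simp
qed

end

section \<open>Surjective homomorphisms and local rings\<close>

locale surjective_hom = ring_hom_cring +
  assumes surj: "h ` carrier R = carrier S"
begin

definition pre :: "'c set \<Rightarrow> 'a set" where "pre T = {u \<in> carrier R. h u \<in> T}"

lemma hom_minus: "a \<in> carrier R \<Longrightarrow> b \<in> carrier R \<Longrightarrow> h (a \<ominus>\<^bsub>R\<^esub> b) = h a \<ominus>\<^bsub>S\<^esub> h b"
  by (simp add: a_minus_def)

lemma hom_power: "a \<in> carrier R \<Longrightarrow> h (a [^]\<^bsub>R\<^esub> (n::nat)) = h a [^]\<^bsub>S\<^esub> n"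
  by (induction n) simp_all

lemma mem_pre: "u \<in> pre T \<longleftrightarrow> u \<in> carrier R \<and> h u \<in> T"
  by (simp add: pre_def)

lemma surjE: "v \<in> carrier S \<Longrightarrow> \<exists>u \<in> carrier R. h u = v"
  using surj by (metis imageE)

lemma pre_ideal: "ideal T S \<Longrightarrow> ideal (pre T) R"
  by (rule R.cring_idealI) (auto simp: mem_pre S.ideal_zero S.ideal_add S.ideal_mult)

lemma img_ideal: assumes J: "ideal J R" shows "ideal (h ` J) S"
proof (rule S.cring_idealI)
  show "h ` J \<subseteq> carrier S" using R.ideal_carr[OF J] by auto
  show "\<zero>\<^bsub>S\<^esub> \<in> h ` J" using R.ideal_zero[OF J] hom_zero by (metis imageI)
  fix a b assume "a \<in> h ` J" "b \<in> h ` J"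
  then obtain x y where xy: "x \<in> J" "y \<in> J" "a = h x" "b = h y" by auto
  hence "a \<oplus>\<^bsub>S\<^esub> b = h (x \<oplus>\<^bsub>R\<^esub> y)" using R.ideal_carr[OF J] by simp
  thus "a \<oplus>\<^bsub>S\<^esub> b \<in> h ` J" using R.ideal_add[OF J xy(1,2)] by blast
next
  fix a r assume "a \<in> h ` J" and r: "r \<in> carrier S"
  then obtain x where x: "x \<in> J" "a = h x" by auto
  obtain s where s: "s \<in> carrier R" "h s = r" using surjE[OF r] by blast
  have "r \<otimes>\<^bsub>S\<^esub> a = h (s \<otimes>\<^bsub>R\<^esub> x)" using s x R.ideal_carr[OF J] by simp
  thus "r \<otimes>\<^bsub>S\<^esub> a \<in> h ` J" using R.ideal_mult[OF J x(1) s(1)] by blast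
qed

lemma img_memD:
  assumes J: "ideal J R" and ker: "pre {\<zero>\<^bsub>S\<^esub>} \<subseteq> J" and u: "u \<in> carrier R" "h u \<in> h ` J"
  shows "u \<in> J"
proof -
  obtain v where v: "v \<in> J" "h u = h v" using u by auto
  have vc: "v \<in> carrier R" using v R.ideal_carr[OF J] by blast
  have "h (u \<ominus>\<^bsub>R\<^esub> v) = h v \<ominus>\<^bsub>S\<^esub> h v" using hom_minus u vc v by simp
  also have "\<dots> = \<zero>\<^bsub>S\<^esub>" using vc by (simp add: S.minus_eq S.r_neg)
  finally have "u \<ominus>\<^bsub>R\<^esub> v \<in> pre {\<zero>\<^bsub>S\<^esub>}" using u vc by (simp add: mem_pre)
  hence "u \<ominus>\<^bsub>R\<^esub> v \<in> J" using ker by blast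
  thus ?thesis using R.ideal_minus_cancel[OF J _ v(1) u(1)] by blast
qed

lemma pre_img: "ideal J R \<Longrightarrow> pre {\<zero>\<^bsub>S\<^esub>} \<subseteq> J \<Longrightarrow> pre (h ` J) = J"
  using img_memD R.ideal_carr by (auto simp: mem_pre)

lemma img_pre: assumes T: "T \<subseteq> carrier S" shows "h ` pre T = T"
proof
  show "h ` pre T \<subseteq> T" by (auto simp: mem_pre)
  show "T \<subseteq> h ` pre T"
  proof
    fix v assume v: "v \<in> T"
    then obtain u where "u \<in> carrier R" "h u = v" using surjE T by (meson subsetD)
    hence "u \<in> pre T" "v = h u" using v by (simp_all add: mem_pre)
    thus "v \<in> h ` pre T" by blast
  qed
qed

lemma ker_pre: "ideal T S \<Longrightarrow> pre {\<zero>\<^bsub>S\<^esub>} \<subseteq> pre T"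
  using S.ideal_zero by (auto simp: mem_pre)

lemma pre_prime: assumes T: "primeideal T S" shows "primeideal (pre T) R"
proof (rule R.primeI)
  show "ideal (pre T) R" using pre_ideal[OF S.prime_ideal[OF T]] .
  show "\<one>\<^bsub>R\<^esub> \<notin> pre T" using S.prime_one[OF T] by (simp add: mem_pre)
  show "a \<in> pre T \<or> b \<in> pre T" if "a \<in> carrier R" "b \<in> carrier R" "a \<otimes>\<^bsub>R\<^esub> b \<in> pre T" for a b
    using that S.primeD[OF T, of "h a" "h b"] by (simp add: mem_pre)
qed

lemma img_prime: assumes P: "primeideal P R" and ker: "pre {\<zero>\<^bsub>S\<^esub>} \<subseteq> P" shows "primeideal (h ` P) S"
proof (rule S.primeI)
  have Pi: "ideal P R" using R.prime_ideal[OF P] .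
  show "ideal (h ` P) S" using img_ideal[OF Pi] .
  show "\<one>\<^bsub>S\<^esub> \<notin> h ` P" using img_memD[OF Pi ker, of "\<one>\<^bsub>R\<^esub>"] R.prime_one[OF P] by auto
  fix a b assume ab: "a \<in> carrier S" "b \<in> carrier S" "a \<otimes>\<^bsub>S\<^esub> b \<in> h ` P"
  obtain x y where xy: "x \<in> carrier R" "h x = a" "y \<in> carrier R" "h y = b" using surjE ab by meson
  have "x \<otimes>\<^bsub>R\<^esub> y \<in> P" using img_memD[OF Pi ker, of "x \<otimes>\<^bsub>R\<^esub> y"] xy ab by simp
  thus "a \<in> h ` P \<or> b \<in> h ` P" using R.primeD[OF P] xy by blast
qed

lemma img_strict:
  assumes "ideal J R" "ideal J' R" "pre {\<zero>\<^bsub>S\<^esub>} \<subseteq> J" "J \<subset> J'" shows "h ` J \<subset> h ` J'"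
proof -
  have "pre {\<zero>\<^bsub>S\<^esub>} \<subseteq> J'" using assms by blast
  hence "h ` J \<noteq> h ` J'" using pre_img assms by (metis psubset_eq)
  thus ?thesis using assms by blast
qed

lemma pre_strict: assumes "T' \<subseteq> carrier S" "T \<subset> T'" shows "pre T \<subset> pre T'"
proof -
  have "pre T \<subseteq> pre T'" using assms(2) by (auto simp: pre_def)
  moreover have "T \<subseteq> carrier S" using assms by blast
  hence "pre T \<noteq> pre T'" using img_pre[of T] img_pre[of T'] assms by (metis psubset_eq)
  ultimately show ?thesis by blast
qed

lemma img_Idl: assumes T: "T \<subseteq> carrier R" shows "h ` genideal R T = genideal S (h ` T)"
proof
  have hT: "h ` T \<subseteq> carrier S" using T by auto
  have "x \<in> pre (genideal S (h ` T))" if "x \<in> T" for x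
    using that T subsetD[OF S.genideal_self[OF hT], of "h x"] by (auto simp: mem_pre)
  hence "genideal R T \<subseteq> pre (genideal S (h ` T))"
    by (intro R.genideal_minimal[OF pre_ideal[OF S.genideal_ideal[OF hT]]] subsetI)
  thus "h ` genideal R T \<subseteq> genideal S (h ` T)" by (auto simp: mem_pre)
  show "genideal S (h ` T) \<subseteq> h ` genideal R T"
    by (rule S.genideal_minimal[OF img_ideal[OF R.genideal_ideal[OF T]]])
      (use R.genideal_self[OF T] in blast)
qed

lemma prime_chain_img:
  assumes c: "prime_chain R c n" and ker: "pre {\<zero>\<^bsub>S\<^esub>} \<subseteq> c 0"
  shows "prime_chain S (\<lambda>i. h ` c i) n"
proof -
  have k: "i \<le> n \<Longrightarrow> pre {\<zero>\<^bsub>S\<^esub>} \<subseteq> c i" for i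
  proof (induction i)
    case (Suc i)
    hence "c i \<subset> c (Suc i)" using c by (simp add: prime_chain_def)
    thus ?case using Suc by auto
  qed (use ker in simp)
  have p: "i \<le> n \<Longrightarrow> primeideal (c i) R" for i using c by (simp add: prime_chain_def)
  show ?thesis unfolding prime_chain_def
  proof (intro conjI allI impI)
    show "primeideal (h ` c i) S" if "i \<le> n" for i using img_prime[OF p[OF that] k[OF that]] .
    show "h ` c i \<subset> h ` c (Suc i)" if i: "i < n" for i
    proof (rule img_strict)
      show "ideal (c i) R" "ideal (c (Suc i)) R" using R.prime_ideal p i by auto
      show "pre {\<zero>\<^bsub>S\<^esub>} \<subseteq> c i" using k i by simp
      show "c i \<subset> c (Suc i)" using c i by (simp add: prime_chain_def)
    qed
  qed
qed

lemma prime_chain_pre: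
  assumes c: "prime_chain S c n" shows "prime_chain R (\<lambda>i. pre (c i)) n"
  unfolding prime_chain_def
proof (intro conjI allI impI)
  have p: "i \<le> n \<Longrightarrow> primeideal (c i) S" for i using c by (simp add: prime_chain_def)
  show "primeideal (pre (c i)) R" if "i \<le> n" for i using pre_prime p that by blast
  show "pre (c i) \<subset> pre (c (Suc i))" if "i < n" for i
    using pre_strict[of "c (Suc i)" "c i"] S.ideal_sub[OF S.prime_ideal[OF p[of "Suc i"]]] c that
    by (simp add: prime_chain_def)
qed

lemma pre_maximal:
  assumes T: "maximalideal T S" shows "maximalideal (pre T) R"
proof (rule maximalidealI)
  have Ti: "ideal T S" using T by (rule maximalideal.axioms(1))
  have Tc: "T \<subseteq> carrier S" using S.ideal_sub[OF Ti] .
  show "ideal (pre T) R" using pre_ideal[OF Ti] .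
  show "carrier R \<noteq> pre T"
  proof
    assume eq: "carrier R = pre T"
    have "T = h ` pre T" using img_pre[OF Tc] by simp
    also have "\<dots> = carrier S" using eq surj by simp
    finally show False using maximalideal.I_notcarr[OF T] by simp
  qed
  fix J assume J: "ideal J R" "pre T \<subseteq> J" "J \<subseteq> carrier R"
  have ker: "pre {\<zero>\<^bsub>S\<^esub>} \<subseteq> J" using ker_pre[OF Ti] J by blast
  have "T \<subseteq> h ` J" using img_pre[OF Tc] J(2) by blast
  hence "h ` J = T \<or> h ` J = carrier S"
    using maximalideal.I_maximal[OF T img_ideal[OF J(1)]] S.ideal_sub[OF img_ideal[OF J(1)]] by blast
  thus "J = pre T \<or> J = carrier R"
  proof
    assume "h ` J = T" thus ?thesis using pre_img[OF J(1) ker] by simp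
  next
    assume "h ` J = carrier S"
    hence "h \<one>\<^bsub>R\<^esub> \<in> h ` J" by simp
    hence "\<one>\<^bsub>R\<^esub> \<in> J" using img_memD[OF J(1) ker, of "\<one>\<^bsub>R\<^esub>"] by blast
    thus ?thesis using ideal.one_imp_carrier[OF J(1)] by blast
  qed
qed

text \<open>The composite of \<open>h\<close> with the projection to \<open>S/J\<close> has kernel
  \<open>pre J\<close>. The isomorphism it induces agrees with \<open>induced_hom\<close> because
  another choice of representative changes the image only by an element of \<open>J\<close>.\<close>

lemma induced_hom_iso:
  assumes J: "ideal J S"
  shows "induced_hom S J h \<in> ring_iso (R Quot pre J) (S Quot J)"
proof -
  interpret J: ideal J S by (rule J)
  define \<psi> where "\<psi> = (\<lambda>u. J +>\<^bsub>S\<^esub> h u)"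
  have comp: "(\<lambda>v. J +>\<^bsub>S\<^esub> v) \<circ> h = \<psi>" by (auto simp: \<psi>_def)
  have "\<psi> \<in> ring_hom R (S Quot J)"
    unfolding comp[symmetric] by (rule ring_hom_trans[OF homh J.rcos_ring_hom])
  then interpret \<psi>: ring_hom_ring R "S Quot J" \<psi>
    by (intro ring_hom_ringI2 R.ring_axioms J.quotient_is_ring)
  have pJ: "ideal (pre J) R" using pre_ideal[OF J] .
  have ker: "a_kernel R (S Quot J) \<psi> = pre J"
  proof -
    have "\<psi> u = J \<longleftrightarrow> h u \<in> J" if "u \<in> carrier R" for u
      unfolding \<psi>_def using J.rcos_const_imp_mem[OF hom_closed[OF that]] S.a_rcos_zero[OF J, of "h u"] by metis
    thus ?thesis unfolding a_kernel_def' pre_def by (simp add: FactRing_def cong: conj_cong)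
  qed
  have "\<psi> ` carrier R = carrier (S Quot J)"
  proof -
    have "\<psi> ` carrier R = (\<lambda>v. J +>\<^bsub>S\<^esub> v) ` carrier S" unfolding \<psi>_def surj[symmetric] by (simp add: image_image)
    thus ?thesis by (auto simp: FactRing_def A_RCOSETS_def')
  qed
  hence iso: "(\<lambda>Y. the_elem (\<psi> ` Y)) \<in> ring_iso (R Quot pre J) (S Quot J)"
    using \<psi>.FactRing_iso_set ker by simp
  have eq: "the_elem (\<psi> ` Y) = induced_hom S J h Y" if Y: "Y \<in> carrier (R Quot pre J)" for Y
  proof -
    obtain u where u: "u \<in> carrier R" "Y = pre J +>\<^bsub>R\<^esub> u" using Y by (auto simp: FactRing_def A_RCOSETS_def')
    have 1: "the_elem (\<psi> ` Y) = \<psi> u" using \<psi>.the_elem_simp[OF u(1)] ker u(2) by simp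
    have "u = \<zero>\<^bsub>R\<^esub> \<oplus>\<^bsub>R\<^esub> u" using u(1) by simp
    hence "u \<in> Y" unfolding u(2) a_r_coset_def' using R.ideal_zero[OF pJ] by blast
    define z where "z = (SOME x. x \<in> Y)"
    have "z \<in> Y" unfolding z_def using \<open>u \<in> Y\<close> by (rule someI)
    then obtain j where j: "j \<in> pre J" "z = j \<oplus>\<^bsub>R\<^esub> u" using u(2) by (auto simp: a_r_coset_def')
    have "j \<in> carrier R" "h j \<in> J" using j by (auto simp: mem_pre)
    hence "h z \<in> J +>\<^bsub>S\<^esub> h u" using j u by (auto simp: a_r_coset_def')
    hence "J +>\<^bsub>S\<^esub> h z = J +>\<^bsub>S\<^esub> h u"
      using S.a_repr_independence[OF _ hom_closed[OF u(1)] J.a_subgroup] by simp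
    thus ?thesis using 1 by (simp add: induced_hom_def z_def \<psi>_def)
  qed
  show ?thesis
    by (rule ring.ring_iso_restrict[OF ideal.quotient_is_ring[OF pJ] iso eq])
qed

end

lemma quotient_surjective_hom:
  assumes "cring R" "ideal J R" shows "surjective_hom R (R Quot J) (\<lambda>u. J +>\<^bsub>R\<^esub> u)"
proof -
  interpret R: cring R by fact
  interpret J: ideal J R by fact
  show ?thesis
    by (intro surjective_hom.intro J.rcos_ring_hom_cring[OF R.is_cring] surjective_hom_axioms.intro)
      (auto simp: FactRing_def A_RCOSETS_def')
qed

lemma surjective_hom_comp:
  assumes "surjective_hom R S g" "surjective_hom S T h" shows "surjective_hom R T (h \<circ> g)"
proof -
  interpret g: surjective_hom R S g by fact
  interpret h: surjective_hom S T h by fact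
  show ?thesis
    by (intro surjective_hom.intro ring_hom_cring.intro g.R.is_cring h.S.is_cring
        ring_hom_cring_axioms.intro ring_hom_trans[OF g.homh h.homh] surjective_hom_axioms.intro)
      (simp only: image_comp[symmetric] g.surj h.surj)
qed

context cring
begin

lemma prime_path_imp_prime_chain: "prime_path P n Q \<Longrightarrow> \<exists>c. prime_chain R c n \<and> c 0 = P \<and> c n = Q"
proof (induction rule: prime_path.induct)
  case (prime_path_0 P)
  thus ?case by (intro exI[of _ "\<lambda>_. P"]) (simp add: prime_chain_def)
next
  case (prime_path_Suc P P' n Q)
  then obtain c where c: "prime_chain R c n" "c 0 = P'" "c n = Q" by blast
  let ?c = "\<lambda>i. case i of 0 \<Rightarrow> P | Suc j \<Rightarrow> c j"
  have "prime_chain R ?c (Suc n)"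
    using c prime_path_Suc(1,2) unfolding prime_chain_def by (auto split: nat.split)
  thus ?case using c by (intro exI[of _ ?c]) simp
qed

lemma prime_chain_imp_prime_path: "prime_chain R c n \<Longrightarrow> prime_path (c 0) n (c n)"
proof (induction n arbitrary: c)
  case 0 thus ?case by (auto simp: prime_chain_def intro: prime_path_0)
next
  case (Suc n)
  have "prime_chain R (\<lambda>i. c (Suc i)) n" using Suc.prems by (auto simp: prime_chain_def)
  hence "prime_path (c (Suc 0)) n (c (Suc n))" using Suc.IH by blast
  moreover have "primeideal (c 0) R" "c 0 \<subset> c (Suc 0)" using Suc.prems by (auto simp: prime_chain_def)
  ultimately show ?case by (rule prime_path_Suc[rotated 2])
qed

lemma saturated_chain_imp_ideal_chain: "saturated_chain P I n K \<Longrightarrow> saturated P I \<Longrightarrow> \<exists>c. ideal_chain R I c n \<and> c n = K"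
proof (induction rule: saturated_chain.induct)
  case saturated_chain_0
  thus ?case by (intro exI[of _ "\<lambda>_. I"]) (simp add: ideal_chain_def saturated_ideal)
next
  case (saturated_chain_Suc n J K)
  then obtain c where c: "ideal_chain R I c n" "c n = J" by blast
  let ?c = "c(Suc n := K)"
  have "I \<subseteq> K" using saturated_chain_sub[OF saturated_chain_Suc(1)] saturated_chain_Suc(2) by auto
  hence "ideal_chain R I ?c (Suc n)"
    using c saturated_chain_Suc(2,3) saturated_ideal unfolding ideal_chain_def by (auto simp: le_Suc_eq less_Suc_eq)
  from this fun_upd_same show ?case by (intro exI[of _ ?c] conjI)
qed

lemma ideal_chain_imp_saturated_chain:
  assumes "ideal_chain R J c n" "\<And>i. i \<le> n \<Longrightarrow> saturated P (c i)" shows "saturated_chain P (c 0) n (c n)"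
  using assms
proof (induction n)
  case 0 show ?case by (rule saturated_chain_0)
next
  case (Suc n)
  have "ideal_chain R J c n" using Suc.prems(1) by (auto simp: ideal_chain_def)
  hence "saturated_chain P (c 0) n (c n)" using Suc by simp
  moreover have "c n \<subset> c (Suc n)" using Suc.prems(1) by (simp add: ideal_chain_def)
  ultimately show ?case using saturated_chain_Suc Suc.prems(2) by blast
qed

end

lemma quot_length_ge: "ideal_chain R J c n \<Longrightarrow> enat n \<le> quot_length R J"
  unfolding quot_length_def by (rule Sup_upper) blast

lemma quot_length_le: "(\<And>c n. ideal_chain R J c n \<Longrightarrow> n \<le> k) \<Longrightarrow> quot_length R J \<le> enat k"
  unfolding quot_length_def by (rule Sup_least) auto

lemma ideal_chain_mono: "ideal_chain R I c n \<Longrightarrow> J \<subseteq> I \<Longrightarrow> ideal_chain R J c n"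
  unfolding ideal_chain_def by blast

lemma krull_dim_unique: "krull_dim R s \<Longrightarrow> krull_dim R t \<Longrightarrow> s = t"
  unfolding krull_dim_def by (meson order_antisym)

section \<open>Noetherian local rings and regular systems of parameters\<close>

locale local_noetherian = noetherian_cring +
  fixes M :: "'a set"
  assumes loc: "local_ring R" and M_def: "M = max_ideal R"
begin

lemma M_maximal: "maximalideal M R"
  using loc theI'[of "\<lambda>m. maximalideal m R"] unfolding M_def max_ideal_def local_ring_def by blast

lemma M_prime: "primeideal M R"
  using maximalideal_prime[OF M_maximal] .

lemma M_ideal: "ideal M R"
  using prime_ideal[OF M_prime] .

lemma M_sub: "M \<subseteq> carrier R"
  using ideal_sub[OF M_ideal] .

lemma proper_sub_M:
  assumes J: "ideal J R" "\<one> \<notin> J" shows "J \<subseteq> M"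
proof -
  let ?F = "{K. ideal K R \<and> J \<subseteq> K \<and> \<one> \<notin> K}"
  have "\<exists>K \<in> ?F. \<forall>L \<in> ?F. K \<subseteq> L \<longrightarrow> L = K" by (rule ideal_maximal_exists) (use J in auto)
  then obtain K where K: "K \<in> ?F" "\<forall>L \<in> ?F. K \<subseteq> L \<longrightarrow> L = K" by (elim bexE)
  have "maximalideal K R"
  proof (rule maximalidealI)
    show "ideal K R" "carrier R \<noteq> K" using K(1) by auto
    fix L assume L: "ideal L R" "K \<subseteq> L" "L \<subseteq> carrier R"
    show "L = K \<or> L = carrier R"
    proof (cases "\<one> \<in> L")
      case True thus ?thesis using ideal.one_imp_carrier[OF L(1)] by simp
    next
      case False
      hence "L \<in> ?F" using L K(1) by auto
      thus ?thesis using K(2) L(2) by simp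
    qed
  qed
  hence "K = M" using loc M_maximal unfolding local_ring_def by blast
  thus ?thesis using K(1) by simp
qed

lemma prime_sub_M: "primeideal P R \<Longrightarrow> P \<subseteq> M"
  using proper_sub_M prime_ideal prime_one by blast

lemma inverse_outside_M:
  assumes x: "x \<in> carrier R - M" shows "\<exists>y \<in> carrier R. y \<otimes> x = \<one>"
proof -
  have xc: "x \<in> carrier R" using x by simp
  have "\<not> PIdl x \<subseteq> M" using cgenideal_self[OF xc] x by blast
  hence "\<one> \<in> PIdl x" using proper_sub_M[OF cgenideal_ideal[OF xc]] by blast
  thus ?thesis by (auto simp: cgenideal_def)
qed

lemma all_saturated: assumes J: "ideal J R" shows "saturated M J"
proof (rule saturatedI[OF J])
  fix s u assume s: "s \<in> carrier R - M" and u: "u \<in> carrier R" "s \<otimes> u \<in> J"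
  obtain y where y: "y \<in> carrier R" "y \<otimes> s = \<one>" using inverse_outside_M[OF s] by blast
  have "y \<otimes> (s \<otimes> u) = u" using y s u by (simp add: m_assoc[symmetric])
  thus "u \<in> J" using ideal_mult[OF J u(2) y(1)] by simp
qed

lemma sat_Idl: assumes T: "T \<subseteq> carrier R" shows "sat M T = Idl T"
proof
  show "sat M T \<subseteq> Idl T" by (rule sat_least[OF all_saturated[OF genideal_ideal[OF T]] genideal_self[OF T]])
  show "Idl T \<subseteq> sat M T" by (rule genideal_minimal[OF sat_ideal sat_upper[OF T]])
qed

lemma dimension_chain: assumes t: "krull_dim R t" shows "\<exists>P. prime_path P t M"
proof -
  obtain c where c: "prime_chain R c t" and max: "\<And>c m. prime_chain R c m \<Longrightarrow> m \<le> t"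
    using t unfolding krull_dim_def by blast
  have ch: "prime_path (c 0) t (c t)" using prime_chain_imp_prime_path[OF c] .
  have p: "primeideal (c t) R" using prime_path_prime[OF ch] by simp
  have "c t = M"
  proof (rule ccontr)
    assume "c t \<noteq> M"
    hence "c t \<subset> M" using prime_sub_M[OF p] by auto
    from prime_path_trans[OF ch prime_path_step[OF p M_prime this]]
    obtain c' where "prime_chain R c' (t + Suc 0)" using prime_path_imp_prime_chain by blast
    thus False using max by fastforce
  qed
  thus ?thesis using ch by blast
qed

lemma parameters_only_prime:
  assumes "system_of_parameters R xs" "primeideal P R" "set xs \<subseteq> P" shows "P = M"
proof
  show "P \<subseteq> M" using prime_sub_M assms(2) .
  have "Idl (set xs) \<subseteq> P" using genideal_minimal[OF prime_ideal[OF assms(2)] assms(3)] .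
  moreover have "M = ideal_radical R (Idl (set xs))" using assms(1) by (simp add: system_of_parameters_def M_def)
  ultimately show "M \<subseteq> P" using prime_pow[OF assms(2)] unfolding ideal_radical_def by blast
qed

text \<open>Modulo an initial segment of the generators the situation is again regular, so by
  \<open>regular_imp_prime\<close> that segment generates a prime ideal. The next generator lies
  outside it, since otherwise too few generators would cut out \<open>M\<close>.\<close>

lemma regular_generators_regular:
  assumes t: "krull_dim R (length ys)" and ys: "set ys \<subseteq> carrier R" and gen: "M = Idl (set ys)"
  shows "reg M (sat M {}) ys"
proof -
  obtain P0 where P0: "prime_path P0 (length ys) M" using dimension_chain[OF t] by blast
  have ysM: "set ys \<subseteq> M" using gen genideal_self[OF ys] by simp
  have D: "sat M {} \<subseteq> P" if "primeideal P R" for P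
    using sat_least[OF saturated_prime[OF that prime_sub_M[OF that]]] by simp
  have "k \<le> length ys \<Longrightarrow> reg M (sat M {}) (take k ys)" for k
  proof (induction k)
    case (Suc k)
    let ?t = "take k ys" and ?d = "drop k ys"
    have reg: "reg M (sat M {}) ?t" and len: "length ?t = k" using Suc by auto
    have split: "set ys = set ?t \<union> set ?d" by (metis append_take_drop_id set_append)
    have tM: "set ?t \<subseteq> M" using split ysM by blast
    define J where "J = sat M (sat M {} \<union> set ?t)"
    \<comment> \<open>A chain of full length is pushed up past the first \<open>k\<close>
      generators; its lower end is the prime to be identified with \<open>J\<close>.\<close>
    obtain P1 where P1: "prime_path P1 (length ys - k) M" "P0 \<subseteq> P1" "set ?t \<subseteq> P1"
      using prime_path_move_list[OF P0 tM] Suc.prems by auto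
    have P1p: "primeideal P1 R" using prime_path_prime[OF P1(1)] by simp
    have JP1: "J \<subseteq> P1" unfolding J_def
      using D[OF P1p] P1(3) by (intro sat_least[OF saturated_prime[OF P1p prime_sub_M[OF P1p]]]) auto
    have tJ: "set ?t \<subseteq> J" unfolding J_def
      using sat_upper[of "sat M {} \<union> set ?t" M] tM M_sub sat_sub_carrier[of M "{}"] by auto
    let ?y = "\<lambda>i. ys ! (k + i)"
    have img: "?y ` {..<length ys - k} = set ?d"
    proof -
      have "set ?d = (\<lambda>i. ?d ! i) ` {..<length ?d}" by (auto simp: in_set_conv_nth)
      thus ?thesis using Suc.prems by simp
    qed
    interpret C: coordinates R M J ?y "length ys - k"
    proof (intro coordinates.intro coordinates_axioms.intro)
      show "noetherian_cring R" by (rule noetherian_cring_axioms)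
      show "primeideal M R" by (rule M_prime)
      show "saturated M J" unfolding J_def by (rule saturated_sat)
      show "?y i \<in> M" if "i < length ys - k" for i using ysM nth_mem[of "k + i" ys] that by auto
      show "J \<subseteq> M" using JP1 prime_sub_M[OF P1p] by blast
      have "set ys \<subseteq> J \<union> ?y ` {..<length ys - k}" using split tJ img by blast
      hence "sat M (set ys) \<subseteq> sat M (J \<union> ?y ` {..<length ys - k})" by (rule sat_mono)
      thus "M \<subseteq> sat M (J \<union> ?y ` {..<length ys - k})" using sat_Idl[OF ys] gen by simp
    qed
    have J: "J = P1" using C.regular_imp_prime[OF P1(1) JP1] .
    let ?x = "ys ! k"
    have kx: "k < length ys" using Suc.prems by simp
    have xM: "?x \<in> M" using ysM nth_mem[OF kx] by blast
    have xJ: "?x \<notin> J"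
    proof
      assume x: "?x \<in> J"
      have "length ys - k \<le> length (drop (Suc k) ys)"
      proof (rule prime_path_length_le[OF P1(1)])
        show "set (drop (Suc k) ys) \<subseteq> M" using ysM set_drop_subset[of "Suc k" ys] by blast
        fix P' assume P': "primeideal P' R" "P1 \<subseteq> P'" "set (drop (Suc k) ys) \<subseteq> P'" "P' \<subseteq> M"
        have "set ?d = insert ?x (set (drop (Suc k) ys))" using Cons_nth_drop_Suc[OF kx] by (metis list.simps(15))
        hence "set ys \<subseteq> P'" using split x J P1(3) P'(2,3) by auto
        thus "P' = M" using genideal_minimal[OF prime_ideal[OF P'(1)]] gen P'(4) by blast
      qed
      thus False using kx by simp
    qed
    have "nzd J ?x" unfolding nzd_def
      using primeD[OF P1p, of ?x] xJ J xM M_sub by blast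
    hence "reg M (sat M {}) (?t @ [?x])"
      using reg_append[OF M_sub saturated_sat tM, of "{}" "[?x]"] reg xM unfolding J_def by simp
    thus ?case using kx by (simp add: take_Suc_conv_app_nth)
  qed simp
  from this[of "length ys"] show ?thesis by simp
qed

lemma reg_imp_regular_sequence:
  assumes "reg M (sat M {}) xs" shows "regular_sequence R xs"
proof -
  have xM: "set xs \<subseteq> M" using reg_set[OF assms] .
  have xc: "set xs \<subseteq> carrier R" using xM M_sub by blast
  have cl0: "sat M (sat M {} \<union> T) = Idl T" if "T \<subseteq> carrier R" for T
    using sat_sat_Un[of "{}" T M] sat_Idl[OF that] that by simp
  have "Idl (set xs) \<subseteq> M" using genideal_minimal[OF M_ideal xM] .
  hence "Idl (set xs) \<noteq> carrier R" using prime_one[OF M_prime] by blast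
  moreover have "u \<in> Idl (set (take i xs))"
    if i: "i < length xs" and u: "u \<in> carrier R" "xs ! i \<otimes> u \<in> Idl (set (take i xs))" for i u
  proof -
    have tM: "set (take i xs) \<subseteq> M" using xM set_take_subset[of i xs] by blast
    have "xs = take i xs @ (xs ! i) # drop (Suc i) xs" using i by (simp add: id_take_nth_drop)
    hence "reg M (sat M {}) (take i xs @ (xs ! i) # drop (Suc i) xs)" using assms by simp
    hence "nzd (sat M (sat M {} \<union> set (take i xs))) (xs ! i)"
      using reg_append[OF M_sub saturated_sat tM, of "{}" "(xs ! i) # drop (Suc i) xs"] by simp
    hence "nzd (Idl (set (take i xs))) (xs ! i)" using cl0 tM M_sub by (metis order.trans)
    thus ?thesis using nzdD u by blast
  qed
  ultimately show ?thesis using xc unfolding regular_sequence_def by blast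
qed

end

lemma local_ring_image:
  assumes "local_noetherian R M" "surjective_hom R S h" "\<one>\<^bsub>S\<^esub> \<noteq> \<zero>\<^bsub>S\<^esub>"
  shows "local_ring S"
proof -
  interpret R: local_noetherian R M by fact
  interpret h: surjective_hom R S h by fact
  have kM: "h.pre {\<zero>\<^bsub>S\<^esub>} \<subseteq> M"
  proof (rule R.proper_sub_M)
    show "ideal (h.pre {\<zero>\<^bsub>S\<^esub>}) R" by (rule h.pre_ideal[OF h.S.zeroideal])
    show "\<one>\<^bsub>R\<^esub> \<notin> h.pre {\<zero>\<^bsub>S\<^esub>}" using assms(3) by (simp add: h.mem_pre)
  qed
  have pm: "primeideal (h ` M) S" by (rule h.img_prime[OF R.M_prime kM])
  have sub: "T \<subseteq> h ` M" if T: "ideal T S" "\<one>\<^bsub>S\<^esub> \<notin> T" for T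
  proof -
    have "h.pre T \<subseteq> M" by (rule R.proper_sub_M[OF h.pre_ideal[OF T(1)]]) (use T(2) in \<open>simp add: h.mem_pre\<close>)
    thus ?thesis using h.img_pre[OF h.S.ideal_sub[OF T(1)]] by blast
  qed
  have "maximalideal (h ` M) S"
  proof (rule maximalidealI)
    show "ideal (h ` M) S" using h.S.prime_ideal[OF pm] .
    show "carrier S \<noteq> h ` M" using h.S.prime_one[OF pm] by auto
    fix L assume L: "ideal L S" "h ` M \<subseteq> L" "L \<subseteq> carrier S"
    show "L = h ` M \<or> L = carrier S"
    proof (cases "\<one>\<^bsub>S\<^esub> \<in> L")
      case True thus ?thesis using ideal.one_imp_carrier[OF L(1)] by simp
    next
      case False thus ?thesis using sub[OF L(1)] L(2) by blast
    qed
  qed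
  moreover have "T = h ` M" if T: "maximalideal T S" for T
  proof -
    have Ti: "ideal T S" using T by (rule maximalideal.axioms(1))
    have "\<one>\<^bsub>S\<^esub> \<notin> T" using maximalideal.I_notcarr[OF T] ideal.one_imp_carrier[OF Ti] by auto
    hence "T \<subseteq> h ` M" using sub[OF Ti] by blast
    hence "h ` M = T \<or> h ` M = carrier S"
      using maximalideal.I_maximal[OF T h.S.prime_ideal[OF pm]] h.S.ideal_sub[OF h.S.prime_ideal[OF pm]] by blast
    thus ?thesis using h.S.prime_one[OF pm] by auto
  qed
  ultimately show ?thesis unfolding local_ring_def using h.S.is_cring by blast
qed

lemma noetherian_local_ringD: "noetherian_local_ring R \<Longrightarrow> local_noetherian R (max_ideal R)"
  unfolding noetherian_local_ring_def local_ring_def local_noetherian_def local_noetherian_axioms_def noetherian_cring_def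
  by auto

lemma ring_char_prime:
  assumes "ring_char R = p" "Factorial_Ring.prime p" shows "[p] \<cdot>\<^bsub>R\<^esub> \<one>\<^bsub>R\<^esub> = \<zero>\<^bsub>R\<^esub>"
proof -
  have "p \<noteq> 0" using assms(2) by (metis not_prime_0)
  hence ex: "\<exists>n::nat. n > 0 \<and> [n] \<cdot>\<^bsub>R\<^esub> \<one>\<^bsub>R\<^esub> = \<zero>\<^bsub>R\<^esub>" using assms(1) unfolding ring_char_def by (auto split: if_splits)
  hence "p = (LEAST n::nat. n > 0 \<and> [n] \<cdot>\<^bsub>R\<^esub> \<one>\<^bsub>R\<^esub> = \<zero>\<^bsub>R\<^esub>)" using assms(1) unfolding ring_char_def by simp
  thus ?thesis using LeastI_ex[OF ex] by simp
qed

section \<open>Colon capturing\<close>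

text \<open>This carries a rearranged sequence of parameter powers in \<open>A\<close> back to a
  rearrangement of their lifts in the Cohen-Macaulay ring.\<close>

lemma mset_map_lift:
  "mset ys = mset (map g xs) \<Longrightarrow> \<exists>zs. mset zs = mset xs \<and> map g zs = ys"
proof (induction ys arbitrary: xs)
  case (Cons y ys)
  have "y \<in> set (map g xs)" using Cons.prems by (metis list.set_intros(1) mset_eq_setD)
  then obtain z where z: "z \<in> set xs" "g z = y" by auto
  then obtain us vs where xs: "xs = us @ z # vs" by (meson split_list)
  have "mset ys = mset (map g (us @ vs))" using Cons.prems xs z by simp
  then obtain zs where "mset zs = mset (us @ vs)" "map g zs = ys" using Cons.IH by blast
  thus ?case using xs z by (intro exI[of _ "z # zs"]) simp
qed simp

context cring
begin

lemma sat_of_Idl: assumes T: "T \<subseteq> carrier R" shows "sat M (Idl T) = sat M T"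
proof
  show "sat M (Idl T) \<subseteq> sat M T"
    by (rule sat_least[OF saturated_sat genideal_minimal[OF sat_ideal sat_upper[OF T]]])
  show "sat M T \<subseteq> sat M (Idl T)" by (rule sat_mono[OF genideal_self[OF T]])
qed

text \<open>A denominator \<open>s\<close> is moved onto \<open>u\<close> before regularity is
  applied, which is why regular sequences localise.\<close>

lemma regular_sequence_imp_reg:
  assumes M: "primeideal M R" and ys: "set ys \<subseteq> M" and reg: "regular_sequence R ys"
  shows "reg M (sat M {}) ys"
proof -
  have Mc: "M \<subseteq> carrier R" using ideal_sub[OF prime_ideal[OF M]] .
  have "k \<le> length ys \<Longrightarrow> reg M (sat M {}) (take k ys)" for k
  proof (induction k)
    case (Suc k)
    let ?t = "take k ys" and ?y = "ys ! k"
    have kl: "k < length ys" using Suc.prems by simp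
    have tM: "set ?t \<subseteq> M" using ys set_take_subset[of k ys] by blast
    have tc: "set ?t \<subseteq> carrier R" using tM Mc by blast
    have yM: "?y \<in> M" using ys nth_mem[OF kl] by blast
    have yc: "?y \<in> carrier R" using yM Mc by blast
    have Ii: "ideal (Idl (set ?t)) R" using genideal_ideal[OF tc] .
    have "nzd (sat M (Idl (set ?t))) ?y"
      unfolding nzd_def
    proof (intro ballI impI)
      fix u assume u: "u \<in> carrier R" "?y \<otimes> u \<in> sat M (Idl (set ?t))"
      then obtain s where s: "s \<in> carrier R - M" "s \<otimes> (?y \<otimes> u) \<in> Idl (set ?t)"
        using mem_sat_ideal[OF M Ii] by blast
      have "?y \<otimes> (s \<otimes> u) \<in> Idl (set ?t)" using s u(1) yc by (simp add: m_lcomm)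
      hence "s \<otimes> u \<in> Idl (set ?t)" using reg kl s(1) u(1) unfolding regular_sequence_def by simp
      thus "u \<in> sat M (Idl (set ?t))" using mem_sat_ideal[OF M Ii] u(1) s(1) by blast
    qed
    moreover have "sat M (sat M {} \<union> set ?t) = sat M (Idl (set ?t))"
      using sat_sat_Un[of "{}" "set ?t" M] sat_of_Idl[OF tc, of M] tc by simp
    ultimately have "reg M (sat M {}) (?t @ [?y])"
      using reg_append[OF Mc saturated_sat tM, of "{}" "[?y]"] Suc yM by simp
    thus ?case using kl by (simp add: take_Suc_conv_app_nth)
  qed simp
  from this[of "length ys"] show ?thesis by simp
qed

end

lemma equidimensional_coheight:
  assumes S: "noetherian_cring S" and g: "surjective_hom S A g"
    and M: "primeideal M S" and KM: "\<And>P. primeideal P S \<Longrightarrow> surjective_hom.pre S g {\<zero>\<^bsub>A\<^esub>} \<subseteq> P \<Longrightarrow> P \<subseteq> M"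
    and eq: "equidimensional A" and t: "krull_dim A t"
    and P: "noetherian_cring.min_over S (surjective_hom.pre S g {\<zero>\<^bsub>A\<^esub>}) P"
  shows "cring.prime_path S P t M" and "cring.prime_path S P m M \<Longrightarrow> m \<le> t" and "minimal_prime A (g ` P)"
proof -
  interpret S: noetherian_cring S by fact
  interpret g: surjective_hom S A g by fact
  let ?K = "g.pre {\<zero>\<^bsub>A\<^esub>}"
  have Pp: "primeideal P S" "?K \<subseteq> P" and Pmin: "\<And>Q. primeideal Q S \<Longrightarrow> ?K \<subseteq> Q \<Longrightarrow> Q \<subseteq> P \<Longrightarrow> Q = P"
    using P by (simp_all add: S.min_over_def)
  let ?T = "g ` P"
  have Tp: "primeideal ?T A" using g.img_prime[OF Pp] .
  have Tc: "?T \<subseteq> carrier A" using g.S.ideal_sub[OF g.S.prime_ideal[OF Tp]] .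
  show Tm: "minimal_prime A ?T"
    unfolding minimal_prime_def
  proof (intro conjI allI impI Tp, elim conjE)
    fix T' assume T': "primeideal T' A" "T' \<subseteq> ?T"
    have T'c: "T' \<subseteq> carrier A" using T' Tc by blast
    have "g.pre T' \<subseteq> g.pre ?T" using T'(2) by (auto simp: g.pre_def)
    hence "g.pre T' \<subseteq> P" using g.pre_img[OF S.prime_ideal[OF Pp(1)] Pp(2)] by simp
    hence "g.pre T' = P"
      using Pmin[OF g.pre_prime[OF T'(1)] g.ker_pre[OF g.S.prime_ideal[OF T'(1)]]] by blast
    thus "T' = ?T" using g.img_pre[OF T'c] by simp
  qed
  obtain t' where t': "krull_dim A t'" "\<And>T. minimal_prime A T \<Longrightarrow> krull_dim (A Quot T) t'"
    using eq unfolding equidimensional_def by blast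
  have dim: "krull_dim (A Quot ?T) t" using t'(2)[OF Tm] krull_dim_unique[OF t t'(1)] by simp
  define \<phi> where "\<phi> = (\<lambda>v. ?T +>\<^bsub>A\<^esub> v) \<circ> g"
  interpret \<phi>: surjective_hom S "A Quot ?T" \<phi>
    unfolding \<phi>_def
    by (rule surjective_hom_comp[OF g quotient_surjective_hom[OF g.S.is_cring g.S.prime_ideal[OF Tp]]])
  have ker: "\<phi>.pre {\<zero>\<^bsub>A Quot ?T\<^esub>} = P"
  proof -
    interpret T: ideal ?T A using g.S.prime_ideal[OF Tp] .
    have "\<phi> u = ?T \<longleftrightarrow> u \<in> P" if u: "u \<in> carrier S" for u
    proof -
      have "\<phi> u = ?T \<longleftrightarrow> g u \<in> ?T"
        unfolding \<phi>_def comp_def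
        using T.rcos_const_imp_mem[OF g.hom_closed[OF u]] g.S.a_rcos_zero[OF T.is_ideal, of "g u"] by metis
      also have "\<dots> \<longleftrightarrow> u \<in> P" using g.img_memD[OF S.prime_ideal[OF Pp(1)] Pp(2) u] by blast
      finally show ?thesis .
    qed
    hence "\<phi>.pre {?T} = {u \<in> carrier S. u \<in> P}" unfolding \<phi>.pre_def by auto
    moreover have "\<zero>\<^bsub>A Quot ?T\<^esub> = ?T" by (simp add: FactRing_def)
    ultimately show ?thesis using S.ideal_carr[OF S.prime_ideal[OF Pp(1)]] by auto
  qed
  show le: "m \<le> t" if pm: "S.prime_path P m M" for m
  proof -
    obtain c where c: "prime_chain S c m" "c 0 = P" using S.prime_path_imp_prime_chain[OF pm] by blast
    have "prime_chain (A Quot ?T) (\<lambda>i. \<phi> ` c i) m" using \<phi>.prime_chain_img[OF c(1)] ker c(2) by simp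
    thus ?thesis using dim unfolding krull_dim_def by blast
  qed
  obtain c where c: "prime_chain (A Quot ?T) c t" using dim unfolding krull_dim_def by blast
  define c' where "c' i = \<phi>.pre (c i)" for i
  have ch: "S.prime_path (c' 0) t (c' t)"
    using S.prime_chain_imp_prime_path[OF \<phi>.prime_chain_pre[OF c]] by (simp add: c'_def)
  have p: "primeideal (c' 0) S" "primeideal (c' t) S" using S.prime_path_prime[OF ch] by auto
  have "primeideal (c 0) (A Quot ?T)" using c by (simp add: prime_chain_def)
  hence P0: "P \<subseteq> c' 0" using \<phi>.ker_pre[OF \<phi>.S.prime_ideal] ker unfolding c'_def by blast
  have tM: "c' t \<subseteq> M" using KM[OF p(2)] P0 S.prime_path_sub[OF ch] Pp(2) by blast
  \<comment> \<open>The ends are adjusted to \<open>M\<close> and then to \<open>P\<close>; a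
    genuine extension at either end would exceed the bound \<open>t\<close> just proved.\<close>
  obtain m where m: "S.prime_path (c' 0) m M" "t \<le> m" "c' t \<noteq> M \<longrightarrow> t < m"
  proof (cases "c' t = M")
    case True thus ?thesis using that[of t] ch by simp
  next
    case False
    hence "c' t \<subset> M" using tM by auto
    thus ?thesis using that[OF S.prime_path_trans[OF ch S.prime_path_step[OF p(2) M]]] by simp
  qed
  obtain k where k: "S.prime_path P k M" "m \<le> k" "P \<noteq> c' 0 \<longrightarrow> m < k"
  proof (cases "P = c' 0")
    case True thus ?thesis using that[of m] m by simp
  next
    case False
    hence "P \<subset> c' 0" using P0 by auto
    thus ?thesis using that[OF S.prime_path.prime_path_Suc[OF Pp(1) _ m(1)]] by simp
  qed
  have "k = t" using le[OF k(1)] k(2) m(2) by simp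
  thus "S.prime_path P t M" using k(1) by simp
qed

text \<open>The colon-killer of the Cohen-Macaulay ring is pushed forward. It stays outside the minimal
  primes because these all have the same coheight.\<close>

lemma colon_capturing:
  assumes A: "local_noetherian A MA" and sop: "system_of_parameters A xs" and eq: "equidimensional A"
    and CM: "cohen_macaulay S" and g: "g \<in> ring_hom S A" and surj: "g ` carrier S = carrier A"
  shows "\<exists>c \<in> ring_zero_compl A. \<forall>ns Xs x u. length ns = length xs \<and> (\<forall>n \<in> set ns. 0 < n) \<and>
     mset (Xs @ [x]) = mset (map2 (\<lambda>x n. x [^]\<^bsub>A\<^esub> (n::nat)) xs ns) \<and> u \<in> carrier A \<and>
     x \<otimes>\<^bsub>A\<^esub> u \<in> genideal A (set Xs) \<longrightarrow> c \<otimes>\<^bsub>A\<^esub> u \<in> genideal A (set Xs)"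
proof -
  interpret A: local_noetherian A MA by fact
  have S: "noetherian_cring S" using CM unfolding cohen_macaulay_def noetherian_cring_def by blast
  interpret S: noetherian_cring S by fact
  have gs: "surjective_hom S A g"
    by (intro surjective_hom.intro ring_hom_cring.intro S.is_cring A.is_cring ring_hom_cring_axioms.intro
        surjective_hom_axioms.intro g surj)
  interpret g: surjective_hom S A g by fact
  \<comment> \<open>\<open>S\<close> may have further maximal ideals, so localisation at
    \<open>M\<close> is imitated by saturation; contractions of ideals of \<open>A\<close> are
    automatically saturated at \<open>M\<close>.\<close>
  define M where "M = g.pre MA"
  define K where "K = g.pre {\<zero>\<^bsub>A\<^esub>}"
  have Mm: "maximalideal M S" unfolding M_def by (rule g.pre_maximal[OF A.M_maximal])
  have M: "primeideal M S" using S.maximalideal_prime[OF Mm] .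
  have Mc: "M \<subseteq> carrier S" using S.ideal_sub[OF S.prime_ideal[OF M]] .
  have sat: "S.saturated M (g.pre J)" if J: "ideal J A" for J
  proof (rule S.saturatedI[OF g.pre_ideal[OF J]])
    fix s u assume s: "s \<in> carrier S - M" and u: "u \<in> carrier S" "s \<otimes>\<^bsub>S\<^esub> u \<in> g.pre J"
    have "g s \<in> carrier A - MA" using s by (auto simp: M_def g.mem_pre)
    moreover have "g s \<otimes>\<^bsub>A\<^esub> g u \<in> J" using s u by (simp add: g.mem_pre)
    ultimately have "g u \<in> J" using A.saturatedD[OF A.all_saturated[OF J]] u(1) by blast
    thus "u \<in> g.pre J" using u(1) by (simp add: g.mem_pre)
  qed
  have Ks: "S.saturated M K" unfolding K_def by (rule sat[OF A.zeroideal])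
  have Ki: "ideal K S" using S.saturated_ideal[OF Ks] .
  have KM: "K \<subseteq> M" unfolding K_def M_def by (rule g.ker_pre[OF A.M_ideal])
  have PM: "P \<subseteq> M" if P: "primeideal P S" "K \<subseteq> P" for P
  proof -
    have Pi: "primeideal (g ` P) A" using g.img_prime P unfolding K_def by blast
    have "g.pre (g ` P) \<subseteq> M" using A.prime_sub_M[OF Pi] unfolding M_def by (auto simp: g.pre_def)
    thus ?thesis using g.pre_img[OF S.prime_ideal[OF P(1)]] P(2) unfolding K_def by simp
  qed
  obtain n where n: "ideal_height S M n" "ideal_grade S M n" using CM Mm unfolding cohen_macaulay_def by blast
  obtain ys where ys: "length ys = n" "set ys \<subseteq> M" "regular_sequence S ys" using n(2) unfolding ideal_grade_def by blast
  have depth_ge: "S.depth_ge M (S.sat M {}) n" unfolding S.depth_ge_def using S.regular_sequence_imp_reg[OF M ys(2,3)] ys(1) by blast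
  have ht: "m \<le> n" if "S.prime_path P m M" for P m
    using S.prime_path_imp_prime_chain[OF that] n(1) unfolding ideal_height_def by blast
  have dimA: "krull_dim A (length xs)" and xsM: "set xs \<subseteq> MA"
    using sop by (simp_all add: system_of_parameters_def A.M_def)
  have xsc: "set xs \<subseteq> carrier A" using xsM A.M_sub by blast
  define zs where "zs = map (inv_into (carrier S) g) xs"
  have inv: "inv_into (carrier S) g v \<in> carrier S \<and> g (inv_into (carrier S) g v) = v" if "v \<in> carrier A" for v
    using that surj inv_into_into[of v g "carrier S"] f_inv_into_f[of v g "carrier S"] by auto
  have lz: "length zs = length xs" by (simp add: zs_def)
  have gz: "map g zs = xs" unfolding zs_def using inv xsc by (auto simp: subset_iff intro: map_idI)
  have zM: "set zs \<subseteq> M" unfolding zs_def M_def using inv xsc xsM by (auto simp: g.mem_pre subset_iff)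
  have only: "P = M" if P: "primeideal P S" "K \<subseteq> P" "set zs \<subseteq> P" "P \<subseteq> M" for P
  proof -
    have Pi: "primeideal (g ` P) A" using g.img_prime P unfolding K_def by blast
    have "set xs \<subseteq> g ` P" using gz P(3) by (metis image_mono set_map)
    hence "g ` P = MA" using A.parameters_only_prime[OF sop Pi] by blast
    thus ?thesis using g.pre_img[OF S.prime_ideal[OF P(1)]] P(2) unfolding K_def M_def by simp
  qed
  have equi1: "S.prime_path P (length xs) M" if P: "S.min_over K P" for P
    by (rule equidimensional_coheight(1)[OF S gs M _ eq dimA P[unfolded K_def]])
      (use PM in \<open>simp add: K_def\<close>)
  have equi2: "m \<le> length xs" if P: "S.min_over K P" "S.prime_path P m M" for P m
    by (rule equidimensional_coheight(2)[OF S gs M _ eq dimA P(1)[unfolded K_def] P(2)])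
      (use PM in \<open>simp add: K_def\<close>)
  obtain xs' c where xs': "length xs' = length zs" "\<forall>i < length zs. xs' ! i \<ominus>\<^bsub>S\<^esub> zs ! i \<in> K" "set xs' \<subseteq> M"
    and c: "c \<in> carrier S" "\<forall>P. S.min_over K P \<longrightarrow> c \<notin> P"
    and colon_killer: "\<forall>ns Xs x u. length ns = length zs \<and> (\<forall>n \<in> set ns. 0 < n) \<and>
       mset (Xs @ [x]) = mset (map2 (\<lambda>x n. x [^]\<^bsub>S\<^esub> (n::nat)) xs' ns) \<and> u \<in> carrier S \<and>
       x \<otimes>\<^bsub>S\<^esub> u \<in> S.sat M (K \<union> set Xs) \<longrightarrow> c \<otimes>\<^bsub>S\<^esub> u \<in> S.sat M (K \<union> set Xs)"
  proof -
    have "\<exists>xs' c. length xs' = length zs \<and> (\<forall>i < length zs. xs' ! i \<ominus>\<^bsub>S\<^esub> zs ! i \<in> K) \<and> set xs' \<subseteq> M \<and>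
      c \<in> carrier S \<and> (\<forall>P. S.min_over K P \<longrightarrow> c \<notin> P) \<and>
      (\<forall>ns Xs x u. length ns = length zs \<and> (\<forall>n \<in> set ns. 0 < n) \<and>
       mset (Xs @ [x]) = mset (map2 (\<lambda>x n. x [^]\<^bsub>S\<^esub> (n::nat)) xs' ns) \<and> u \<in> carrier S \<and>
       x \<otimes>\<^bsub>S\<^esub> u \<in> S.sat M (K \<union> set Xs) \<longrightarrow> c \<otimes>\<^bsub>S\<^esub> u \<in> S.sat M (K \<union> set Xs))"
    proof (rule S.cohen_macaulay_colon_killer[OF M Ks KM depth_ge])
      show "m \<le> n" if "S.prime_path P m M" for P m using ht[OF that] .
      show "S.prime_path P (length zs) M" if "S.min_over K P" for P using equi1[OF that] lz by simp
      show "m \<le> length zs" if "S.min_over K P" "S.prime_path P m M" for P m using equi2[OF that] lz by simp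
      show "set zs \<subseteq> M" by (rule zM)
      show "P = M" if "primeideal P S" "K \<subseteq> P" "set zs \<subseteq> P" "P \<subseteq> M" for P using only[OF that] .
    qed
    thus ?thesis by (elim exE conjE) (rule that)
  qed
  \<comment> \<open>A minimal prime of \<open>A\<close> pulls back to a prime minimal over
    \<open>K\<close>, and \<open>c\<close> avoids all of these.\<close>
  have c0: "g c \<in> ring_zero_compl A"
  proof -
    have "g c \<notin> T" if T: "minimal_prime A T" for T
    proof
      assume gc: "g c \<in> T"
      have Tp: "primeideal T A" and Tmin: "\<And>Q. primeideal Q A \<Longrightarrow> Q \<subseteq> T \<Longrightarrow> Q = T"
        using T by (auto simp: minimal_prime_def)
      have Ti: "ideal T A" using A.prime_ideal[OF Tp] .
      have "S.min_over K (g.pre T)"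
        unfolding S.min_over_def
      proof (intro conjI allI impI)
        show "primeideal (g.pre T) S" using g.pre_prime[OF Tp] .
        show "K \<subseteq> g.pre T" unfolding K_def by (rule g.ker_pre[OF Ti])
      next
        fix Q assume "primeideal Q S \<and> K \<subseteq> Q \<and> Q \<subseteq> g.pre T"
        hence Q: "primeideal Q S" "K \<subseteq> Q" "Q \<subseteq> g.pre T" by simp_all
        have "g ` Q \<subseteq> T" using Q(3) g.img_pre[OF A.ideal_sub[OF Ti]] by blast
        hence "g ` Q = T" using Tmin g.img_prime Q(1,2) unfolding K_def by blast
        thus "Q = g.pre T" using g.pre_img[OF S.prime_ideal[OF Q(1)]] Q(2) unfolding K_def by simp
      qed
      hence "c \<notin> g.pre T" using c(2) by blast
      thus False using gc c(1) by (simp add: g.mem_pre)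
    qed
    thus ?thesis using c(1) by (auto simp: ring_zero_compl_def)
  qed
  have x'c: "set xs' \<subseteq> carrier S" using xs'(3) Mc by blast
  have gx': "g (xs' ! i) = xs ! i" if i: "i < length xs" for i
  proof -
    have z: "zs ! i \<in> carrier S" "xs' ! i \<in> carrier S"
      using i lz zM Mc x'c xs'(1) by (metis nth_mem subsetD)+
    have "xs' ! i \<ominus>\<^bsub>S\<^esub> zs ! i \<in> K" using xs'(2) i lz by simp
    hence "g (xs' ! i) \<ominus>\<^bsub>A\<^esub> g (zs ! i) = \<zero>\<^bsub>A\<^esub>" using z by (simp add: K_def g.mem_pre g.hom_minus)
    hence "g (xs' ! i) = g (zs ! i)" using z A.r_right_minus_eq by simp
    also have "\<dots> = xs ! i" using arg_cong[OF gz, of "\<lambda>l. l ! i"] i lz by simp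
    finally show ?thesis .
  qed
  have "g c \<otimes>\<^bsub>A\<^esub> u \<in> genideal A (set Xs)"
    if a: "length ns = length xs" "\<forall>n \<in> set ns. (0::nat) < n"
      "mset (Xs @ [x]) = mset (map2 (\<lambda>x n. x [^]\<^bsub>A\<^esub> n) xs ns)" "u \<in> carrier A"
      "x \<otimes>\<^bsub>A\<^esub> u \<in> genideal A (set Xs)" for ns Xs x u
  proof -
    let ?L = "map2 (\<lambda>x n. x [^]\<^bsub>S\<^esub> n) xs' ns"
    have gL: "map g ?L = map2 (\<lambda>x n. x [^]\<^bsub>A\<^esub> n) xs ns"
    proof (rule nth_equalityI)
      fix i assume "i < length (map g ?L)"
      hence i: "i < length xs" "i < length ns" "i < length xs'" using lz xs'(1) by auto
      have "xs' ! i \<in> carrier S" using x'c nth_mem[OF i(3)] by blast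
      thus "map g ?L ! i = map2 (\<lambda>x n. x [^]\<^bsub>A\<^esub> n) xs ns ! i" using i gx'[OF i(1)] by (simp add: g.hom_power)
    qed (use lz xs'(1) in simp)
    have Lc: "set ?L \<subseteq> carrier S" using x'c by (auto dest!: set_zip_leftD)
    \<comment> \<open>The lifted powers are put in the order prescribed by \<open>Xs @ [x]\<close>,
      so that the killer found in \<open>S\<close> applies to them.\<close>
    obtain zs where zs: "mset zs = mset ?L" "map g zs = Xs @ [x]"
      using mset_map_lift[of "Xs @ [x]" g ?L] a(3) gL by metis
    have zc: "set zs \<subseteq> carrier S" using zs(1) Lc by (metis mset_eq_setD)
    have zne: "zs \<noteq> []" using zs(2) by auto
    define Ys where "Ys = butlast zs"
    define y where "y = last zs"
    have zsplit: "zs = Ys @ [y]" using zne by (simp add: Ys_def y_def)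
    have gY: "map g Ys = Xs" "g y = x" using zs(2) by (simp_all add: zsplit)
    have Yc: "set Ys \<subseteq> carrier S" "y \<in> carrier S" using zc by (auto simp: zsplit)
    obtain v where v: "v \<in> carrier S" "g v = u" using g.surjE[OF a(4)] by blast
    have KY: "K \<union> set Ys \<subseteq> carrier S" using S.ideal_sub[OF Ki] Yc by blast
    let ?N = "S.sat M (K \<union> set Ys)"
    have up: "K \<union> set Ys \<subseteq> ?N" by (rule S.sat_upper[OF KY])
    have gYs: "set Xs = g ` set Ys" using gY(1) by auto
    have Xc: "set Xs \<subseteq> carrier A" using gYs Yc g.surj by blast
    have "genideal A (set Xs) \<subseteq> g ` ?N"
      by (rule A.genideal_minimal[OF g.img_ideal[OF S.sat_ideal]]) (use gYs up in blast)
    hence "g (y \<otimes>\<^bsub>S\<^esub> v) \<in> g ` ?N" using a(5) gY(2) v Yc(2) by auto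
    hence "y \<otimes>\<^bsub>S\<^esub> v \<in> ?N" using g.img_memD[OF S.sat_ideal] up v Yc(2) unfolding K_def by blast
    moreover have "mset (Ys @ [y]) = mset ?L" using zs(1) zsplit by simp
    ultimately have cv: "c \<otimes>\<^bsub>S\<^esub> v \<in> ?N" using colon_killer a(1,2) lz v(1) by metis
    have "?N \<subseteq> g.pre (genideal A (set Xs))"
    proof (rule S.sat_least[OF sat[OF A.genideal_ideal[OF Xc]]])
      have "K \<subseteq> g.pre (genideal A (set Xs))" unfolding K_def by (rule g.ker_pre[OF A.genideal_ideal[OF Xc]])
      moreover have "z \<in> g.pre (genideal A (set Xs))" if z: "z \<in> set Ys" for z
      proof -
        have "g z \<in> set Xs" using gYs z by blast
        hence "g z \<in> genideal A (set Xs)" using A.genideal_self[OF Xc] by blast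
        thus ?thesis using z Yc by (auto simp: g.mem_pre)
      qed
      ultimately show "K \<union> set Ys \<subseteq> g.pre (genideal A (set Xs))" by blast
    qed
    hence "g (c \<otimes>\<^bsub>S\<^esub> v) \<in> genideal A (set Xs)" using cv by (auto simp: g.mem_pre)
    thus ?thesis using c(1) v by simp
  qed
  thus ?thesis using c0 by blast
qed

locale local_char_p = local_noetherian + char_p_cring

sublocale local_char_p \<subseteq> char_p_local R p M
  by (intro char_p_local.intro char_p_local_axioms.intro noetherian_cring_axioms char_p_cring_axioms M_prime all_saturated)

context local_char_p
begin

lemma frob_power_Idl:
  assumes T: "T \<subseteq> carrier R"
  shows "frob_power R (Idl T) (p ^ e) = Idl ((\<lambda>x. x [^] (p ^ e)) ` T)"
proof
  have im: "(\<lambda>x. x [^] (p ^ e)) ` T \<subseteq> carrier R" using T by auto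
  show "frob_power R (Idl T) (p ^ e) \<subseteq> Idl ((\<lambda>x. x [^] (p ^ e)) ` T)"
    by (rule frob_power_least[OF genideal_ideal[OF im]], rule frobenius_Idl[OF T genideal_ideal[OF im]])
      (use genideal_self[OF im] in auto)
  show "Idl ((\<lambda>x. x [^] (p ^ e)) ` T) \<subseteq> frob_power R (Idl T) (p ^ e)"
    by (rule genideal_minimal[OF frob_power_ideal[OF ideal_sub[OF genideal_ideal[OF T]]]])
      (use genideal_self[OF T] frob_power_mem[OF ideal_sub[OF genideal_ideal[OF T]]] in auto)
qed

text \<open>A prime \<open>P\<close> with a chain of full length up to \<open>M\<close> gives, by
  \<open>parameter_powers_chain\<close>, an ideal above both \<open>P\<close> and the Frobenius
  power over which there is already a chain of the required length.\<close>

lemma quot_length_frob_power_ge: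
  assumes sop: "system_of_parameters R xs"
  shows "enat ((p ^ e) ^ length xs) \<le> quot_length R (frob_power R (Idl (set xs)) (p ^ e))"
proof -
  have dim: "krull_dim R (length xs)" and xsM: "set xs \<subseteq> M"
    using sop by (simp_all add: system_of_parameters_def M_def)
  have xsc: "set xs \<subseteq> carrier R" using xsM M_sub by blast
  obtain P where P: "prime_path P (length xs) M" using dimension_chain[OF dim] by blast
  have only: "P' = M" if "primeideal P' R" "P \<subseteq> P'" "set xs \<subseteq> P'" "P' \<subseteq> M" for P'
    using parameters_only_prime[OF sop that(1,3)] .
  obtain I where I: "saturated M I" "P \<subseteq> I" "(\<lambda>y. y [^] (p ^ e)) ` set xs \<subseteq> I" "saturated_chain M I ((p ^ e) ^ length xs) (carrier R)"
  proof -
    have "\<exists>I. saturated M I \<and> P \<subseteq> I \<and> (\<lambda>y. y [^] (p ^ e)) ` set xs \<subseteq> I \<and> saturated_chain M I ((p ^ e) ^ length xs) (carrier R)"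
    proof (rule parameter_powers_chain[OF P xsM])
      show "P' = M" if "primeideal P' R" "P \<subseteq> P'" "set xs \<subseteq> P'" "P' \<subseteq> M" for P' using only[OF that] .
    qed
    thus ?thesis by (elim exE conjE) (rule that)
  qed
  obtain c where c: "ideal_chain R I c ((p ^ e) ^ length xs)" using saturated_chain_imp_ideal_chain[OF I(4,1)] by blast
  have "frob_power R (Idl (set xs)) (p ^ e) \<subseteq> I"
    unfolding frob_power_Idl[OF xsc] by (rule genideal_minimal[OF saturated_ideal[OF I(1)] I(3)])
  thus ?thesis using quot_length_ge[OF ideal_chain_mono[OF c]] by blast
qed

end

section \<open>Comparison of lengths\<close>

context coordinates
begin

text \<open>Otherwise Nakayama's lemma makes all inclusions between the ideals
  \<open>J + Mk k\<close> strict for \<open>k\<close> from \<open>d + 1\<close> down to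
  \<open>0\<close>, a chain of \<open>d + 1\<close> steps.\<close>

lemma Mk_sub_of_colength_le:
  assumes J: "saturated M J" "J0 \<subseteq> J" and len: "colength_le M J d" shows "Mk d \<subseteq> J"
proof (rule ccontr)
  assume no: "\<not> Mk d \<subseteq> J"
  define D where "D k = sat M (J \<union> Mk k)" for k
  have Jc: "J \<subseteq> carrier R" using ideal_sub[OF saturated_ideal[OF J(1)]] .
  have JMk: "J \<union> Mk k \<subseteq> carrier R" for k using Jc ideal_sub[OF Mk_ideal[of k]] by blast
  have up: "J \<union> Mk k \<subseteq> D k" for k unfolding D_def by (rule sat_upper[OF JMk])
  have sD: "saturated M (D k)" for k unfolding D_def by (rule saturated_sat)
  have mono: "D (Suc k) \<subseteq> D k" for k
    unfolding D_def by (rule sat_mono) (use Mk_dec[of k] in blast)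
  have strict: "D (Suc k) \<subset> D k" if k: "k \<le> d" for k
  proof -
    have "D (Suc k) \<noteq> D k"
    proof
      assume eq: "D (Suc k) = D k"
      have "Mk k \<subseteq> J"
      proof (rule nakayama[OF M J(1)])
        show "Mk k \<subseteq> carrier R" using JMk[of k] by blast
        fix E assume E: "saturated M E" "J \<subseteq> E" "\<And>p u. p \<in> M \<Longrightarrow> u \<in> Mk k \<Longrightarrow> p \<otimes> u \<in> E"
        have "Mk (Suc k) \<subseteq> E" by (rule Mk_Suc_least) (use E J(2) in blast)+
        hence "D (Suc k) \<subseteq> E" unfolding D_def using sat_least[OF E(1)] E(2) by simp
        thus "Mk k \<subseteq> E" using up[of k] eq by blast
      qed
      thus False using no Mk_antimono[OF k] by blast
    qed
    thus ?thesis using mono[of k] by blast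
  qed
  have "i \<le> Suc d \<Longrightarrow> saturated_chain M (D (Suc d)) i (D (Suc d - i))" for i
  proof (induction i)
    case 0 show ?case using saturated_chain_0 by simp
  next
    case (Suc i)
    have "Suc d - i = Suc (d - i)" using Suc.prems by simp
    hence "saturated_chain M (D (Suc d)) i (D (Suc (d - i)))" using Suc by simp
    thus ?case using saturated_chain_Suc[OF _ strict[of "d - i"] sD] by simp
  qed
  from this[of "Suc d"] have "saturated_chain M (D (Suc d)) (Suc d) (D 0)" by simp
  hence "Suc d \<le> d" using len sD[of "Suc d"] up[of "Suc d"] unfolding colength_le_def by blast
  thus False by simp
qed

end

context surjective_hom
begin

lemma quot_length_imp_colength_le:
  assumes T: "ideal T S" and len: "quot_length S T \<le> enat k" and R: "noetherian_cring R"
  shows "R.colength_le M (pre T) k"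
proof -
  interpret N: noetherian_cring R by fact
  have "n \<le> k" if I: "R.saturated M I" "pre T \<subseteq> I" and ch: "R.saturated_chain M I n K" for I n K
  proof -
    obtain c where c: "ideal_chain R I c n" using R.saturated_chain_imp_ideal_chain[OF ch I(1)] by blast
    have ci: "ideal (c i) R" "pre T \<subseteq> c i" "pre {\<zero>\<^bsub>S\<^esub>} \<subseteq> c i" if "i \<le> n" for i
      using c I(2) ker_pre[OF T] that by (auto simp: ideal_chain_def)
    have "ideal_chain S T (\<lambda>i. h ` c i) n"
      unfolding ideal_chain_def
    proof (intro conjI allI impI)
      fix i assume i: "i \<le> n"
      show "ideal (h ` c i) S" using img_ideal[OF ci(1)[OF i]] .
      show "T \<subseteq> h ` c i" using ci(2)[OF i] img_pre[OF S.ideal_sub[OF T]] by blast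
    next
      fix i assume i: "i < n"
      have "c i \<subset> c (Suc i)" using c i by (simp add: ideal_chain_def)
      thus "h ` c i \<subset> h ` c (Suc i)" using img_strict[OF ci(1) ci(1) ci(3)] i by simp
    qed
    hence "enat n \<le> enat k" using order_trans[OF quot_length_ge len] by blast
    thus ?thesis by simp
  qed
  thus ?thesis unfolding R.colength_le_def by blast
qed

lemma colength_le_imp_quot_length:
  assumes "local_noetherian R M" "R.colength_le M (pre T) k"
  shows "quot_length S T \<le> enat k"
proof (rule quot_length_le)
  interpret N: local_noetherian R M by fact
  fix c n assume c: "ideal_chain S T c n"
  have ci: "ideal (pre (c i)) R" if "i \<le> n" for i using pre_ideal c that by (simp add: ideal_chain_def)
  have sub: "T \<subseteq> c i" if "i \<le> n" for i using c that by (simp add: ideal_chain_def)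
  have "ideal_chain R (pre T) (\<lambda>i. pre (c i)) n"
    unfolding ideal_chain_def
  proof (intro conjI allI impI)
    fix i assume i: "i \<le> n"
    show "ideal (pre (c i)) R" using ci[OF i] .
    show "pre T \<subseteq> pre (c i)" using sub[OF i] by (auto simp: pre_def)
  next
    fix i assume i: "i < n"
    show "pre (c i) \<subset> pre (c (Suc i))"
      by (rule pre_strict) (use c i S.ideal_sub in \<open>auto simp: ideal_chain_def\<close>)
  qed
  from R.ideal_chain_imp_saturated_chain[OF this, of M] have "R.saturated_chain M (pre (c 0)) n (pre (c n))"
    using N.all_saturated[OF ci] by blast
  moreover have "R.saturated M (pre (c 0))" using N.all_saturated[OF ci] by blast
  moreover have "pre T \<subseteq> pre (c 0)" using sub[of 0] by (auto simp: pre_def)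
  ultimately show "n \<le> k" using assms(2) unfolding R.colength_le_def by blast
qed

end

section \<open>Comparison of the regular ring \<open>Q\<close> with its quotient
  \<open>B\<close>\<close>

locale tight_closure_comparison =
  A: local_char_p A MA p + Q: local_char_p Q MQ p + B: local_char_p B MB p + \<theta>: surjective_hom Q B \<theta>
  for A :: "('a, 'm) ring_scheme" and MA and p :: nat and Q :: "('b, 'n) ring_scheme" and MQ
    and B :: "('c, 'o) ring_scheme" and MB and \<theta> +
  fixes \<eta> :: "'a \<Rightarrow> 'b" and xs :: "'a list" and ys :: "'b list" and d e :: nat
  assumes sop: "system_of_parameters A xs"
    and Q_dim: "krull_dim Q (length xs)" and ys_len: "length ys = length xs"
    and ys_sub: "set ys \<subseteq> carrier Q" and MQ_gen: "MQ = genideal Q (set ys)"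
    and eta_hom: "\<eta> \<in> ring_hom A Q" and eta_M: "\<eta> ` MA \<subseteq> MQ"
    and d_def: "quot_length B (ext_ideal B (\<theta> \<circ> \<eta>) (tight_closure A p (genideal A (set xs)))) = enat d"
    and q_big: "p ^ e > d ^ length xs * length xs ^ (length xs - 1)"
    and len_ineq: "quot_length A (frob_power A (genideal A (set xs)) (p ^ e))
      \<le> quot_length B (ext_ideal B (\<theta> \<circ> \<eta>) (frob_power A (genideal A (set xs)) (p ^ e)))"
    and tc: "tight_closure A p (frob_power A (genideal A (set xs)) (p ^ e))
               = frob_power A (genideal A (set xs)) (p ^ e)"
begin

abbreviation "t \<equiv> length xs"
abbreviation "\<qq> \<equiv> genideal A (set xs)"
abbreviation "\<qq>t \<equiv> tight_closure A p \<qq>"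
abbreviation "\<qq>F \<equiv> frob_power A \<qq> (p ^ e)"

sublocale \<eta>: ring_hom_cring A Q \<eta>
  by (intro ring_hom_cring.intro A.is_cring Q.is_cring ring_hom_cring_axioms.intro eta_hom)

lemma xs_sub: "set xs \<subseteq> MA"
  using sop by (simp add: system_of_parameters_def A.M_def)

lemma xs_carrier: "set xs \<subseteq> carrier A"
  using xs_sub A.M_sub by blast

lemma qq_ideal: "ideal \<qq> A"
  using A.genideal_ideal[OF xs_carrier] .

lemma qq_carrier: "\<qq> \<subseteq> carrier A"
  using A.ideal_sub[OF qq_ideal] .

lemma qqt_carrier: "\<qq>t \<subseteq> carrier A"
  by (rule A.tight_closure_carrier)

lemma qqF_carrier: "\<qq>F \<subseteq> carrier A"
  using A.ideal_sub[OF A.frob_power_ideal[OF qq_carrier]] .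

lemma eta_image: "T \<subseteq> carrier A \<Longrightarrow> \<eta> ` T \<subseteq> carrier Q"
  by auto

lemma comp_image: "T \<subseteq> carrier A \<Longrightarrow> (\<theta> \<circ> \<eta>) ` T \<subseteq> carrier B"
  by auto

lemma ext_Q_ideal: "T \<subseteq> carrier A \<Longrightarrow> ideal (ext_ideal Q \<eta> T) Q"
  unfolding ext_ideal_def by (rule Q.genideal_ideal[OF eta_image])

lemma ext_B_ideal: "T \<subseteq> carrier A \<Longrightarrow> ideal (ext_ideal B (\<theta> \<circ> \<eta>) T) B"
  unfolding ext_ideal_def by (rule B.genideal_ideal[OF comp_image])

lemma ext_B_eq_image: "T \<subseteq> carrier A \<Longrightarrow> ext_ideal B (\<theta> \<circ> \<eta>) T = \<theta> ` ext_ideal Q \<eta> T"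
  unfolding ext_ideal_def by (simp add: \<theta>.img_Idl[OF eta_image] image_comp)

lemma ext_Q_generators: "ext_ideal Q \<eta> \<qq> = genideal Q (set (map \<eta> xs))"
proof
  have im: "set (map \<eta> xs) \<subseteq> carrier Q" using xs_carrier by auto
  have pi: "ideal {r \<in> carrier A. \<eta> r \<in> genideal Q (set (map \<eta> xs))} A"
    using Q.genideal_ideal[OF im]
    by (intro A.cring_idealI) (auto simp: Q.ideal_zero Q.ideal_add Q.ideal_mult)
  have "\<eta> r \<in> genideal Q (set (map \<eta> xs))" if "r \<in> set xs" for r
  proof -
    have "\<eta> r \<in> set (map \<eta> xs)" using that by simp
    thus ?thesis using Q.genideal_self[OF im] by blast
  qed
  hence "\<qq> \<subseteq> {r \<in> carrier A. \<eta> r \<in> genideal Q (set (map \<eta> xs))}"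
    by (intro A.genideal_minimal[OF pi]) (use xs_carrier in blast)
  thus "ext_ideal Q \<eta> \<qq> \<subseteq> genideal Q (set (map \<eta> xs))"
    unfolding ext_ideal_def by (intro Q.genideal_minimal[OF Q.genideal_ideal[OF im]]) blast
  have "set (map \<eta> xs) \<subseteq> \<eta> ` \<qq>" using A.genideal_self[OF xs_carrier] by auto
  thus "genideal Q (set (map \<eta> xs)) \<subseteq> ext_ideal Q \<eta> \<qq>"
    unfolding ext_ideal_def
    using Q.genideal_self[OF eta_image[OF qq_carrier]]
    by (intro Q.genideal_minimal[OF Q.genideal_ideal[OF eta_image[OF qq_carrier]]]) blast
qed

lemma closure_power:
  assumes "u \<in> \<qq>t" shows "u [^]\<^bsub>A\<^esub> (p ^ e) \<in> \<qq>F"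
  using A.power_tight_closure[OF qq_carrier assms, of e] tc by simp

text \<open>By Frobenius it is enough to test generators. For an element of \<open>\<qq>t\<close>
  itself, the power lies in the tight closure of \<open>\<qq>F\<close>, which is
  \<open>\<qq>F\<close> by \<open>tc\<close>.\<close>

lemma ext_B_power:
  assumes v: "v \<in> ext_ideal B (\<theta> \<circ> \<eta>) \<qq>t"
  shows "v [^]\<^bsub>B\<^esub> (p ^ e) \<in> ext_ideal B (\<theta> \<circ> \<eta>) \<qq>F"
proof (rule B.frobenius_Idl[OF comp_image[OF qqt_carrier] ext_B_ideal[OF qqF_carrier]])
  show "v \<in> genideal B ((\<theta> \<circ> \<eta>) ` \<qq>t)" using v by (simp add: ext_ideal_def)
  fix w assume "w \<in> (\<theta> \<circ> \<eta>) ` \<qq>t"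
  then obtain u where u: "u \<in> \<qq>t" "w = \<theta> (\<eta> u)" by auto
  have uc: "u \<in> carrier A" using u(1) qqt_carrier by blast
  have "w [^]\<^bsub>B\<^esub> (p ^ e) = (\<theta> \<circ> \<eta>) (u [^]\<^bsub>A\<^esub> (p ^ e))"
    using uc u(2) by (simp add: \<theta>.hom_power \<eta>.hom_pow)
  moreover have "(\<theta> \<circ> \<eta>) (u [^]\<^bsub>A\<^esub> (p ^ e)) \<in> (\<theta> \<circ> \<eta>) ` \<qq>F" using closure_power[OF u(1)] by blast
  ultimately show "w [^]\<^bsub>B\<^esub> (p ^ e) \<in> ext_ideal B (\<theta> \<circ> \<eta>) \<qq>F"
    using B.genideal_self[OF comp_image[OF qqF_carrier]] unfolding ext_ideal_def by auto
qed

text \<open>The base ideal \<open>J0\<close> is the zero ideal of \<open>Q\<close>, written in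
  saturated form.\<close>

sublocale coordinates Q MQ "Q.sat MQ {}" "\<lambda>i. ys ! i" t
proof (intro coordinates.intro coordinates_axioms.intro Q.noetherian_cring_axioms Q.M_prime Q.saturated_sat)
  show "ys ! i \<in> MQ" if "i < t" for i
    using that ys_len nth_mem[of i ys] Q.genideal_self[OF ys_sub] MQ_gen by auto
  show "Q.sat MQ {} \<subseteq> MQ" using Q.sat_least[OF Q.all_saturated[OF Q.M_ideal]] by simp
  have "set ys = (\<lambda>i. ys ! i) ` {..<t}" using ys_len by (auto simp: set_conv_nth)
  hence "set ys \<subseteq> Q.sat MQ (Q.sat MQ {} \<union> (\<lambda>i. ys ! i) ` {..<t})"
    using Q.sat_upper'[of _ "Q.sat MQ {} \<union> (\<lambda>i. ys ! i) ` {..<t}" MQ] ys_sub by blast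
  thus "MQ \<subseteq> Q.sat MQ (Q.sat MQ {} \<union> (\<lambda>i. ys ! i) ` {..<t})"
    using Q.genideal_minimal[OF Q.sat_ideal] MQ_gen by simp
qed

lemma sat_empty_least: "ideal J Q \<Longrightarrow> Q.sat MQ {} \<subseteq> J"
  using Q.sat_least[OF Q.all_saturated] by simp

abbreviation "preB \<equiv> \<theta>.pre (ext_ideal B (\<theta> \<circ> \<eta>) \<qq>t)"

lemma Mk_d_sub_preB: "Mk d \<subseteq> preB"
proof (rule Mk_sub_of_colength_le)
  have i: "ideal preB Q" by (rule \<theta>.pre_ideal[OF ext_B_ideal[OF qqt_carrier]])
  show "Q.saturated MQ preB" by (rule Q.all_saturated[OF i])
  show "Q.sat MQ {} \<subseteq> preB" by (rule sat_empty_least[OF i])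
  show "Q.colength_le MQ preB d"
    by (rule \<theta>.quot_length_imp_colength_le[OF ext_B_ideal[OF qqt_carrier] _ Q.noetherian_cring_axioms]) (simp add: d_def)
qed

text \<open>An element of order \<open>s \<le> d\<close> in the kernel would bound the length of \<open>B/\<qq>F B\<close> by
  \<open>d ^ t * t ^ (t - 1) * q ^ (t - 1)\<close>, which is less than \<open>q ^ t\<close>.\<close>

lemma kernel_sub_Mk: "\<theta>.pre {\<zero>\<^bsub>B\<^esub>} \<subseteq> Mk (Suc d)"
proof
  fix f assume f: "f \<in> \<theta>.pre {\<zero>\<^bsub>B\<^esub>}"
  have fc: "f \<in> carrier Q" and f0: "\<theta> f = \<zero>\<^bsub>B\<^esub>" using f by (auto simp: \<theta>.mem_pre)
  let ?K = "\<theta>.pre (ext_ideal B (\<theta> \<circ> \<eta>) \<qq>F)"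
  have FI: "ideal (ext_ideal B (\<theta> \<circ> \<eta>) \<qq>F) B" by (rule ext_B_ideal[OF qqF_carrier])
  have Ki: "ideal ?K Q" by (rule \<theta>.pre_ideal[OF FI])
  have Ks: "Q.saturated MQ ?K" by (rule Q.all_saturated[OF Ki])
  have fK: "f \<in> ?K" using \<theta>.ker_pre[OF FI] f by blast
  show "f \<in> Mk (Suc d)"
  proof (rule ccontr)
    assume no: "f \<notin> Mk (Suc d)"
    hence "f \<notin> Q.sat MQ {}" using J0_Mk by blast
    then obtain s where s: "f \<in> Mk s" "f \<notin> Mk (Suc s)" using order_exists[OF fc] by blast
    have sd: "s \<le> d"
    proof (rule ccontr)
      assume "\<not> s \<le> d"
      hence "Mk s \<subseteq> Mk (Suc d)" by (intro Mk_antimono) simp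
      thus False using s(1) no by blast
    qed
    \<comment> \<open>For \<open>t = 0\<close> the maximal ideal is zero and contains the kernel,
      contrary to the order of \<open>f\<close>. Positivity makes \<open>t - 1\<close> a true
      predecessor in the estimates below.\<close>
    have t0: "0 < t"
    proof (rule ccontr)
      assume "\<not> 0 < t"
      hence "MQ = genideal Q {}" using MQ_gen ys_len by simp
      hence "MQ \<subseteq> Mk (Suc s)" using Q.genideal_minimal[OF Mk_ideal] by simp
      moreover have "\<theta>.pre {\<zero>\<^bsub>B\<^esub>} \<subseteq> MQ"
      proof (rule Q.proper_sub_M)
        show "ideal (\<theta>.pre {\<zero>\<^bsub>B\<^esub>}) Q" by (rule \<theta>.pre_ideal[OF B.zeroideal])
        show "\<one>\<^bsub>Q\<^esub> \<notin> \<theta>.pre {\<zero>\<^bsub>B\<^esub>}"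
          using B.prime_one[OF B.M_prime] B.ideal_zero[OF B.M_ideal] by (auto simp: \<theta>.mem_pre)
      qed
      ultimately show False using f s(2) by blast
    qed
    let ?q = "p ^ e"
    \<comment> \<open>The d-th power of a generator lies in \<open>preB\<close>, and its further
      power with exponent \<open>?q\<close> in \<open>?K\<close>; with \<open>t\<close> generators
      the pigeonhole principle yields the degree \<open>t * (d * ?q)\<close>.\<close>
    have N: "Mk (t * (d * ?q)) \<subseteq> ?K"
    proof (rule Mk_pigeonhole[OF Ks sat_empty_least[OF Ki] t0])
      fix i assume i: "i < t"
      have yc: "ys ! i \<in> carrier Q" using i ys_len ys_sub nth_mem[of i ys] by auto
      have "mon (\<lambda>j. if j = i then d else 0) \<in> Mk (deg (\<lambda>j. if j = i then d else 0))" by (rule mon_Mk[OF refl])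
      hence "ys ! i [^]\<^bsub>Q\<^esub> d \<in> Mk d" using mon_single[OF i, of d] deg_single[OF i, of d] by simp
      hence "ys ! i [^]\<^bsub>Q\<^esub> d \<in> preB" using Mk_d_sub_preB by blast
      hence "\<theta> (ys ! i [^]\<^bsub>Q\<^esub> d) [^]\<^bsub>B\<^esub> ?q \<in> ext_ideal B (\<theta> \<circ> \<eta>) \<qq>F"
        by (intro ext_B_power) (simp add: \<theta>.mem_pre)
      thus "ys ! i [^]\<^bsub>Q\<^esub> (d * ?q) \<in> ?K"
        using yc by (simp add: \<theta>.mem_pre \<theta>.hom_power B.nat_pow_pow)
    qed
    have "Q.colength_le MQ ?K (s * (t * (d * ?q)) ^ (t - 1))"
      by (rule colength_le_hypersurface[OF s fK Ks sat_empty_least[OF Ki] N t0])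
    hence "quot_length B (ext_ideal B (\<theta> \<circ> \<eta>) \<qq>F) \<le> enat (s * (t * (d * ?q)) ^ (t - 1))"
      by (rule \<theta>.colength_le_imp_quot_length[OF Q.local_noetherian_axioms])
    hence "enat (?q ^ t) \<le> enat (s * (t * (d * ?q)) ^ (t - 1))"
      using A.quot_length_frob_power_ge[OF sop, of e] len_ineq by (meson order_trans)
    hence "?q ^ t \<le> s * (t * (d * ?q)) ^ (t - 1)" by simp
    also have "\<dots> \<le> d * (t * (d * ?q)) ^ (t - 1)" using sd by simp
    also have "\<dots> = (d * d ^ (t - 1) * t ^ (t - 1)) * ?q ^ (t - 1)"
      by (simp only: power_mult_distrib ac_simps)
    also have "d * d ^ (t - 1) = d ^ t" using t0 by (metis power_eq_if not_gr_zero)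
    also have "(d ^ t * t ^ (t - 1)) * ?q ^ (t - 1) < ?q * ?q ^ (t - 1)" using q_big A.p_power_pos[of e] by simp
    also have "\<dots> = ?q ^ t" using t0 by (cases t) simp_all
    finally show False by simp
  qed
qed

lemma preB_eq: "preB = ext_ideal Q \<eta> \<qq>t"
proof -
  let ?a = "ext_ideal Q \<eta> \<qq>t"
  have ai: "ideal ?a Q" by (rule ext_Q_ideal[OF qqt_carrier])
  have img: "ext_ideal B (\<theta> \<circ> \<eta>) \<qq>t = \<theta> ` ?a" by (rule ext_B_eq_image[OF qqt_carrier])
  have Md: "Mk d \<subseteq> ?a"
  proof (rule Q.nakayama[OF Q.M_prime Q.all_saturated[OF ai]])
    show "Mk d \<subseteq> carrier Q" using Q.ideal_sub[OF Mk_ideal] .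
    fix E assume E: "Q.saturated MQ E" "?a \<subseteq> E" "\<And>v u. v \<in> MQ \<Longrightarrow> u \<in> Mk d \<Longrightarrow> v \<otimes>\<^bsub>Q\<^esub> u \<in> E"
    have Ei: "ideal E Q" using Q.saturated_ideal[OF E(1)] .
    \<comment> \<open>Such an \<open>E\<close> contains the kernel, and this turns membership in
      \<open>preB\<close> into membership in \<open>E\<close>.\<close>
    have "Mk (Suc d) \<subseteq> E" by (rule Mk_Suc_least[OF E(1) sat_empty_least[OF Ei] E(3)])
    hence kE: "\<theta>.pre {\<zero>\<^bsub>B\<^esub>} \<subseteq> E" using kernel_sub_Mk by blast
    have "preB \<subseteq> E"
    proof
      fix u assume "u \<in> preB"
      hence "u \<in> carrier Q" "\<theta> u \<in> \<theta> ` E" using E(2) img by (auto simp: \<theta>.mem_pre)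
      thus "u \<in> E" by (rule \<theta>.img_memD[OF Ei kE])
    qed
    thus "Mk d \<subseteq> E" using Mk_d_sub_preB by blast
  qed
  have "\<theta>.pre {\<zero>\<^bsub>B\<^esub>} \<subseteq> ?a" using kernel_sub_Mk Mk_dec Md by blast
  thus ?thesis using \<theta>.pre_img[OF ai] img by simp
qed

lemma induced_iso:
  "induced_hom B (ext_ideal B (\<theta> \<circ> \<eta>) \<qq>t) \<theta> \<in> ring_iso (Q Quot ext_ideal Q \<eta> \<qq>t) (B Quot ext_ideal B (\<theta> \<circ> \<eta>) \<qq>t)"
  using \<theta>.induced_hom_iso[OF ext_B_ideal[OF qqt_carrier]] preB_eq by simp

text \<open>\<open>Mk d\<close> lies in \<open>preB\<close>, which is the extended ideal by
  \<open>preB_eq\<close>, so that ideal contains a power of every generator of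
  \<open>MQ\<close>.\<close>

lemma prime_over_extension:
  assumes P: "primeideal P Q" "ext_ideal Q \<eta> \<qq>t \<subseteq> P" shows "P = MQ"
proof
  show "P \<subseteq> MQ" by (rule Q.prime_sub_M[OF P(1)])
  have "y \<in> P" if y: "y \<in> set ys" for y
  proof -
    obtain i where i: "i < t" "y = ys ! i" using y ys_len by (auto simp: in_set_conv_nth)
    have "ys ! i [^]\<^bsub>Q\<^esub> d \<in> Mk d"
      using mon_Mk[OF refl, of "\<lambda>j. if j = i then d else 0"] mon_single[OF i(1), of d] deg_single[OF i(1), of d] by simp
    hence "y [^]\<^bsub>Q\<^esub> d \<in> P" using Mk_d_sub_preB preB_eq P(2) i(2) by blast
    thus ?thesis using Q.prime_pow[OF P(1)] y ys_sub by blast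
  qed
  thus "MQ \<subseteq> P" using Q.genideal_minimal[OF Q.prime_ideal[OF P(1)]] MQ_gen by blast
qed

text \<open>The generators \<open>ys\<close> show that \<open>Q\<close> has depth \<open>t\<close>,
  and by \<open>prime_over_extension\<close> the images of the parameters cut out only
  \<open>MQ\<close>; so \<open>parameters_regular\<close> applies. The premise identifies the
  extended tight closure with the ideal generated by these images.\<close>

lemma parameter_images_regular:
  assumes closed: "\<qq>t = \<qq>" shows "regular_sequence Q (map \<eta> xs)"
proof (rule Q.reg_imp_regular_sequence, rule Q.parameters_regular[OF Q.M_prime Q.saturated_sat])
  have "Q.reg MQ (Q.sat MQ {}) ys"
    by (rule Q.regular_generators_regular) (use Q_dim ys_len ys_sub MQ_gen in simp_all)
  thus "Q.depth_ge MQ (Q.sat MQ {}) (length (map \<eta> xs))" unfolding Q.depth_ge_def using ys_len by auto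
  show "set (map \<eta> xs) \<subseteq> MQ" using xs_sub eta_M by auto
  fix P assume P: "primeideal P Q" "set (map \<eta> xs) \<subseteq> P"
  have "ext_ideal Q \<eta> \<qq>t \<subseteq> P"
    using Q.genideal_minimal[OF Q.prime_ideal[OF P(1)] P(2)] closed ext_Q_generators by simp
  thus "P = MQ" by (rule prime_over_extension[OF P(1)])
qed

lemma ext_proper: "\<one>\<^bsub>Q\<^esub> \<notin> ext_ideal Q \<eta> \<qq>"
proof -
  have "set (map \<eta> xs) \<subseteq> MQ" using xs_sub eta_M by auto
  hence "ext_ideal Q \<eta> \<qq> \<subseteq> MQ" using Q.genideal_minimal[OF Q.M_ideal] ext_Q_generators by simp
  thus ?thesis using Q.prime_one[OF Q.M_prime] by blast
qed

lemma closed_if_colon_capturing: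
  assumes "equidimensional A" "cohen_macaulay S" "g \<in> ring_hom S A" "g ` carrier S = carrier A"
  shows "\<qq>t = \<qq>"
proof -
  obtain c where c: "c \<in> ring_zero_compl A"
    and colon_killer: "\<forall>ns Xs x u. length ns = length xs \<and> (\<forall>n \<in> set ns. 0 < n) \<and>
     mset (Xs @ [x]) = mset (map2 (\<lambda>x n. x [^]\<^bsub>A\<^esub> (n::nat)) xs ns) \<and> u \<in> carrier A \<and>
     x \<otimes>\<^bsub>A\<^esub> u \<in> genideal A (set Xs) \<longrightarrow> c \<otimes>\<^bsub>A\<^esub> u \<in> genideal A (set Xs)"
    using colon_capturing[OF A.local_noetherian_axioms sop assms] by (elim bexE) (rule that)
  show ?thesis
  proof (rule A.tight_closure_descent[OF xs_sub c _ _ A.p_power_pos])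
    show "tight_closure A p (genideal A ((\<lambda>x. x [^]\<^bsub>A\<^esub> (p ^ e)) ` set xs)) = genideal A ((\<lambda>x. x [^]\<^bsub>A\<^esub> (p ^ e)) ` set xs)"
      using tc A.frob_power_Idl[OF xs_carrier] by simp
    fix ns Xs x u
    assume "length ns = length xs" "\<forall>n \<in> set ns. (0::nat) < n"
      "mset (Xs @ [x]) = mset (map2 (\<lambda>x n. x [^]\<^bsub>A\<^esub> n) xs ns)" "u \<in> carrier A"
      "x \<otimes>\<^bsub>A\<^esub> u \<in> genideal A (set Xs)"
    thus "c \<otimes>\<^bsub>A\<^esub> u \<in> genideal A (set Xs)" by (intro colon_killer[rule_format]) (intro conjI)
  qed
qed

end

lemma quot_one_neq_zero:
  assumes "cring R" "ideal J R" "\<one>\<^bsub>R\<^esub> \<notin> J" shows "\<one>\<^bsub>R Quot J\<^esub> \<noteq> \<zero>\<^bsub>R Quot J\<^esub>"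
proof -
  interpret R: cring R by fact
  interpret J: ideal J R by fact
  have "J +>\<^bsub>R\<^esub> \<one>\<^bsub>R\<^esub> \<noteq> J" using J.rcos_const_imp_mem[OF R.one_closed] assms(3) by blast
  thus ?thesis by (simp add: FactRing_def)
qed

theorem theorem2p5:
  fixes A :: "'a ring" and Q :: "'b ring" and B :: "'c ring"
    and \<eta> :: "'a \<Rightarrow> 'b" and \<theta> :: "'b \<Rightarrow> 'c"
    and p t d e :: nat and xs :: "'a list"
  assumes p_prime: "Factorial_Ring.prime p"
    and A_loc: "noetherian_local_ring A" and A_char: "ring_char A = p"
    and A_dim: "krull_dim A t"
    and sop: "system_of_parameters A xs"
    and Q_reg: "regular_local_ring Q" and Q_dim: "krull_dim Q t" and Q_char: "ring_char Q = p"
    and B_loc: "noetherian_local_ring B" and B_char: "ring_char B = p"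
    and eta_loc: "local_hom A Q \<eta>" and theta_loc: "local_hom Q B \<theta>"
    and theta_surj: "\<theta> ` carrier Q = carrier B"
    and residue_iso: "induced_hom Q (max_ideal Q) \<eta>
                        \<in> ring_iso (A Quot max_ideal A) (Q Quot max_ideal Q)"
    and d_def: "quot_length B (ext_ideal B (\<theta> \<circ> \<eta>)
                   (tight_closure A p (Idl\<^bsub>A\<^esub> (set xs)))) = enat d"
    and q_big: "p ^ e > d ^ t * t ^ (t - 1)"
    and len_ineq: "quot_length B (ext_ideal B (\<theta> \<circ> \<eta>) (frob_power A (Idl\<^bsub>A\<^esub> (set xs)) (p ^ e)))
                     \<ge> quot_length A (frob_power A (Idl\<^bsub>A\<^esub> (set xs)) (p ^ e))"
    and tc: "tight_closure A p (frob_power A (Idl\<^bsub>A\<^esub> (set xs)) (p ^ e))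
               = frob_power A (Idl\<^bsub>A\<^esub> (set xs)) (p ^ e)"
  shows "induced_hom B (ext_ideal B (\<theta> \<circ> \<eta>) (tight_closure A p (Idl\<^bsub>A\<^esub> (set xs)))) \<theta>
           \<in> ring_iso (Q Quot ext_ideal Q \<eta> (tight_closure A p (Idl\<^bsub>A\<^esub> (set xs))))
                      (B Quot ext_ideal B (\<theta> \<circ> \<eta>) (tight_closure A p (Idl\<^bsub>A\<^esub> (set xs))))
       \<and> (\<forall>(S :: 'd ring) g. equidimensional A \<and> cohen_macaulay S \<and> g \<in> ring_hom S A
              \<and> g ` carrier S = carrier A \<longrightarrow>
            tight_closure A p (Idl\<^bsub>A\<^esub> (set xs)) = Idl\<^bsub>A\<^esub> (set xs)
            \<and> induced_hom B (ext_ideal B (\<theta> \<circ> \<eta>) (Idl\<^bsub>A\<^esub> (set xs))) \<theta>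
                \<in> ring_iso (Q Quot ext_ideal Q \<eta> (Idl\<^bsub>A\<^esub> (set xs)))
                           (B Quot ext_ideal B (\<theta> \<circ> \<eta>) (Idl\<^bsub>A\<^esub> (set xs)))
            \<and> complete_intersection TYPE('b) (Q Quot ext_ideal Q \<eta> (Idl\<^bsub>A\<^esub> (set xs)))
            \<and> complete_intersection TYPE('b) (B Quot ext_ideal B (\<theta> \<circ> \<eta>) (Idl\<^bsub>A\<^esub> (set xs))))"

proof -
  have lA: "local_noetherian A (max_ideal A)" and lB: "local_noetherian B (max_ideal B)"
    using noetherian_local_ringD A_loc B_loc by blast+
  have lQ: "local_noetherian Q (max_ideal Q)"
    using noetherian_local_ringD Q_reg unfolding regular_local_ring_def by blast
  interpret lA: local_noetherian A "max_ideal A" by (rule lA)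
  interpret lQ: local_noetherian Q "max_ideal Q" by (rule lQ)
  interpret lB: local_noetherian B "max_ideal B" by (rule lB)
  have len: "length xs = t" using krull_dim_unique[OF _ A_dim] sop unfolding system_of_parameters_def by blast
  obtain ys where ys: "krull_dim Q (length ys)" "set ys \<subseteq> carrier Q" "max_ideal Q = genideal Q (set ys)"
    using Q_reg unfolding regular_local_ring_def by blast
  have ylen: "length ys = length xs" using krull_dim_unique[OF ys(1) Q_dim] len by simp
  interpret tight_closure_comparison A "max_ideal A" p Q "max_ideal Q" B "max_ideal B" \<theta> \<eta> xs ys d e
  proof (intro tight_closure_comparison.intro tight_closure_comparison_axioms.intro local_char_p.intro
      lA lQ lB char_p_cring.intro char_p_cring_axioms.intro lA.is_cring lB.is_cring lQ.is_cring
      surjective_hom.intro ring_hom_cring.intro ring_hom_cring_axioms.intro surjective_hom_axioms.intro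
      p_prime ring_char_prime[OF A_char p_prime] ring_char_prime[OF Q_char p_prime]
      ring_char_prime[OF B_char p_prime] sop ylen ys(2,3) theta_surj tc len_ineq d_def)
    show "\<theta> \<in> ring_hom Q B" using theta_loc by (simp add: local_hom_def)
    show "\<eta> \<in> ring_hom A Q" "\<eta> ` max_ideal A \<subseteq> max_ideal Q" using eta_loc by (simp_all add: local_hom_def)
    show "krull_dim Q (length xs)" using Q_dim len by simp
    show "d ^ length xs * length xs ^ (length xs - 1) < p ^ e" using q_big len by simp
  qed
  show ?thesis
  proof (rule conjI[OF induced_iso], intro allI impI, elim conjE)
    fix S :: "'d ring" and g
    assume *: "equidimensional A" "cohen_macaulay S" "g \<in> ring_hom S A" "g ` carrier S = carrier A"
    have closed: "\<qq>t = \<qq>" by (rule closed_if_colon_capturing[OF *])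
    let ?QQ = "Q Quot ext_ideal Q \<eta> \<qq>" and ?BB = "B Quot ext_ideal B (\<theta> \<circ> \<eta>) \<qq>"
    have Qi: "ideal (ext_ideal Q \<eta> \<qq>) Q" and Bi: "ideal (ext_ideal B (\<theta> \<circ> \<eta>) \<qq>) B"
      using ext_Q_ideal ext_B_ideal qq_carrier by blast+
    have iso: "induced_hom B (ext_ideal B (\<theta> \<circ> \<eta>) \<qq>) \<theta> \<in> ring_iso ?QQ ?BB"
      using induced_iso closed by simp
    have reg: "regular_sequence Q (map \<eta> xs)" by (rule parameter_images_regular[OF closed])
    have pre: "\<theta>.pre (ext_ideal B (\<theta> \<circ> \<eta>) \<qq>) = ext_ideal Q \<eta> \<qq>" using preB_eq closed by simp
    have nB: "\<one>\<^bsub>B\<^esub> \<notin> ext_ideal B (\<theta> \<circ> \<eta>) \<qq>"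
      using ext_proper pre \<theta>.mem_pre[of "\<one>\<^bsub>Q\<^esub>" "ext_ideal B (\<theta> \<circ> \<eta>) \<qq>"] by simp
    have locQ: "local_ring ?QQ"
      by (rule local_ring_image[OF lQ quotient_surjective_hom[OF lQ.is_cring Qi]
            quot_one_neq_zero[OF lQ.is_cring Qi ext_proper]])
    have locB: "local_ring ?BB"
      by (rule local_ring_image[OF lB quotient_surjective_hom[OF lB.is_cring Bi]
            quot_one_neq_zero[OF lB.is_cring Bi nB]])
    \<comment> \<open>Both complete intersections are presented by \<open>Q\<close> itself and the
      sequence \<open>map \<eta> xs\<close>, which generates the extension of \<qq>.\<close>
    have isoQ: "is_ring_iso (Q Quot genideal Q (set (map \<eta> xs))) ?QQ"
      using ring_iso_set_refl[of ?QQ] ext_Q_generators unfolding is_ring_iso_def by auto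
    have isoB: "is_ring_iso (Q Quot genideal Q (set (map \<eta> xs))) ?BB"
      using iso ext_Q_generators unfolding is_ring_iso_def by auto
    have ciQ: "complete_intersection TYPE('b) ?QQ"
      unfolding complete_intersection_def using locQ Q_reg reg isoQ by blast
    have ciB: "complete_intersection TYPE('b) ?BB"
      unfolding complete_intersection_def using locB Q_reg reg isoB by blast
    show "\<qq>t = \<qq> \<and> induced_hom B (ext_ideal B (\<theta> \<circ> \<eta>) \<qq>) \<theta> \<in> ring_iso ?QQ ?BB \<and>
        complete_intersection TYPE('b) ?QQ \<and> complete_intersection TYPE('b) ?BB"
      by (intro conjI closed iso ciQ ciB)
  qed
qed

end
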